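(* Let $K$ be a long knot, with component labelled $1$, and let $$\varphi(K)=\left(\begin{array}{c|c}\omega & x_1\\ \hline y_1 & 1\end{array}\right)$$ be its invariant in $\Gamma$-calculus. Let $\widetilde K$ be the closed knot obtained by closing the open component of $K$ trivially. Then, writing $t=t_1$, $$\omega\doteq\Delta_{\widetilde K}(t),$$ where $\Delta_{\widetilde K}(t)$ is the Alexander polynomial of $\widetilde K$ and $\doteq$ means equality up to multiplication by $\pm t^n$, $n\in\mathbb{Z}$.
   Context: A long knot is an ordinary (no virtual crossings) one-component open knot, viewed via a diagram as a w-tangle with one strand. W-tangles. A w-tangle diagram labelled by a finite set $X$ is a finite collection of oriented arcs (no closed components), bijectively labelled by $X$, drawn in the plane with finitely many transverse double points, each virtual, positive or negative, up to planar isotopy, the position of endpoints being immaterial. A w-tangle is an equivalence class modulo R2, R3, the purely virtual moves VR1–VR3, the mixed moves M (arcs having only virtual crossings may be moved across real crossings), and OC (two consecutive overpasses of an arc may be exchanged); R1 is not imposed. Operations: $m^{x,y}_z$ connects the head of strand $x$ to the tail of strand $y$ (creating only virtual crossings) and calls the result $z$; $e_x$ adds a crossingless strand $x$; $\sqcup$ is disjoint union; $\sigma^x_z$ relabels. $R_{i,j}^{\pm}$ is the two-strand w-tangle with one real crossing of sign $\pm$ with strand $i$ over strand $j$. Every w-tangle is obtained from a disjoint union of crossings and trivial strands by stitching. $\Gamma$-calculus. An element labelled by $X$ is a pair $(\omega,M)$ with $\omega\in\mathbb{Q}(t_i:i\in X)$ and $M$ an $X\times X$ matrix over this field (rows $y_i$,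 columns $x_j$) with $M|_{t_i\to1}=I$. Operations: $e_a$ sends $(\omega,M)$ to $(\omega,(1)\oplus M)$; $(\omega_1,M_1)\sqcup(\omega_2,M_2)=(\omega_1\omega_2,M_1\oplus M_2)$; $\sigma^a_b$ renames $x_a,y_a,t_a$ to $x_b,y_b,t_b$; and, if the entries in rows $y_a,y_b,y_S$ and columns $x_a,x_b,x_S$ are $\left(\begin{smallmatrix}\alpha&\beta&\theta\\ \gamma&\delta&\epsilon\\ \phi&\psi&\Xi\end{smallmatrix}\right)$, then $m^{a,b}_c$ produces scalar $(1-\gamma)\omega$ and matrix (rows $y_c,y_S$, columns $x_c,x_S$) $\begin{pmatrix}\beta+\frac{\alpha\delta}{1-\gamma}&\theta+\frac{\alpha\epsilon}{1-\gamma}\\ \psi+\frac{\delta\phi}{1-\gamma}&\Xi+\frac{\phi\epsilon}{1-\gamma}\end{pmatrix}$, with $t_a,t_b\to t_c$ substituted everywhere. The invariant $\varphi$ of w-tangles is the map compatible with all these operations determined by: $\varphi(R_{a,b}^{\pm})$ has scalar part $1$ and matrix part (rows $y_a,y_b$, columns $x_a,x_b$) $\begin{pmatrix}1&1-t_a^{\pm1}\\0&t_a^{\pm1}\end{pmatrix}$. For a one-strand w-tangle the matrix part is always $(1)$. *)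

theory Defs
  imports
    "HOL-Library.Poly_Mapping"
    "HOL-Library.Multiset"
    "HOL-Computational_Algebra.Fraction_Field"
    "HOL-Combinatorics.Orbits"
    "Jordan_Normal_Form.Determinant"
    "Jordan_Normal_Form.DL_Submatrix"
begin

section \<open>W-tangle diagrams\<close>

text \<open>
  A w-tangle diagram is recorded by its Gauss diagram: for every strand label, the list of passages
  through the real crossings met along the strand from tail to head.  Virtual crossings leave
  no trace, and a plane diagram is determined by its Gauss diagram up to planar isotopy, the position
  of the endpoints, and the moves VR1--VR3 and M.
  A passage carries the name of its crossing, whether it is the upper passage, and whether the
  crossing is positive.
\<close>

datatype pass = Pass (crossing: nat) (is_over: bool) (is_pos: bool)

abbreviation over_pass :: "nat \<Rightarrow> bool \<Rightarrow> pass" where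
  "over_pass p s \<equiv> Pass p True s"

abbreviation under_pass :: "nat \<Rightarrow> bool \<Rightarrow> pass" where
  "under_pass p s \<equiv> Pass p False s"

type_synonym wdiagram = "nat \<Rightarrow> pass list option"

definition passes :: "wdiagram \<Rightarrow> pass multiset" where
  "passes D = (\<Sum>x\<in>dom D. mset (the (D x)))"

definition crossings :: "wdiagram \<Rightarrow> nat set" where
  "crossings D = crossing ` (\<Union>x\<in>dom D. set (the (D x)))"

definition wf_diagram :: "wdiagram \<Rightarrow> bool" where
  "wf_diagram D \<longleftrightarrow> finite (dom D) \<and>
     (\<forall>p\<in>crossings D. \<exists>s. filter_mset (\<lambda>v. crossing v = p) (passes D)
        = {#over_pass p s, under_pass p s#})"

definition crossing_diagram :: "nat \<Rightarrow> nat \<Rightarrow> nat \<Rightarrow> bool \<Rightarrow> wdiagram" where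
  "crossing_diagram a b p s = [a \<mapsto> [over_pass p s], b \<mapsto> [under_pass p s]]"

definition add_strand :: "nat \<Rightarrow> wdiagram \<Rightarrow> wdiagram" where
  "add_strand a D = D(a \<mapsto> [])"

definition stitch :: "nat \<Rightarrow> nat \<Rightarrow> nat \<Rightarrow> wdiagram \<Rightarrow> wdiagram" where
  "stitch a b c D = (D(a := None, b := None))(c \<mapsto> the (D a) @ the (D b))"

definition relabel :: "nat \<Rightarrow> nat \<Rightarrow> wdiagram \<Rightarrow> wdiagram" where
  "relabel a b D = (D(a := None))(b \<mapsto> the (D a))"

definition rename_crossings :: "(nat \<Rightarrow> nat) \<Rightarrow> wdiagram \<Rightarrow> wdiagram" where
  "rename_crossings f D =
     (\<lambda>x. map_option (map (\<lambda>v. Pass (f (crossing v)) (is_over v) (is_pos v))) (D x))"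

text \<open>
  Crossing names may be changed at will, so requiring them to be disjoint loses no generality.
\<close>

definition can_union :: "wdiagram \<Rightarrow> wdiagram \<Rightarrow> bool" where
  "can_union D E \<longleftrightarrow> dom D \<inter> dom E = {} \<and> crossings D \<inter> crossings E = {}"

definition can_stitch :: "nat \<Rightarrow> nat \<Rightarrow> nat \<Rightarrow> wdiagram \<Rightarrow> bool" where
  "can_stitch a b c D \<longleftrightarrow> a \<in> dom D \<and> b \<in> dom D \<and> a \<noteq> b \<and> c \<notin> dom D - {a, b}"

definition can_relabel :: "nat \<Rightarrow> nat \<Rightarrow> wdiagram \<Rightarrow> bool" where
  "can_relabel a b D \<longleftrightarrow> a \<in> dom D \<and> b \<notin> dom D - {a}"

text \<open>
  The three strands of an R3 move, \<open>i\<close> over \<open>j\<close> over \<open>k\<close>; \<open>p\<close>, \<open>q\<close>, \<open>r\<close> are the crossings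
  \<open>ij\<close>, \<open>ik\<close>, \<open>jk\<close>.  The other side of the move has the order of the two
  passages reversed on every strand.  For \<open>m\<close>, \<open>u\<close>, \<open>v\<close>, \<open>w\<close> all true this is the braid-like move with
  positive crossings; reversing a strand (one of \<open>u\<close>, \<open>v\<close>, \<open>w\<close> false) reverses the order of its passages
  and changes the signs of its crossings, and reflecting the plane (\<open>m\<close> false) changes all signs.
\<close>

definition r3_side ::
    "bool \<Rightarrow> bool \<Rightarrow> bool \<Rightarrow> bool \<Rightarrow> bool \<Rightarrow> nat \<times> nat \<times> nat \<Rightarrow> nat \<times> nat \<times> nat \<Rightarrow> wdiagram" where
  "r3_side left m u v w = (\<lambda>(i, j, k) (p, q, r).
     let order = (\<lambda>e l. if e = left then l else rev l);
         sp = (m = (u = v)); sq = (m = (u = w)); sr = (m = (v = w))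
     in [i \<mapsto> order u [over_pass p sp, over_pass q sq],
         j \<mapsto> order v [under_pass p sp, over_pass r sr],
         k \<mapsto> order w [under_pass q sq, under_pass r sr]])"

text \<open>
  Equality of w-tangles, as a relation on diagrams.  A move takes place inside a larger diagram
  because the relation is a congruence for the operations: the larger diagram
  is a stitching of the local picture with the remaining strand pieces.
\<close>

inductive wequiv :: "wdiagram \<Rightarrow> wdiagram \<Rightarrow> bool" where
  refl: "wf_diagram D \<Longrightarrow> wequiv D D"
| sym: "wequiv D E \<Longrightarrow> wequiv E D"
| trans: "wequiv D E \<Longrightarrow> wequiv E F \<Longrightarrow> wequiv D F"
| rename: "wf_diagram D \<Longrightarrow> inj_on f (crossings D) \<Longrightarrow> wequiv D (rename_crossings f D)"
| R2_parallel: "a \<noteq> b \<Longrightarrow> p \<noteq> q \<Longrightarrow>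
    wequiv [a \<mapsto> [over_pass p s, over_pass q (\<not> s)], b \<mapsto> [under_pass p s, under_pass q (\<not> s)]]
           [a \<mapsto> [], b \<mapsto> []]"
| R2_antiparallel: "a \<noteq> b \<Longrightarrow> p \<noteq> q \<Longrightarrow>
    wequiv [a \<mapsto> [over_pass p s, over_pass q (\<not> s)], b \<mapsto> [under_pass q (\<not> s), under_pass p s]]
           [a \<mapsto> [], b \<mapsto> []]"
| R3: "distinct [i, j, k] \<Longrightarrow> distinct [p, q, r] \<Longrightarrow>
    wequiv (r3_side True m u v w (i, j, k) (p, q, r)) (r3_side False m u v w (i, j, k) (p, q, r))"
| OC: "distinct [a, b, c] \<Longrightarrow> p \<noteq> q \<Longrightarrow>
    wequiv [a \<mapsto> [over_pass p s, over_pass q s'], b \<mapsto> [under_pass p s], c \<mapsto> [under_pass q s']]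
           [a \<mapsto> [over_pass q s', over_pass p s], b \<mapsto> [under_pass p s], c \<mapsto> [under_pass q s']]"
| union: "wequiv D D' \<Longrightarrow> wequiv E E' \<Longrightarrow> can_union D E \<Longrightarrow> can_union D' E' \<Longrightarrow>
    wequiv (D ++ E) (D' ++ E')"
| stitch: "wequiv D D' \<Longrightarrow> can_stitch a b c D \<Longrightarrow> wequiv (stitch a b c D) (stitch a b c D')"
| relabel: "wequiv D D' \<Longrightarrow> can_relabel a b D \<Longrightarrow> wequiv (relabel a b D) (relabel a b D')"


section \<open>Gamma-calculus\<close>

text \<open>
  The field of rational functions over the rationals in the variables \<open>t\<^sub>0, t\<^sub>1, \<dots>\<close>.
\<close>

type_synonym mpoly = "(nat \<Rightarrow>\<^sub>0 nat) \<Rightarrow>\<^sub>0 rat"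
type_synonym ratfun = "mpoly fract"

definition tvar :: "nat \<Rightarrow> ratfun" where
  "tvar i = Fract (Poly_Mapping.single (Poly_Mapping.single i 1) 1) 1"

definition subst_poly :: "(nat \<Rightarrow> nat) \<Rightarrow> mpoly \<Rightarrow> mpoly" where
  "subst_poly f P = (\<Sum>m\<in>Poly_Mapping.keys P.
     Poly_Mapping.single
       (\<Sum>i\<in>Poly_Mapping.keys m. Poly_Mapping.single (f i) (Poly_Mapping.lookup m i))
       (Poly_Mapping.lookup P m))"

text \<open>
  The substitution \<open>t\<^sub>i \<rightarrow> t\<^bsub>f i\<^esub>\<close>, meaningful for rational functions having a representation whose
  denominator does not become zero.  This covers everything regular at \<open>t = 1\<close>.
\<close>

definition subst :: "(nat \<Rightarrow> nat) \<Rightarrow> ratfun \<Rightarrow> ratfun" where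
  "subst f r = (THE s. \<exists>P Q. r = Fract P Q \<and> subst_poly f Q \<noteq> 0 \<and>
     s = Fract (subst_poly f P) (subst_poly f Q))"

text \<open>
  \<open>Gelem X \<omega> M\<close> is the element \<open>(\<omega>, M)\<close> labelled by \<open>X\<close>; \<open>M i j\<close> is the entry in row \<open>y\<^sub>i\<close> and column
  \<open>x\<^sub>j\<close>, and \<open>M\<close> vanishes outside \<open>X \<times> X\<close>.  The condition that \<open>M\<close> becomes the identity
  at \<open>t = 1\<close> holds for the crossings and is preserved by the operations; it is what makes
  the denominators and substitutions in stitching legitimate.
\<close>

datatype gamma = Gelem (labels: "nat set") (scalar: ratfun) (mat_part: "nat \<Rightarrow> nat \<Rightarrow> ratfun")

definition gamma_empty :: gamma where
  "gamma_empty = Gelem {} 1 (\<lambda>i j. 0)"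

definition gamma_crossing :: "nat \<Rightarrow> nat \<Rightarrow> bool \<Rightarrow> gamma" where
  "gamma_crossing a b s =
     (let T = (if s then tvar a else inverse (tvar a))
      in Gelem {a, b} 1 (\<lambda>i j.
           if i = a \<and> j = a then 1
           else if i = a \<and> j = b then 1 - T
           else if i = b \<and> j = b then T
           else 0))"

fun gamma_e :: "nat \<Rightarrow> gamma \<Rightarrow> gamma" where
  "gamma_e a (Gelem X w M) = Gelem (insert a X) w (\<lambda>i j. if i = a \<and> j = a then 1 else M i j)"

fun gamma_union :: "gamma \<Rightarrow> gamma \<Rightarrow> gamma" where
  "gamma_union (Gelem X w M) (Gelem Y v N) = Gelem (X \<union> Y) (w * v)
     (\<lambda>i j. if i \<in> X \<and> j \<in> X then M i j else if i \<in> Y \<and> j \<in> Y then N i j else 0)"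

fun gamma_relabel :: "nat \<Rightarrow> nat \<Rightarrow> gamma \<Rightarrow> gamma" where
  "gamma_relabel a b (Gelem X w M) =
     (let Y = insert b (X - {a});
          old = (\<lambda>i. if i = b then a else i);
          sub = subst (\<lambda>i. if i = a then b else i)
      in Gelem Y (sub w) (\<lambda>i j. if i \<in> Y \<and> j \<in> Y then sub (M (old i) (old j)) else 0))"

text \<open>
  The four cases below are the four blocks of the stitched matrix: row \<open>y\<^sub>c\<close> arises from row \<open>y\<^sub>a\<close> and
  column \<open>x\<^sub>c\<close> from column \<open>x\<^sub>b\<close>.
\<close>

fun gamma_stitch :: "nat \<Rightarrow> nat \<Rightarrow> nat \<Rightarrow> gamma \<Rightarrow> gamma" where
  "gamma_stitch a b c (Gelem X w M) =
     (let S = X - {a, b};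
          \<alpha> = M a a; \<beta> = M a b; \<gamma> = M b a; \<delta> = M b b;
          sub = subst (\<lambda>i. if i = a \<or> i = b then c else i)
      in Gelem (insert c S) (sub ((1 - \<gamma>) * w)) (\<lambda>i j.
           if i = c \<and> j = c then sub (\<beta> + \<alpha> * \<delta> / (1 - \<gamma>))
           else if i = c \<and> j \<in> S then sub (M a j + \<alpha> * M b j / (1 - \<gamma>))
           else if i \<in> S \<and> j = c then sub (M i b + \<delta> * M i a / (1 - \<gamma>))
           else if i \<in> S \<and> j \<in> S then sub (M i j + M i a * M b j / (1 - \<gamma>))
           else 0))"

text \<open>
  The graph of the invariant: the least relation that contains the values on crossings, is compatible
  with all operations, and does not distinguish equal w-tangles.
\<close>

inductive phi_graph :: "wdiagram \<Rightarrow> gamma \<Rightarrow> bool" where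
  empty: "phi_graph Map.empty gamma_empty"
| crossing: "a \<noteq> b \<Longrightarrow> phi_graph (crossing_diagram a b p s) (gamma_crossing a b s)"
| strand: "phi_graph D \<zeta> \<Longrightarrow> a \<notin> dom D \<Longrightarrow> phi_graph (add_strand a D) (gamma_e a \<zeta>)"
| union: "phi_graph D \<zeta> \<Longrightarrow> phi_graph E \<eta> \<Longrightarrow> can_union D E \<Longrightarrow>
    phi_graph (D ++ E) (gamma_union \<zeta> \<eta>)"
| stitch: "phi_graph D \<zeta> \<Longrightarrow> can_stitch a b c D \<Longrightarrow>
    phi_graph (stitch a b c D) (gamma_stitch a b c \<zeta>)"
| relabel: "phi_graph D \<zeta> \<Longrightarrow> can_relabel a b D \<Longrightarrow>
    phi_graph (relabel a b D) (gamma_relabel a b \<zeta>)"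
| equiv: "phi_graph D \<zeta> \<Longrightarrow> wequiv D E \<Longrightarrow> phi_graph E \<zeta>"

definition phi :: "wdiagram \<Rightarrow> gamma" where
  "phi D = (THE \<zeta>. phi_graph D \<zeta>)"


section \<open>Long knots\<close>

text \<open>
  A long knot diagram is a generic line in the plane, equivalently a closed curve through
  infinity on the sphere.  Its underlying graph has the crossings and infinity as vertices.  If the
  code \<open>w\<close> has length \<open>N\<close>, edge \<open>e\<close> (for \<open>0 \<le> e \<le> N\<close>) ends at passage \<open>e\<close> and starts at
  passage \<open>e - 1\<close>, where edge \<open>0\<close> starts and edge \<open>N\<close> ends at infinity.  A dart is an edge with
  a direction of travel, \<open>True\<close> being forwards.  The code has no virtual crossings
  iff the cyclic orders of the darts prescribed by the signs give a surface of Euler characteristic 2.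
\<close>

definition mate :: "pass list \<Rightarrow> nat \<Rightarrow> nat" where
  "mate w k = (THE l. l < length w \<and> l \<noteq> k \<and> crossing (w ! l) = crossing (w ! k))"

text \<open>
  Seen along passage \<open>k\<close>, the other strand runs from right to left iff \<open>k\<close> is the upper passage of a
  positive crossing or the lower passage of a negative one.
\<close>

definition right_to_left :: "pass list \<Rightarrow> nat \<Rightarrow> bool" where
  "right_to_left w k \<longleftrightarrow> is_over (w ! k) = is_pos (w ! k)"

text \<open>Walking along the boundary of the face on the left: turn left at each crossing.\<close>

fun next_dart :: "pass list \<Rightarrow> nat \<times> bool \<Rightarrow> nat \<times> bool" where
  "next_dart w (e, True) =
     (if e = length w then (0, True)
      else if right_to_left w e then (Suc (mate w e), True)
      else (mate w e, False))"
| "next_dart w (e, False) =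
     (if e = 0 then (length w, False)
      else if right_to_left w (e - 1) then (mate w (e - 1), False)
      else (Suc (mate w (e - 1)), True))"

definition faces :: "pass list \<Rightarrow> (nat \<times> bool) set set" where
  "faces w = orbit (next_dart w) ` ({0..length w} \<times> UNIV)"

definition planar_code :: "pass list \<Rightarrow> bool" where
  "planar_code w \<longleftrightarrow>
     (let V = card (crossing ` set w) + 1; E = length w + 1; F = card (faces w)
      in int V - int E + int F = 2)"

definition long_knot :: "wdiagram \<Rightarrow> bool" where
  "long_knot K \<longleftrightarrow> wf_diagram K \<and> dom K = {1} \<and> planar_code (the (K 1))"


section \<open>Closed knots and the Alexander polynomial\<close>

text \<open>
  A closed knot diagram is given by its Gauss code read cyclically, so the trivial closure of a long
  knot has the same list as its code.
\<close>

type_synonym closed_diagram = "pass list"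

definition trivial_closure :: "wdiagram \<Rightarrow> closed_diagram" where
  "trivial_closure K = the (K 1)"

text \<open>
  Wirtinger arcs run from one underpassage to the next.  Arc \<open>0\<close> contains the base point, so
  the arc on which passage \<open>k\<close> is reached is numbered by the underpassages before it.
\<close>

definition num_arcs :: "closed_diagram \<Rightarrow> nat" where
  "num_arcs w = max 1 (length (filter (\<lambda>v. \<not> is_over v) w))"

definition wirtinger_arc :: "closed_diagram \<Rightarrow> nat \<Rightarrow> nat" where
  "wirtinger_arc w k = length (filter (\<lambda>v. \<not> is_over v) (take k w)) mod num_arcs w"

text \<open>Words in a free group: \<open>(g, True)\<close> is the generator \<open>x\<^sub>g\<close> and \<open>(g, False)\<close> its inverse.\<close>

type_synonym word = "(nat \<times> bool) list"

text \<open>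
  At a crossing of sign \<open>\<epsilon>\<close> with over-arc \<open>o\<close> the under-arcs \<open>a\<close> (incoming) and \<open>b\<close> (outgoing) satisfy
  \<open>x\<^sub>b = x\<^sub>o\<^sup>\<epsilon> x\<^sub>a x\<^sub>o\<^sup>-\<^sup>\<epsilon>\<close>.  The opposite convention for meridians or products replaces
  \<open>t\<close> by its inverse, which does not affect the Alexander polynomial up to units.
\<close>

definition wirtinger_relator :: "closed_diagram \<Rightarrow> nat \<Rightarrow> word" where
  "wirtinger_relator w k =
     (let s = is_pos (w ! k); ov = wirtinger_arc w (mate w k)
      in [(ov, s), (wirtinger_arc w k, True), (ov, \<not> s), (wirtinger_arc w (Suc k), False)])"

definition wirtinger_relators :: "closed_diagram \<Rightarrow> word list" where
  "wirtinger_relators w =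
     map (wirtinger_relator w) (filter (\<lambda>k. \<not> is_over (w ! k)) [0..<length w])"

text \<open>Laurent polynomials with integer coefficients, as the group ring of the integers.\<close>

type_synonym laurent = "int \<Rightarrow>\<^sub>0 int"

definition tpow :: "int \<Rightarrow> laurent" where
  "tpow n = Poly_Mapping.single n 1"

text \<open>The Fox derivative with respect to \<open>x\<^sub>j\<close>, with every generator sent to \<open>t\<close>.\<close>

fun fox :: "nat \<Rightarrow> word \<Rightarrow> laurent" where
  "fox j [] = 0"
| "fox j ((g, True) # u) = (if g = j then 1 else 0) + tpow 1 * fox j u"
| "fox j ((g, False) # u) = tpow (- 1) * (fox j u - (if g = j then 1 else 0))"

definition alexander_matrix :: "closed_diagram \<Rightarrow> laurent mat" where
  "alexander_matrix w = mat (length (wirtinger_relators w)) (num_arcs w)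
     (\<lambda>(i, j). fox j (wirtinger_relators w ! i))"

definition first_minors :: "closed_diagram \<Rightarrow> laurent set" where
  "first_minors w =
     {det (submatrix (alexander_matrix w) I J) | I J.
        I \<subseteq> {..<length (wirtinger_relators w)} \<and> J \<subseteq> {..<num_arcs w} \<and>
        card I = num_arcs w - 1 \<and> card J = num_arcs w - 1}"

text \<open>
  The Alexander polynomial generates the smallest principal ideal containing the first elementary
  ideal, that is, it is a greatest common divisor of the first minors.  It is
  determined up to units \<open>\<plusminus>t\<^sup>n\<close>.
\<close>

definition is_alexander_polynomial :: "closed_diagram \<Rightarrow> laurent \<Rightarrow> bool" where
  "is_alexander_polynomial w \<Delta> \<longleftrightarrow>
     (\<forall>d\<in>first_minors w. \<Delta> dvd d) \<and>
     (\<forall>g. (\<forall>d\<in>first_minors w. g dvd d) \<longrightarrow> g dvd \<Delta>)"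

definition alexander_polynomial :: "closed_diagram \<Rightarrow> laurent" where
  "alexander_polynomial w = (SOME \<Delta>. is_alexander_polynomial w \<Delta>)"

definition laurent_at :: "ratfun \<Rightarrow> laurent \<Rightarrow> ratfun" where
  "laurent_at t P =
     (\<Sum>k\<in>Poly_Mapping.keys P. of_int (Poly_Mapping.lookup P k) * t powi k)"

definition eq_up_to_units :: "ratfun \<Rightarrow> ratfun \<Rightarrow> ratfun \<Rightarrow> bool" where
  "eq_up_to_units t f g \<longleftrightarrow> (\<exists>n::int. f = t powi n * g \<or> f = - (t powi n * g))"

end

theory Submission
  imports Defs
begin

text \<open>
  Cutting a diagram at its undercrossings gives a linear system with one unknown per crossing, namely
  the value on the arc leaving it below, which is the Burau combination of the values on the two
  incoming arcs.  The \<open>\<Gamma>\<close>-calculus invariant is the pair of the determinant of this system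
  and its input-output matrix.  Stitching changes the system by a matrix of rank one, so the stitching
  formula is Cramer's rule; the denominators are legitimate because the system is nilpotent at \<open>t = 1\<close>.
  For a long knot, the system is the Wirtinger presentation on \<open>n + 1\<close> arcs with the column of the
  initial arc deleted.  In the planar case an Alexander numbering \<open>\<nu>\<close> of the faces exists, and the
  rows weighted by powers of \<open>t\<close> with exponents \<open>- \<nu>\<close> add up to a unit multiple of the coordinate row
  of the last arc.
  Hence the determinant agrees up to units with any of its cofactors along the last column, that
  is, with any first minor of the Alexander matrix of the closure.
\<close>

section \<open>Determinants over a finite index set\<close>

text \<open>\<open>phi\<close> is a definite description over \<open>phi_graph\<close>, so existence
  and uniqueness are both needed. Uniqueness: the determinant and the input-output matrix are
  computed from the Gauss diagram alone and obey every clause of \<open>phi_graph\<close>, the moves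
  included. Existence: every diagram is cut down to crossings and empty strands.

  \<open>subst\<close> behaves well only on fractions whose denominator survives the substitution.
  These form a local ring on which it is a homomorphism, and all quantities must be kept inside such
  rings. Evaluation at t = 1 is a second map of this kind; a determinant that is nonzero there stays
  nonzero under every replacement of variables by variables.

  The integral Alexander numbering is not obtained topologically. Counting functions on the faces
  requires finitely many values and so yields numberings modulo \<open>M\<close> only. The integral
  candidate is a signed count of crossings along the knot, and its consistency at a crossing is a
  congruence that becomes an equality because \<open>M\<close> exceeds every possible
  difference.\<close>

definition det_on :: "'a set \<Rightarrow> ('a \<Rightarrow> 'a \<Rightarrow> 'k) \<Rightarrow> 'k::comm_ring_1" where
  "det_on S A = (\<Sum>p | p permutes S. of_int (sign p) * (\<Prod>i\<in>S. A i (p i)))"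

lemma det_on_cong:
  assumes "\<And>i j. i \<in> S \<Longrightarrow> j \<in> S \<Longrightarrow> A i j = B i j"
  shows "det_on S A = det_on S B"
  unfolding det_on_def using assms
  by (auto intro!: sum.cong arg_cong2[where f = "(*)"] prod.cong simp: permutes_in_image)

text \<open>Systems are indexed by crossing names, which carry no order. Renaming crossings and
  passing to the Wirtinger numbering both change the index set; permutations are carried along by
  \<open>map_permutation\<close>, which preserves signs.\<close>

lemma det_on_bij:
  assumes "bij_betw f S S'" "finite S"
    and "\<And>i j. i \<in> S \<Longrightarrow> j \<in> S \<Longrightarrow> A' (f i) (f j) = A i j"
  shows "det_on S' A' = det_on S A"
proof -
  note inj = bij_betw_imp_inj_on[OF assms(1)]
  define g where "g = inv_into S f"
  have g: "bij_betw g S' S" "\<And>x. x \<in> S' \<Longrightarrow> f (g x) = x" "\<And>x. x \<in> S \<Longrightarrow> g (f x) = x"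
    using assms(1) unfolding g_def
    by (auto simp: bij_betw_inv_into bij_betw_inv_into_right bij_betw_inv_into_left)
  have bij: "bij_betw (map_permutation S f) {p. p permutes S} {p. p permutes S'}"
  proof (rule bij_betw_byWitness[where f' = "map_permutation S' g"])
    show "\<forall>p\<in>{p. p permutes S}. map_permutation S' g (map_permutation S f p) = p"
      using map_permutation_compose_inv[OF assms(1)] g(3) by auto
    show "\<forall>p\<in>{p. p permutes S'}. map_permutation S f (map_permutation S' g p) = p"
      using map_permutation_compose_inv[OF g(1)] g(2) by auto
    show "map_permutation S f ` {p. p permutes S} \<subseteq> {p. p permutes S'}"
      using map_permutation_permutes[OF assms(1)] by auto
    show "map_permutation S' g ` {p. p permutes S'} \<subseteq> {p. p permutes S}"
      using map_permutation_permutes[OF g(1)] by auto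
  qed
  have summand: "of_int (sign (map_permutation S f p)) * (\<Prod>i\<in>S'. A' i (map_permutation S f p i))
      = of_int (sign p) * (\<Prod>i\<in>S. A i (p i))" if p: "p permutes S" for p
  proof -
    have "(\<Prod>i\<in>S'. A' i (map_permutation S f p i))
        = (\<Prod>i\<in>S. A' (f i) (map_permutation S f p (f i)))"
      by (rule prod.reindex_bij_betw[OF assms(1), symmetric])
    also have "\<dots> = (\<Prod>i\<in>S. A i (p i))"
    proof (rule prod.cong)
      fix i assume i: "i \<in> S"
      show "A' (f i) (map_permutation S f p (f i)) = A i (p i)"
        unfolding map_permutation_apply[OF inj i]
        by (rule assms(3)) (use i permutes_in_image[OF p] in auto)
    qed simp
    finally show ?thesis
      unfolding sign_map_permutation[OF inj p assms(2)] by (rule arg_cong)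
  qed
  have "det_on S' A' = (\<Sum>p | p permutes S. of_int (sign (map_permutation S f p)) *
      (\<Prod>i\<in>S'. A' i (map_permutation S f p i)))"
    unfolding det_on_def by (rule sum.reindex_bij_betw[OF bij, symmetric])
  also have "\<dots> = det_on S A"
    unfolding det_on_def by (rule sum.cong) (auto simp: summand)
  finally show ?thesis .
qed

lemma det_on_mat: "det_on {0..<n} A = det (mat n n (\<lambda>(i, j). A i j))"
proof -
  have "(\<Prod>i\<in>{0..<n}. A i (p i)) = (\<Prod>i = 0..<n. mat n n (\<lambda>(i, j). A i j) $$ (i, p i))"
    if "p permutes {0..<n}" for p
    using permutes_in_image[OF that] by (intro prod.cong) auto
  hence "det_on {0..<n} A = (\<Sum>p | p permutes {0..<n}.
      signof p * (\<Prod>i = 0..<n. mat n n (\<lambda>(i, j). A i j) $$ (i, p i)))"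
    unfolding det_on_def by (intro sum.cong HOL.refl) simp
  also have "\<dots> = det (mat n n (\<lambda>(i, j). A i j))"
    by (rule det_def'[symmetric]) simp
  finally show ?thesis .
qed

lemma det_on_enum:
  assumes "bij_betw f {0..<n} S"
  shows "det_on S A = det (mat n n (\<lambda>(i, j). A (f i) (f j)))"
  by (subst det_on_bij[OF assms, of _ "\<lambda>i j. A (f i) (f j)"]) (auto simp: det_on_mat)

lemma finite_enum:
  assumes "finite S"
  obtains f where "bij_betw f {0..<card S} S"
  using ex_bij_betw_nat_finite[OF assms] by blast

lemma enum_obtain:
  assumes "bij_betw f {0..<n} S" "q \<in> S"
  obtains k where "k < n" "f k = q"
  using assms by (metis atLeastLessThan_iff bij_betw_imp_surj_on imageE)

text \<open>Kept free of division, so that it serves twice: to write solutions as quotients, and to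
  evaluate the determinant after a change of one column in \<open>stitching\<close>.\<close>

lemma det_on_cramer:
  assumes fin: "finite S" and q: "q \<in> S"
    and b: "\<And>p. p \<in> S \<Longrightarrow> (\<Sum>r\<in>S. A p r * x r) = b p"
  shows "det_on S (\<lambda>p r. if r = q then b p else A p r) = x q * det_on S A"
proof -
  obtain f where f: "bij_betw f {0..<card S} S" using finite_enum[OF fin] .
  let ?n = "card S"
  let ?A = "mat ?n ?n (\<lambda>(i, j). A (f i) (f j))" and ?x = "vec ?n (\<lambda>i. x (f i))"
  obtain k where k: "k < ?n" "f k = q" using enum_obtain[OF f q] .
  have fS: "f i \<in> S" if "i < ?n" for i using f that by (auto simp: bij_betw_def)
  have inj: "f i = q \<longleftrightarrow> i = k" if "i < ?n" for i
    using f that k by (auto simp: bij_betw_def inj_on_def)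
  have "(?A *\<^sub>v ?x) $ i = b (f i)" if "i < ?n" for i
    using that b[OF fS[OF that]]
    by (simp add: scalar_prod_def sum.reindex_bij_betw[OF f, of "\<lambda>r. A (f i) r * x r"])
  hence "replace_col ?A (?A *\<^sub>v ?x) k
      = mat ?n ?n (\<lambda>(i, j). (\<lambda>p r. if r = q then b p else A p r) (f i) (f j))"
    by (intro eq_matI) (auto simp: replace_col_def inj)
  thus ?thesis
    using cramer_lemma_mat[of ?A ?n ?x k] k by (simp add: det_on_enum[OF f])
qed

lemma det_on_eq_0_iff:
  fixes A :: "'a \<Rightarrow> 'a \<Rightarrow> 'k::field"
  assumes fin: "finite S"
  shows "det_on S A = 0 \<longleftrightarrow> (\<exists>x. (\<exists>p\<in>S. x p \<noteq> 0) \<and> (\<forall>p\<in>S. (\<Sum>r\<in>S. A p r * x r) = 0))"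
proof -
  obtain f where f: "bij_betw f {0..<card S} S" using finite_enum[OF fin] .
  let ?n = "card S"
  let ?A = "mat ?n ?n (\<lambda>(i, j). A (f i) (f j))"
  have fS: "f i \<in> S" if "i < ?n" for i using f that by (auto simp: bij_betw_def)
  have mult: "(?A *\<^sub>v v) $ i = (\<Sum>r\<in>S. A (f i) r * v $ (inv_into {0..<?n} f r))"
    if "i < ?n" "v \<in> carrier_vec ?n" for i v
  proof -
    have "(\<Sum>r\<in>S. A (f i) r * v $ (inv_into {0..<?n} f r))
       = (\<Sum>j\<in>{0..<?n}. A (f i) (f j) * v $ (inv_into {0..<?n} f (f j)))"
      by (rule sum.reindex_bij_betw[OF f, symmetric])
    also have "\<dots> = (\<Sum>j\<in>{0..<?n}. A (f i) (f j) * v $ j)"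
      by (rule sum.cong) (auto simp: bij_betw_inv_into_left[OF f])
    finally show ?thesis using that by (simp add: scalar_prod_def)
  qed
  have "det_on S A = 0 \<longleftrightarrow> (\<exists>v. v \<in> carrier_vec ?n \<and> v \<noteq> 0\<^sub>v ?n \<and> ?A *\<^sub>v v = 0\<^sub>v ?n)"
    unfolding det_on_enum[OF f] by (rule det_0_iff_vec_prod_zero_field) simp
  also have "\<dots> \<longleftrightarrow> (\<exists>x. (\<exists>p\<in>S. x p \<noteq> 0) \<and> (\<forall>p\<in>S. (\<Sum>r\<in>S. A p r * x r) = 0))"
  proof
    assume "\<exists>v. v \<in> carrier_vec ?n \<and> v \<noteq> 0\<^sub>v ?n \<and> ?A *\<^sub>v v = 0\<^sub>v ?n"
    then obtain v where v: "v \<in> carrier_vec ?n" "v \<noteq> 0\<^sub>v ?n" "?A *\<^sub>v v = 0\<^sub>v ?n" by blast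
    let ?x = "\<lambda>r. v $ (inv_into {0..<?n} f r)"
    obtain i where i: "i < ?n" "v $ i \<noteq> 0" using v(1,2) by (metis carrier_vecD eq_vecI index_zero_vec)
    hence "f i \<in> S" "?x (f i) \<noteq> 0" using fS by (auto simp: bij_betw_inv_into_left[OF f])
    moreover have "(\<Sum>r\<in>S. A p r * ?x r) = 0" if "p \<in> S" for p
    proof -
      obtain j where "j < ?n" "f j = p" using enum_obtain[OF f \<open>p \<in> S\<close>] .
      thus ?thesis using mult[of j v] v by simp
    qed
    ultimately show "\<exists>x. (\<exists>p\<in>S. x p \<noteq> 0) \<and> (\<forall>p\<in>S. (\<Sum>r\<in>S. A p r * x r) = 0)"
      by (intro exI[of _ ?x] conjI bexI[of _ "f i"] ballI)
  next
    assume "\<exists>x. (\<exists>p\<in>S. x p \<noteq> 0) \<and> (\<forall>p\<in>S. (\<Sum>r\<in>S. A p r * x r) = 0)"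
    then obtain x p where x: "p \<in> S" "x p \<noteq> 0" "\<forall>p\<in>S. (\<Sum>r\<in>S. A p r * x r) = 0" by blast
    let ?v = "vec ?n (\<lambda>i. x (f i))"
    obtain j where j: "j < ?n" "f j = p" using enum_obtain[OF f \<open>p \<in> S\<close>] .
    have "?v \<noteq> 0\<^sub>v ?n" using j x(2) by (metis index_vec index_zero_vec(1))
    moreover have "?A *\<^sub>v ?v = 0\<^sub>v ?n"
    proof (rule eq_vecI)
      fix i assume i: "i < dim_vec (0\<^sub>v ?n)"
      have "?v $ inv_into {0..<?n} f r = x r" if r: "r \<in> S" for r
      proof -
        obtain j where "j < ?n" "f j = r" using enum_obtain[OF f r] .
        thus ?thesis using bij_betw_inv_into_left[OF f, of j] by auto
      qed
      hence "(\<Sum>r\<in>S. A (f i) r * ?v $ inv_into {0..<?n} f r) = (\<Sum>r\<in>S. A (f i) r * x r)"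
        by (intro sum.cong) auto
      thus "(?A *\<^sub>v ?v) $ i = 0\<^sub>v ?n $ i" using mult[of i ?v] i x(3) fS[of i] by simp
    qed simp
    ultimately show "\<exists>v. v \<in> carrier_vec ?n \<and> v \<noteq> 0\<^sub>v ?n \<and> ?A *\<^sub>v v = 0\<^sub>v ?n"
      by (intro exI[of _ ?v]) auto
  qed
  finally show ?thesis .
qed

lemma det_on_solve:
  fixes A :: "'a \<Rightarrow> 'a \<Rightarrow> 'k::field"
  assumes fin: "finite S" and det: "det_on S A \<noteq> 0"
  shows "\<exists>x. \<forall>p\<in>S. (\<Sum>r\<in>S. A p r * x r) = b p"
proof -
  obtain f where f: "bij_betw f {0..<card S} S" using finite_enum[OF fin] .
  let ?n = "card S"
  let ?A = "mat ?n ?n (\<lambda>(i, j). A (f i) (f j))" and ?b = "vec ?n (\<lambda>i. b (f i))"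
  let ?d = "det ?A"
  define v where "v = (1 / ?d) \<cdot>\<^sub>v (adj_mat ?A *\<^sub>v ?b)"
  have d: "?d \<noteq> 0" using det by (simp add: det_on_enum[OF f])
  note adj = adj_mat[of ?A ?n, simplified]
  have v: "v \<in> carrier_vec ?n" using adj(1) by (simp add: v_def)
  have "?A *\<^sub>v v = (1 / ?d) \<cdot>\<^sub>v (?A *\<^sub>v (adj_mat ?A *\<^sub>v ?b))"
    unfolding v_def by (rule mult_mat_vec[of _ ?n ?n]) (use adj(1) in auto)
  also have "?A *\<^sub>v (adj_mat ?A *\<^sub>v ?b) = (?A * adj_mat ?A) *\<^sub>v ?b"
    by (rule assoc_mult_mat_vec[symmetric]) (use adj(1) in auto)
  also have "\<dots> = ?d \<cdot>\<^sub>v ?b" unfolding adj(2)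
    by (intro eq_vecI) auto
  finally have Av: "?A *\<^sub>v v = ?b" using d by (auto simp: smult_smult_assoc)
  define x where "x r = v $ (inv_into {0..<?n} f r)" for r
  have "(\<Sum>r\<in>S. A p r * x r) = b p" if "p \<in> S" for p
  proof -
    obtain i where i: "i < ?n" "f i = p" using enum_obtain[OF f \<open>p \<in> S\<close>] .
    have "(\<Sum>r\<in>S. A p r * x r) = (\<Sum>j\<in>{0..<?n}. A p (f j) * x (f j))"
      by (rule sum.reindex_bij_betw[OF f, symmetric])
    also have "\<dots> = (\<Sum>j\<in>{0..<?n}. A p (f j) * v $ j)"
      by (rule sum.cong) (auto simp: x_def bij_betw_inv_into_left[OF f])
    also have "\<dots> = (?A *\<^sub>v v) $ i" using i v by (simp add: scalar_prod_def)
    finally show ?thesis using Av i by simp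
  qed
  thus ?thesis by blast
qed

text \<open>Enumerating \<open>S\<close> before \<open>R\<close> makes the matrix block upper
  triangular, so a single vanishing block suffices.\<close>

lemma det_on_union:
  fixes A :: "'a \<Rightarrow> 'a \<Rightarrow> 'k::idom"
  assumes fin: "finite S" "finite R" and dis: "S \<inter> R = {}"
    and zero: "\<And>p q. p \<in> R \<Longrightarrow> q \<in> S \<Longrightarrow> A p q = 0"
  shows "det_on (S \<union> R) A = det_on S A * det_on R A"
proof -
  obtain f where f: "bij_betw f {0..<card S} S" using finite_enum[OF fin(1)] .
  obtain g where g: "bij_betw g {0..<card R} R" using finite_enum[OF fin(2)] .
  let ?n = "card S" and ?m = "card R"
  define h where "h i = (if i < ?n then f i else g (i - ?n))" for i
  have "bij_betw h ({0..<?n} \<union> {?n..<?n + ?m}) (S \<union> R)"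
  proof (rule bij_betw_combine)
    show "bij_betw h {0..<?n} S" using f by (subst bij_betw_cong[of _ _ f]) (auto simp: h_def)
    have "bij_betw (\<lambda>i. g (i - ?n)) {?n..<?n + ?m} R"
    proof (rule bij_betw_trans[OF _ g, unfolded comp_def])
      show "bij_betw (\<lambda>i. i - ?n) {?n..<?n + ?m} {0..<?m}"
        by (rule bij_betw_byWitness[where f' = "\<lambda>i. i + ?n"]) auto
    qed
    thus "bij_betw h {?n..<?n + ?m} R"
      by (subst bij_betw_cong[of _ _ "\<lambda>i. g (i - ?n)"]) (auto simp: h_def)
  qed (use dis in auto)
  hence h: "bij_betw h {0..<?n + ?m} (S \<union> R)"
    by (simp add: ivl_disj_un_two(3))
  have gR: "g i \<in> R" if "i < ?m" for i using g that by (auto simp: bij_betw_def)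
  have fS: "f i \<in> S" if "i < ?n" for i using f that by (auto simp: bij_betw_def)
  have "mat (?n + ?m) (?n + ?m) (\<lambda>(i, j). A (h i) (h j))
      = four_block_mat (mat ?n ?n (\<lambda>(i, j). A (f i) (f j))) (mat ?n ?m (\<lambda>(i, j). A (f i) (g j)))
          (0\<^sub>m ?m ?n) (mat ?m ?m (\<lambda>(i, j). A (g i) (g j)))"
    by (rule eq_matI) (auto simp: h_def zero gR fS)
  thus ?thesis unfolding det_on_enum[OF h] det_on_enum[OF f] det_on_enum[OF g]
    by (simp add: det_four_block_mat_lower_left_zero[of _ ?n _ ?m])
qed

lemma det_on_empty: "det_on {} A = 1"
  by (simp add: det_on_def sign_id)

lemma det_on_singleton: "det_on {p} A = A p p"
  by (simp add: det_on_def sign_id)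

lemma det_on_insert:
  fixes A :: "'a \<Rightarrow> 'a \<Rightarrow> 'k::idom"
  assumes "finite S" "p \<notin> S" "\<And>q. q \<in> S \<Longrightarrow> A p q = 0"
  shows "det_on (insert p S) A = A p p * det_on S A"
  using det_on_union[of S "{p}" A] assms by (simp add: det_on_singleton mult.commute)

section \<open>Partial homomorphisms of fields of fractions\<close>

lemma sum_monomials:
  "R = (\<Sum>m\<in>Poly_Mapping.keys R. Poly_Mapping.single m (Poly_Mapping.lookup R m))"
  by (intro poly_mapping_eqI) (auto simp: lookup_sum lookup_single when_def sum.delta in_keys_iff)

text \<open>The universal map out of a monoid algebra, given on coefficients and on exponents.
  Variable substitution, evaluation at 1 and \<open>laurent_at\<close> are its instances.\<close>

definition poly_lift :: "('c \<Rightarrow> 'r) \<Rightarrow> ('a \<Rightarrow> 'r) \<Rightarrow> ('a \<Rightarrow>\<^sub>0 'c::zero) \<Rightarrow> 'r::comm_ring_1" where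
  "poly_lift \<kappa> \<psi> P = (\<Sum>m\<in>Poly_Mapping.keys P. \<kappa> (Poly_Mapping.lookup P m) * \<psi> m)"

locale poly_lift_hom = coeff: comm_ring_hom \<kappa>
  for \<kappa> :: "'c::comm_ring_1 \<Rightarrow> 'r::comm_ring_1" +
  fixes \<psi> :: "'a::comm_monoid_add \<Rightarrow> 'r"
  assumes exp_0: "\<psi> 0 = 1" and exp_add: "\<psi> (a + b) = \<psi> a * \<psi> b"
begin

lemma lift_superset:
  assumes "finite A" "Poly_Mapping.keys P \<subseteq> A"
  shows "poly_lift \<kappa> \<psi> P = (\<Sum>m\<in>A. \<kappa> (Poly_Mapping.lookup P m) * \<psi> m)"
  unfolding poly_lift_def using assms
  by (intro sum.mono_neutral_left) (auto simp: in_keys_iff)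

lemma lift_add: "poly_lift \<kappa> \<psi> (P + Q) = poly_lift \<kappa> \<psi> P + poly_lift \<kappa> \<psi> Q"
proof -
  let ?A = "Poly_Mapping.keys P \<union> Poly_Mapping.keys Q"
  have "Poly_Mapping.keys (P + Q) \<subseteq> ?A" by (rule keys_add)
  thus ?thesis
    by (simp add: lift_superset[of ?A] lookup_add coeff.hom_add distrib_right sum.distrib)
qed

lemma lift_zero: "poly_lift \<kappa> \<psi> 0 = 0"
  by (simp add: poly_lift_def)

lemma lift_sum: "poly_lift \<kappa> \<psi> (\<Sum>i\<in>I. P i) = (\<Sum>i\<in>I. poly_lift \<kappa> \<psi> (P i))"
  by (induction I rule: infinite_finite_induct) (simp_all add: lift_zero lift_add)

lemma lift_single: "poly_lift \<kappa> \<psi> (Poly_Mapping.single m c) = \<kappa> c * \<psi> m"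
  by (cases "c = 0") (simp_all add: poly_lift_def)

lemma lift_mult: "poly_lift \<kappa> \<psi> (P * Q) = poly_lift \<kappa> \<psi> P * poly_lift \<kappa> \<psi> Q"
proof -
  let ?s = "\<lambda>P m. Poly_Mapping.single m (Poly_Mapping.lookup P m)"
  have "poly_lift \<kappa> \<psi> (P * Q) = poly_lift \<kappa> \<psi> (\<Sum>m\<in>Poly_Mapping.keys P.
      \<Sum>l\<in>Poly_Mapping.keys Q. ?s P m * ?s Q l)"
    by (subst sum_monomials[of P], subst sum_monomials[of Q]) (simp add: sum_product)
  also have "\<dots> = poly_lift \<kappa> \<psi> P * poly_lift \<kappa> \<psi> Q"
    unfolding lift_sum mult_single lift_single coeff.hom_mult exp_add
    by (simp add: poly_lift_def sum_product mult_ac)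
  finally show ?thesis .
qed

lemma comm_ring_hom_lift: "comm_ring_hom (poly_lift \<kappa> \<psi>)"
proof
  show "poly_lift \<kappa> \<psi> 1 = 1"
    using lift_single[of 0 1] by (simp add: coeff.hom_one exp_0)
qed (simp_all add: lift_zero lift_add lift_mult)

end

text \<open>Abstracts a specialisation of rational functions: a homomorphism defined on a subring
  only, where an element with nonzero image is invertible inside the subring. Determinants and
  Cramer quotients can then be specialised term by term.\<close>

locale partial_hom =
  fixes L :: "'a::field set" and h :: "'a \<Rightarrow> 'b::field"
  assumes one: "1 \<in> L" "h 1 = 1"
    and add: "x \<in> L \<Longrightarrow> y \<in> L \<Longrightarrow> x + y \<in> L" "x \<in> L \<Longrightarrow> y \<in> L \<Longrightarrow> h (x + y) = h x + h y"
    and mult: "x \<in> L \<Longrightarrow> y \<in> L \<Longrightarrow> x * y \<in> L" "x \<in> L \<Longrightarrow> y \<in> L \<Longrightarrow> h (x * y) = h x * h y"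
    and minus: "x \<in> L \<Longrightarrow> - x \<in> L" "x \<in> L \<Longrightarrow> h (- x) = - h x"
    and inverse: "x \<in> L \<Longrightarrow> h x \<noteq> 0 \<Longrightarrow> inverse x \<in> L"
      "x \<in> L \<Longrightarrow> h x \<noteq> 0 \<Longrightarrow> h (inverse x) = inverse (h x)"
begin

lemma zero: "0 \<in> L" "h 0 = 0"
proof -
  show "0 \<in> L" using add(1)[OF one(1) minus(1)[OF one(1)]] by simp
  from add(2)[OF this this] have "h 0 = h 0 + h 0" by simp
  thus "h 0 = 0" by (metis add_cancel_right_left)
qed

lemma diff: "x \<in> L \<Longrightarrow> y \<in> L \<Longrightarrow> x - y \<in> L" "x \<in> L \<Longrightarrow> y \<in> L \<Longrightarrow> h (x - y) = h x - h y"
  using add[of x "- y"] minus[of y] by auto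

lemma divide: "x \<in> L \<Longrightarrow> y \<in> L \<Longrightarrow> h y \<noteq> 0 \<Longrightarrow> x / y \<in> L"
  "x \<in> L \<Longrightarrow> y \<in> L \<Longrightarrow> h y \<noteq> 0 \<Longrightarrow> h (x / y) = h x / h y"
  using mult[of x "Fields.inverse y"] inverse[of y] by (auto simp: divide_inverse)

lemma sum: "(\<And>i. i \<in> I \<Longrightarrow> f i \<in> L) \<Longrightarrow> sum f I \<in> L"
  "(\<And>i. i \<in> I \<Longrightarrow> f i \<in> L) \<Longrightarrow> h (sum f I) = (\<Sum>i\<in>I. h (f i))"
proof -
  have "sum f I \<in> L \<and> h (sum f I) = (\<Sum>i\<in>I. h (f i))" if "\<And>i. i \<in> I \<Longrightarrow> f i \<in> L"
    using that by (induction I rule: infinite_finite_induct) (auto simp: zero add)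
  thus "(\<And>i. i \<in> I \<Longrightarrow> f i \<in> L) \<Longrightarrow> sum f I \<in> L"
    "(\<And>i. i \<in> I \<Longrightarrow> f i \<in> L) \<Longrightarrow> h (sum f I) = (\<Sum>i\<in>I. h (f i))" by blast+
qed

lemma prod: "(\<And>i. i \<in> I \<Longrightarrow> f i \<in> L) \<Longrightarrow> prod f I \<in> L"
  "(\<And>i. i \<in> I \<Longrightarrow> f i \<in> L) \<Longrightarrow> h (prod f I) = (\<Prod>i\<in>I. h (f i))"
proof -
  have "prod f I \<in> L \<and> h (prod f I) = (\<Prod>i\<in>I. h (f i))" if "\<And>i. i \<in> I \<Longrightarrow> f i \<in> L"
    using that by (induction I rule: infinite_finite_induct) (auto simp: one mult)
  thus "(\<And>i. i \<in> I \<Longrightarrow> f i \<in> L) \<Longrightarrow> prod f I \<in> L"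
    "(\<And>i. i \<in> I \<Longrightarrow> f i \<in> L) \<Longrightarrow> h (prod f I) = (\<Prod>i\<in>I. h (f i))" by blast+
qed

lemma sign: "of_int (sign p) \<in> L" "h (of_int (sign p)) = of_int (sign p)"
  by (auto simp: sign_def of_int_minus one minus)

lemma det_on:
  assumes "\<And>i j. i \<in> S \<Longrightarrow> j \<in> S \<Longrightarrow> A i j \<in> L"
  shows "det_on S A \<in> L" "h (det_on S A) = det_on S (\<lambda>i j. h (A i j))"
proof -
  have "(\<Prod>i\<in>S. A i (p i)) \<in> L \<and> h (\<Prod>i\<in>S. A i (p i)) = (\<Prod>i\<in>S. h (A i (p i)))"
    if "p permutes S" for p
    using prod[of S "\<lambda>i. A i (p i)"] assms permutes_in_image[OF that] by blast
  note this[THEN conjunct1, simp] this[THEN conjunct2, simp]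
  show "det_on S A \<in> L" unfolding det_on_def by (rule sum) (simp add: mult sign)
  show "h (det_on S A) = det_on S (\<lambda>i j. h (A i j))" unfolding det_on_def
    by (subst sum(2)) (simp_all add: mult sign)
qed

end

section \<open>Localisation at the kernel of a ring homomorphism\<close>

definition fract_regular :: "('a::idom \<Rightarrow> 'k::field) \<Rightarrow> 'a fract set" where
  "fract_regular g = {Fract P Q | P Q. g Q \<noteq> 0}"

text \<open>Since \<open>g\<close> maps to a field, its kernel is prime and
  \<open>fract_regular g\<close> is the localisation there. The description has the shape of
  \<open>subst\<close>, so that the two agree by unfolding.\<close>

definition fract_ext :: "('a::idom \<Rightarrow> 'k::field) \<Rightarrow> 'a fract \<Rightarrow> 'k" where
  "fract_ext g r = (THE s. \<exists>P Q. r = Fract P Q \<and> g Q \<noteq> 0 \<and> s = g P / g Q)"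

context
  fixes g :: "'a::idom \<Rightarrow> 'k::field"
  assumes g: "comm_ring_hom g"
begin

interpretation g: comm_ring_hom g by (rule g)

lemma fract_ext_Fract:
  assumes "g Q \<noteq> 0"
  shows "fract_ext g (Fract P Q) = g P / g Q"
  unfolding fract_ext_def
proof (rule the_equality)
  fix s assume "\<exists>P' Q'. Fract P Q = Fract P' Q' \<and> g Q' \<noteq> 0 \<and> s = g P' / g Q'"
  then obtain P' Q' where *: "Fract P Q = Fract P' Q'" "g Q' \<noteq> 0" "s = g P' / g Q'" by blast
  have "Q \<noteq> 0" "Q' \<noteq> 0" using assms *(2) by auto
  hence "P * Q' = P' * Q" using *(1) by (simp add: eq_fract)
  hence "g P * g Q' = g P' * g Q" by (metis g.hom_mult)
  thus "s = g P / g Q" unfolding *(3) using *(2) assms by (subst frac_eq_eq) simp_all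
qed (use assms in blast)

lemma partial_hom_fract: "partial_hom (fract_regular g) (fract_ext g)"
proof -
  have reg: "Fract P Q \<in> fract_regular g" if "g Q \<noteq> 0" for P Q
    using that by (auto simp: fract_regular_def)
  have cases: thesis if "x \<in> fract_regular g"
    "\<And>P Q. x = Fract P Q \<Longrightarrow> g Q \<noteq> 0 \<Longrightarrow> Q \<noteq> 0 \<Longrightarrow> thesis" for x thesis
    using that(1) by (auto simp: fract_regular_def intro!: that(2))
  show ?thesis
  proof
    show "1 \<in> fract_regular g" "fract_ext g 1 = 1"
      using reg[of 1 1] fract_ext_Fract[of 1 1] by (simp_all add: One_fract_def)
  next
    fix x y assume "x \<in> fract_regular g" "y \<in> fract_regular g"
    then obtain P Q P' Q' where *: "x = Fract P Q" "g Q \<noteq> 0" "Q \<noteq> 0"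
      "y = Fract P' Q'" "g Q' \<noteq> 0" "Q' \<noteq> 0" by (metis cases)
    show "x + y \<in> fract_regular g" "x * y \<in> fract_regular g"
      using * by (auto simp: g.hom_mult intro!: reg)
    show "fract_ext g (x + y) = fract_ext g x + fract_ext g y"
      "fract_ext g (x * y) = fract_ext g x * fract_ext g y"
      using * by (simp_all add: fract_ext_Fract g.hom_mult g.hom_add field_simps)
  next
    fix x assume "x \<in> fract_regular g"
    then obtain P Q where *: "x = Fract P Q" "g Q \<noteq> 0" "Q \<noteq> 0" by (metis cases)
    show "- x \<in> fract_regular g" "fract_ext g (- x) = - fract_ext g x"
      using * by (auto simp: fract_ext_Fract g.hom_uminus intro!: reg)
    assume "fract_ext g x \<noteq> 0"
    hence "g P \<noteq> 0" using * by (simp add: fract_ext_Fract)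
    thus "inverse x \<in> fract_regular g" "fract_ext g (inverse x) = inverse (fract_ext g x)"
      using * by (auto simp: fract_ext_Fract intro!: reg)
  qed
qed

end

section \<open>Substitution of variables and evaluation at t = 1\<close>

definition subst_exp :: "(nat \<Rightarrow> nat) \<Rightarrow> (nat \<Rightarrow>\<^sub>0 nat) \<Rightarrow> (nat \<Rightarrow>\<^sub>0 nat)" where
  "subst_exp f m = (\<Sum>i\<in>Poly_Mapping.keys m. Poly_Mapping.single (f i) (Poly_Mapping.lookup m i))"

lemma subst_exp_add: "subst_exp f (a + b) = subst_exp f a + subst_exp f b"
proof -
  let ?A = "Poly_Mapping.keys a \<union> Poly_Mapping.keys b"
  have sup: "subst_exp f m = (\<Sum>i\<in>?A. Poly_Mapping.single (f i) (Poly_Mapping.lookup m i))"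
    if "Poly_Mapping.keys m \<subseteq> ?A" for m
    unfolding subst_exp_def using that by (intro sum.mono_neutral_left) (auto simp: in_keys_iff)
  show ?thesis
    unfolding sup[OF keys_add] sup[OF Un_upper1] sup[OF Un_upper2]
    by (simp add: lookup_add single_add sum.distrib)
qed

interpretation subst_poly: poly_lift_hom "Poly_Mapping.single 0"
  "\<lambda>m. Poly_Mapping.single (subst_exp f m) 1 :: mpoly" for f
  by unfold_locales (simp_all add: single_add mult_single subst_exp_add, simp add: subst_exp_def)

lemma subst_poly_lift:
  "subst_poly f = poly_lift (Poly_Mapping.single 0) (\<lambda>m. Poly_Mapping.single (subst_exp f m) 1)"
  by (simp add: fun_eq_iff subst_poly_def poly_lift_def mult_single subst_exp_def)

text \<open>\<open>fract_ext\<close> expects a map into a field, hence the embedding of the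
  substituted polynomial into the fractions.\<close>

definition subst_fract :: "(nat \<Rightarrow> nat) \<Rightarrow> mpoly \<Rightarrow> ratfun" where
  "subst_fract f P = Fract (subst_poly f P) 1"

lemma subst_fract_hom: "comm_ring_hom (subst_fract f)"
proof -
  interpret comm_ring_hom "subst_poly f"
    unfolding subst_poly_lift by (rule subst_poly.comm_ring_hom_lift)
  show ?thesis
    by unfold_locales (simp_all add: subst_fract_def hom_add hom_mult Zero_fract_def One_fract_def)
qed

lemma subst_eq_ext: "subst f = fract_ext (subst_fract f)"
  by (auto simp: fun_eq_iff subst_def fract_ext_def subst_fract_def eq_fract Zero_fract_def
      intro!: arg_cong[where f = The])

lemma partial_hom_subst: "partial_hom (fract_regular (subst_fract f)) (subst f)"
  unfolding subst_eq_ext by (rule partial_hom_fract[OF subst_fract_hom])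

lemma subst_poly_single:
  "subst_poly f (Poly_Mapping.single (Poly_Mapping.single i 1) 1) = Poly_Mapping.single (Poly_Mapping.single (f i) 1) 1"
  by (simp add: subst_poly_def)

lemma comm_ring_hom_one: "comm_ring_hom g \<Longrightarrow> g 1 = 1"
proof -
  assume "comm_ring_hom g"
  then interpret comm_ring_hom g .
  show ?thesis by simp
qed

lemma tvar_regular: "comm_ring_hom g \<Longrightarrow> tvar i \<in> fract_regular g"
  unfolding tvar_def fract_regular_def
  using comm_ring_hom_one[of g] by fastforce

lemma subst_tvar: "subst f (tvar i) = tvar (f i)"
  unfolding tvar_def subst_eq_ext
  by (subst fract_ext_Fract[OF subst_fract_hom])
     (simp_all add: subst_fract_def subst_poly_single[unfolded One_nat_def] comm_ring_hom_one[OF subst_fract_hom, unfolded subst_fract_def])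

lemma tvar_nonzero: "tvar i \<noteq> 0"
  by (simp add: tvar_def Zero_fract_def eq_fract) (metis lookup_single_eq lookup_zero zero_neq_one)

text \<open>The augmentation sending all variables to 1. Its purpose is to certify that determinants
  over the rational functions do not vanish.\<close>

definition at_one :: "mpoly \<Rightarrow> rat" where
  "at_one = poly_lift (\<lambda>c. c) (\<lambda>_. 1)"

lemma at_one_hom: "comm_ring_hom at_one"
proof -
  interpret poly_lift_hom "\<lambda>c::rat. c" "\<lambda>_::nat \<Rightarrow>\<^sub>0 nat. 1"
    by unfold_locales simp_all
  show ?thesis unfolding at_one_def by (rule comm_ring_hom_lift)
qed

lemma partial_hom_at_one: "partial_hom (fract_regular at_one) (fract_ext at_one)"
  by (rule partial_hom_fract[OF at_one_hom])

lemma at_one_tvar: "fract_ext at_one (tvar i) = 1"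
  unfolding tvar_def
  by (subst fract_ext_Fract[OF at_one_hom])
     (simp_all add: comm_ring_hom_one[OF at_one_hom], simp add: at_one_def poly_lift_def)

section \<open>Well-formed diagrams\<close>

lemma passes_upd:
  assumes "finite (dom D)" "a \<notin> dom D"
  shows "passes (D(a \<mapsto> l)) = mset l + passes D"
  using assms unfolding passes_def
  by (auto intro!: arg_cong2[where f = "(+)"] sum.cong)

lemma passes_remove:
  assumes "finite (dom D)" "D a = Some l"
  shows "passes D = mset l + passes (D(a := None))"
proof -
  have "D = (D(a := None))(a \<mapsto> l)" using assms by (auto simp: fun_eq_iff)
  thus ?thesis using passes_upd[of "D(a := None)" a l] assms by simp
qed

lemma set_passes: "finite (dom D) \<Longrightarrow> set_mset (passes D) = (\<Union>x\<in>dom D. set (the (D x)))"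
  unfolding passes_def by (auto simp: set_mset_sum)

lemma crossings_passes: "finite (dom D) \<Longrightarrow> crossings D = crossing ` set_mset (passes D)"
  by (simp add: crossings_def set_passes)

lemma finite_crossings: "finite (dom D) \<Longrightarrow> finite (crossings D)"
  by (simp add: crossings_def)

text \<open>Well-formedness sees the strands only through the multiset of all passages, which
  stitching and relabelling do not change.\<close>

definition paired :: "pass multiset \<Rightarrow> bool" where
  "paired M \<longleftrightarrow> (\<forall>p\<in>crossing ` set_mset M.
     \<exists>s. filter_mset (\<lambda>v. crossing v = p) M = {#over_pass p s, under_pass p s#})"

lemma wf_diagram_iff: "wf_diagram D \<longleftrightarrow> finite (dom D) \<and> paired (passes D)"
  using crossings_passes[of D] by (auto simp: wf_diagram_def paired_def)

lemma wf_finite: "wf_diagram D \<Longrightarrow> finite (dom D)"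
  by (simp add: wf_diagram_def)

lemma paired_union:
  assumes "paired M" "paired N" "crossing ` set_mset M \<inter> crossing ` set_mset N = {}"
  shows "paired (M + N)"
proof -
  have empty: "filter_mset (\<lambda>v. crossing v = p) M = {#}" if "p \<notin> crossing ` set_mset M" for p M
    using that by auto
  show ?thesis unfolding paired_def
  proof
    fix p assume "p \<in> crossing ` set_mset (M + N)"
    then consider "p \<in> crossing ` set_mset M" "p \<notin> crossing ` set_mset N"
      | "p \<in> crossing ` set_mset N" "p \<notin> crossing ` set_mset M"
      using assms(3) by auto
    thus "\<exists>s. filter_mset (\<lambda>v. crossing v = p) (M + N) = {#over_pass p s, under_pass p s#}"
      using assms(1,2) empty unfolding paired_def by cases (metis add.right_neutral add.left_neutral filter_union_mset)+
  qed
qed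

lemma passes_union:
  assumes "finite (dom D)" "finite (dom E)" "dom D \<inter> dom E = {}"
  shows "passes (D ++ E) = passes D + passes E"
proof -
  have "passes (D ++ E) = (\<Sum>x\<in>dom D \<union> dom E. mset (the ((D ++ E) x)))"
    by (simp add: passes_def Un_commute)
  also have "\<dots> = (\<Sum>x\<in>dom D. mset (the ((D ++ E) x))) + (\<Sum>x\<in>dom E. mset (the ((D ++ E) x)))"
    using assms by (rule sum.union_disjoint)
  also have "\<dots> = passes D + passes E" unfolding passes_def
    using assms(3) by (intro arg_cong2[where f = "(+)"] sum.cong)
      (auto simp: map_add_def split: option.splits)
  finally show ?thesis .
qed

lemma wf_union: "wf_diagram D \<Longrightarrow> wf_diagram E \<Longrightarrow> can_union D E \<Longrightarrow> wf_diagram (D ++ E)"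
  by (auto simp: wf_diagram_iff can_union_def passes_union crossings_passes intro: paired_union)

lemma wf_add_strand: "wf_diagram D \<Longrightarrow> a \<notin> dom D \<Longrightarrow> wf_diagram (add_strand a D)"
  by (simp add: wf_diagram_iff add_strand_def passes_upd)

lemma dom_stitch: "can_stitch a b c D \<Longrightarrow> dom (stitch a b c D) = insert c (dom D - {a, b})"
  by (auto simp: stitch_def can_stitch_def)

lemma passes_stitch:
  assumes "finite (dom D)" "can_stitch a b c D"
  shows "passes (stitch a b c D) = passes D"
proof -
  obtain la lb where l: "D a = Some la" "D b = Some lb" "a \<noteq> b" "c \<notin> dom D - {a, b}"
    using assms(2) by (auto simp: can_stitch_def)
  have "passes D = mset la + (mset lb + passes (D(a := None, b := None)))"
    using passes_remove[OF assms(1) l(1)] passes_remove[of "D(a := None)" b lb] l assms(1) by simp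
  thus ?thesis using l assms(1) by (simp add: stitch_def passes_upd)
qed

lemma wf_stitch: "wf_diagram D \<Longrightarrow> can_stitch a b c D \<Longrightarrow> wf_diagram (stitch a b c D)"
  by (simp add: wf_diagram_iff passes_stitch dom_stitch)

lemma dom_relabel: "can_relabel a b D \<Longrightarrow> dom (relabel a b D) = insert b (dom D - {a})"
  by (auto simp: relabel_def can_relabel_def)

lemma passes_relabel:
  assumes "finite (dom D)" "can_relabel a b D"
  shows "passes (relabel a b D) = passes D"
proof -
  obtain la where l: "D a = Some la" "b \<notin> dom D - {a}"
    using assms(2) by (auto simp: can_relabel_def)
  thus ?thesis using passes_remove[OF assms(1) l(1)] assms(1) by (simp add: relabel_def passes_upd)
qed

lemma wf_relabel: "wf_diagram D \<Longrightarrow> can_relabel a b D \<Longrightarrow> wf_diagram (relabel a b D)"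
  by (simp add: wf_diagram_iff passes_relabel dom_relabel)

section \<open>Renaming of crossings\<close>

definition rename_pass :: "(nat \<Rightarrow> nat) \<Rightarrow> pass \<Rightarrow> pass" where
  "rename_pass f v = Pass (f (crossing v)) (is_over v) (is_pos v)"

lemma rename_pass_sel [simp]:
  "crossing (rename_pass f v) = f (crossing v)" "is_over (rename_pass f v) = is_over v"
  "is_pos (rename_pass f v) = is_pos v" "rename_pass f (Pass p o' s) = Pass (f p) o' s"
  by (simp_all add: rename_pass_def)

lemma rename_pass_id [simp]: "rename_pass (\<lambda>p. p) v = v" "rename_pass id v = v"
  by (simp_all add: rename_pass_def)

lemma rename_crossings_eq: "rename_crossings f D = (\<lambda>x. map_option (map (rename_pass f)) (D x))"
  by (auto simp: rename_crossings_def rename_pass_def fun_eq_iff intro!: map_option_cong)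

lemma dom_rename: "dom (rename_crossings f D) = dom D"
  by (auto simp: rename_crossings_eq)

lemma passes_rename: "passes (rename_crossings f D) = image_mset (rename_pass f) (passes D)"
proof -
  have "passes (rename_crossings f D) = (\<Sum>x\<in>dom D. image_mset (rename_pass f) (mset (the (D x))))"
    unfolding passes_def dom_rename by (rule sum.cong) (auto simp: rename_crossings_eq)
  also have "\<dots> = image_mset (rename_pass f) (passes D)"
    unfolding passes_def by (rule sum_comp_morphism[symmetric, unfolded comp_def, OF image_mset_empty image_mset_union, symmetric])
  finally show ?thesis .
qed

lemma crossings_rename: "finite (dom D) \<Longrightarrow> crossings (rename_crossings f D) = f ` crossings D"
  by (auto simp: crossings_passes dom_rename passes_rename image_image)

lemma wf_rename:
  assumes wf: "wf_diagram D" and inj: "inj_on f (crossings D)"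
  shows "wf_diagram (rename_crossings f D)"
proof -
  note fin = wf_finite[OF wf]
  have "\<exists>s. filter_mset (\<lambda>v. crossing v = f p) (image_mset (rename_pass f) (passes D))
      = {#over_pass (f p) s, under_pass (f p) s#}" if p: "p \<in> crossings D" for p
  proof -
    obtain s where s: "filter_mset (\<lambda>v. crossing v = p) (passes D) = {#over_pass p s, under_pass p s#}"
      using wf p by (auto simp: wf_diagram_def)
    have "filter_mset (\<lambda>v. crossing v = f p) (image_mset (rename_pass f) (passes D))
       = image_mset (rename_pass f) (filter_mset (\<lambda>v. f (crossing v) = f p) (passes D))"
      by (simp add: filter_mset_image_mset)
    also have "filter_mset (\<lambda>v. f (crossing v) = f p) (passes D) = filter_mset (\<lambda>v. crossing v = p) (passes D)"
      using inj p fin by (intro filter_mset_cong) (auto simp: inj_on_def crossings_passes)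
    finally show ?thesis unfolding s by auto
  qed
  thus ?thesis using fin
    by (simp add: wf_diagram_def dom_rename passes_rename crossings_rename)
qed

lemma wf_count:
  assumes "wf_diagram D"
  shows "count (passes D) v \<le> 1"
proof (cases "v \<in># passes D")
  case True
  then obtain s where s: "filter_mset (\<lambda>w. crossing w = crossing v) (passes D)
      = {#over_pass (crossing v) s, under_pass (crossing v) s#}"
    using assms unfolding wf_diagram_iff paired_def by blast
  have "count (passes D) v = count (filter_mset (\<lambda>w. crossing w = crossing v) (passes D)) v" by simp
  also have "\<dots> \<le> 1" unfolding s by (cases v) auto
  finally show ?thesis .
qed (simp add: not_in_iff)

text \<open>A passage has multiplicity at most one in the total multiset, hence determines its
  strand and its place there. This makes the data of a crossing well defined.\<close>

lemma occurrence_unique: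
  assumes "wf_diagram D" "D x = Some (l @ v # l')" "D y = Some (m @ v # m')"
  shows "x = y \<and> l = m \<and> l' = m'"
proof -
  note fin = wf_finite[OF assms(1)]
  have 1: "passes D = mset (l @ v # l') + passes (D(x := None))"
    using passes_remove[OF fin assms(2)] .
  have xy: "x = y"
  proof (rule ccontr)
    assume "x \<noteq> y"
    hence "passes (D(x := None)) = mset (m @ v # m') + passes (D(x := None, y := None))"
      using passes_remove[of "D(x := None)" y] fin assms(3) by simp
    thus False using 1 wf_count[OF assms(1), of v] by simp
  qed
  have "count (mset (l @ v # l')) v \<le> 1" using 1 wf_count[OF assms(1), of v] by simp
  hence "v \<notin> set l" "v \<notin> set l'" by (auto simp: count_eq_zero_iff simp flip: set_mset_mset)
  moreover have eq: "l @ v # l' = m @ v # m'" using assms(2,3) xy by simp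
  ultimately show ?thesis using xy by (metis append_Cons_eq_iff)
qed

lemma occurs_crossing: "D x = Some (l @ v # l') \<Longrightarrow> crossing v \<in> crossings D"
  by (force simp: crossings_def)

lemma crossing_occurs:
  assumes "wf_diagram D" "p \<in> crossings D"
  obtains s x l l' y m m' where "D x = Some (l @ over_pass p s # l')" "D y = Some (m @ under_pass p s # m')"
proof -
  obtain s where s: "filter_mset (\<lambda>v. crossing v = p) (passes D) = {#over_pass p s, under_pass p s#}"
    using assms by (auto simp: wf_diagram_def)
  have "over_pass p s \<in># passes D" "under_pass p s \<in># passes D"
    using arg_cong[OF s, of set_mset] by auto
  hence "\<exists>x l. D x = Some l \<and> over_pass p s \<in> set l" "\<exists>x l. D x = Some l \<and> under_pass p s \<in> set l"
    using set_passes[OF wf_finite[OF assms(1)]] by force+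
  thus thesis using that by (metis split_list)
qed

lemma occurs_sign:
  assumes "wf_diagram D" "D x = Some (l @ v # l')" "D y = Some (m @ w # m')" "crossing v = crossing w"
  shows "is_pos v = is_pos w"
proof -
  note fin = wf_finite[OF assms(1)]
  have in_passes: "v \<in># passes D" "w \<in># passes D" using assms(2,3) set_passes[OF fin] by force+
  obtain s where s: "filter_mset (\<lambda>u. crossing u = crossing v) (passes D)
      = {#over_pass (crossing v) s, under_pass (crossing v) s#}"
    using assms(1) in_passes(1) unfolding wf_diagram_iff paired_def by blast
  have "u \<in> {over_pass (crossing v) s, under_pass (crossing v) s}"
    if "u \<in># passes D" "crossing u = crossing v" for u
    using that arg_cong[OF s, of set_mset] by auto
  from this[OF in_passes(1)] this[OF in_passes(2)] assms(4) show ?thesis by (metis empty_iff insert_iff pass.sel(3))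
qed

section \<open>The linear system of a diagram\<close>

text \<open>
  \<open>follow s l\<close> is the arc on which one leaves the passages \<open>l\<close> after entering them on the arc \<open>s\<close>;
  an arc is the initial arc \<open>Inl x\<close> of the strand \<open>x\<close>, or the arc \<open>Inr p\<close> leaving the crossing \<open>p\<close>
  below.
\<close>

fun follow :: "nat + nat \<Rightarrow> pass list \<Rightarrow> nat + nat" where
  "follow s [] = s"
| "follow s (v # l) = follow (if is_over v then s else Inr (crossing v)) l"

lemma follow_append: "follow s (l @ l') = follow (follow s l) l'"
  by (induction l arbitrary: s) auto

lemma follow_cases: "follow s l = s \<or> (\<exists>v\<in>set l. \<not> is_over v \<and> follow s l = Inr (crossing v))"
proof (induction l arbitrary: s)
  case (Cons v l)
  show ?case
    using Cons.IH[of s] Cons.IH[of "Inr (crossing v)"] by (cases "is_over v") auto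
qed simp

definition out_arc :: "wdiagram \<Rightarrow> nat \<Rightarrow> nat + nat" where
  "out_arc D x = follow (Inl x) (the (D x))"

text \<open>The components are the upper strand, whose variable enters the weight, the sign, the arc
  passing over, and the arc that arrives below.\<close>

definition crossing_at :: "wdiagram \<Rightarrow> nat \<Rightarrow> nat \<times> bool \<times> (nat + nat) \<times> (nat + nat) \<Rightarrow> bool" where
  "crossing_at D p = (\<lambda>(o', s, oa, ua). \<exists>l l' x m m'.
     D o' = Some (l @ over_pass p s # l') \<and> D x = Some (m @ under_pass p s # m') \<and>
     oa = follow (Inl o') l \<and> ua = follow (Inl x) m)"

lemma crossing_atI:
  assumes "D o' = Some (l @ over_pass p s # l')" "D x = Some (m @ under_pass p s # m')"
  shows "crossing_at D p (o', s, follow (Inl o') l, follow (Inl x) m)"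
  unfolding crossing_at_def using assms by fast

lemma crossing_at_unique:
  assumes "wf_diagram D" "crossing_at D p c" "crossing_at D p c'"
  shows "c = c'"
proof -
  obtain o' s oa ua where c: "c = (o', s, oa, ua)" by (cases c)
  obtain o2 s2 oa2 ua2 where c': "c' = (o2, s2, oa2, ua2)" by (cases c')
  from assms(2) obtain l l' x m m' where *:
    "D o' = Some (l @ over_pass p s # l')" "D x = Some (m @ under_pass p s # m')"
    "oa = follow (Inl o') l" "ua = follow (Inl x) m"
    unfolding crossing_at_def c by auto
  from assms(3) obtain l2 l2' x2 m2 m2' where **:
    "D o2 = Some (l2 @ over_pass p s2 # l2')" "D x2 = Some (m2 @ under_pass p s2 # m2')"
    "oa2 = follow (Inl o2) l2" "ua2 = follow (Inl x2) m2"
    unfolding crossing_at_def c' by auto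
  have "s = s2" using occurs_sign[OF assms(1) *(1) **(1)] by simp
  with * ** show ?thesis unfolding c c'
    using occurrence_unique[OF assms(1) *(1)] occurrence_unique[OF assms(1) *(2)] by metis
qed

definition crossing_data :: "wdiagram \<Rightarrow> nat \<Rightarrow> nat \<times> bool \<times> (nat + nat) \<times> (nat + nat)" where
  "crossing_data D p = (THE c. crossing_at D p c)"

lemma crossing_dataI: "wf_diagram D \<Longrightarrow> crossing_at D p c \<Longrightarrow> crossing_data D p = c"
  unfolding crossing_data_def using crossing_at_unique by blast

definition weight :: "(nat \<Rightarrow> 'k::field) \<Rightarrow> nat \<Rightarrow> bool \<Rightarrow> 'k" where
  "weight \<tau> x s = (if s then \<tau> x else inverse (\<tau> x))"

definition arc_value :: "(nat \<Rightarrow> 'k) \<Rightarrow> (nat \<Rightarrow> 'k) \<Rightarrow> nat + nat \<Rightarrow> 'k" where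
  "arc_value y u = case_sum y u"

lemma arc_value_simps [simp]: "arc_value y u (Inl x) = y x" "arc_value y u (Inr p) = u p"
  by (simp_all add: arc_value_def)

text \<open>
  \<open>y\<close> assigns values to the initial arcs of the strands and \<open>u\<close> to the arcs leaving the crossings
  below; the value prescribed for the latter is the Burau combination of the two incoming arcs.
  The variables of the strands are specialised by \<open>\<tau>\<close>.
\<close>

definition rhs :: "wdiagram \<Rightarrow> (nat \<Rightarrow> 'k::field) \<Rightarrow> nat \<Rightarrow> (nat \<Rightarrow> 'k) \<Rightarrow> (nat \<Rightarrow> 'k) \<Rightarrow> 'k" where
  "rhs D \<tau> p y u = (case crossing_data D p of (o', s, oa, ua) \<Rightarrow>
     weight \<tau> o' s * arc_value y u ua + (1 - weight \<tau> o' s) * arc_value y u oa)"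

definition unit_at :: "nat \<Rightarrow> nat \<Rightarrow> 'k::zero_neq_one" where
  "unit_at i j = (if j = i then 1 else 0)"

lemma sum_unit_at:
  "finite A \<Longrightarrow> (\<Sum>q\<in>A. unit_at q r * u q) = (if r \<in> A then u r else (0 :: 'k::comm_ring_1))"
  using sum.delta'[of A r u] by (simp add: unit_at_def if_distrib[of "\<lambda>z. z * _"] cong: if_cong)

lemma weight_one [simp]: "weight (\<lambda>_. 1) x s = 1"
  by (simp add: weight_def)

definition sys :: "wdiagram \<Rightarrow> (nat \<Rightarrow> 'k::field) \<Rightarrow> nat \<Rightarrow> nat \<Rightarrow> 'k" where
  "sys D \<tau> p q = unit_at q p - rhs D \<tau> p (\<lambda>_. 0) (unit_at q)"

definition omega :: "wdiagram \<Rightarrow> (nat \<Rightarrow> 'k::field) \<Rightarrow> 'k" where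
  "omega D \<tau> = det_on (crossings D) (sys D \<tau>)"

definition solves :: "wdiagram \<Rightarrow> (nat \<Rightarrow> 'k::field) \<Rightarrow> (nat \<Rightarrow> 'k) \<Rightarrow> (nat \<Rightarrow> 'k) \<Rightarrow> bool" where
  "solves D \<tau> y u \<longleftrightarrow> (\<forall>p\<in>crossings D. u p = rhs D \<tau> p y u)"

text \<open>Entry \<open>i\<close>, \<open>j\<close> is the response at the end of strand
  \<open>j\<close> to a unit input at strand \<open>i\<close>. The choice is harmless when
  \<open>omega\<close> is nonzero: solutions may differ off the crossings, but no out arc of the
  diagram lies there.\<close>

definition transfer :: "wdiagram \<Rightarrow> (nat \<Rightarrow> 'k::field) \<Rightarrow> nat \<Rightarrow> nat \<Rightarrow> 'k" where
  "transfer D \<tau> i j = (if i \<in> dom D \<and> j \<in> dom D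
     then arc_value (unit_at i) (SOME u. solves D \<tau> (unit_at i) u) (out_arc D j) else 0)"

lemma arc_value_linear:
  "arc_value (\<lambda>x. y x + k * y' x) (\<lambda>p. u p + k * u' p) s = arc_value y u s + k * (arc_value y' u' s :: 'k::comm_ring_1)"
  by (cases s) auto

lemma rhs_linear:
  "rhs D \<tau> p (\<lambda>x. y x + k * y' x) (\<lambda>p. u p + k * u' p) = rhs D \<tau> p y u + k * rhs D \<tau> p y' u'"
  by (cases "crossing_data D p") (simp add: rhs_def arc_value_linear algebra_simps)

lemma follow_valid:
  assumes "D x = Some (l @ l')"
  shows "follow (Inl x) l \<in> Inl ` dom D \<union> Inr ` crossings D"
  using follow_cases[of "Inl x" l] assms occurs_crossing[of D x] by (auto simp: in_set_conv_decomp) 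

lemma out_arc_valid: "x \<in> dom D \<Longrightarrow> out_arc D x \<in> Inl ` dom D \<union> Inr ` crossings D"
  using follow_valid[of D x _ "[]"] by (auto simp: out_arc_def)

lemma crossing_data_valid:
  assumes "wf_diagram D" "p \<in> crossings D"
  obtains o' s oa ua where "crossing_data D p = (o', s, oa, ua)" "o' \<in> dom D"
    "oa \<in> Inl ` dom D \<union> Inr ` crossings D" "ua \<in> Inl ` dom D \<union> Inr ` crossings D"
proof -
  obtain s x l l' y m m' where "D x = Some (l @ over_pass p s # l')" "D y = Some (m @ under_pass p s # m')"
    using crossing_occurs[OF assms] .
  thus thesis
    using that[of x s "follow (Inl x) l" "follow (Inl y) m"]
      crossing_dataI[OF assms(1) crossing_atI] follow_valid by blast
qed

lemma arc_value_cong: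
  assumes "s \<in> Inl ` A \<union> Inr ` B" "\<And>x. x \<in> A \<Longrightarrow> y x = y' x" "\<And>p. p \<in> B \<Longrightarrow> u p = u' p"
  shows "arc_value y u s = arc_value y' u' s"
  using assms by auto

lemma rhs_cong:
  assumes "wf_diagram D" "p \<in> crossings D"
    and "\<And>x. x \<in> dom D \<Longrightarrow> \<tau> x = \<tau>' x" "\<And>x. x \<in> dom D \<Longrightarrow> y x = y' x" "\<And>q. q \<in> crossings D \<Longrightarrow> u q = u' q"
  shows "rhs D \<tau> p y u = rhs D \<tau>' p y' u'"
  by (rule crossing_data_valid[OF assms(1,2)])
     (simp add: rhs_def weight_def assms(3) arc_value_cong[OF _ assms(4,5)])

lemma arc_value_zero [simp]: "arc_value (\<lambda>_. 0) (\<lambda>_. 0) s = 0"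
  by (cases s) auto

lemma rhs_zero: "rhs D \<tau> p (\<lambda>_. 0) (\<lambda>_. 0) = 0"
  by (simp add: rhs_def case_prod_unfold)

lemma rhs_expand:
  assumes "wf_diagram D" "p \<in> crossings D"
  shows "rhs D \<tau> p y u = rhs D \<tau> p y (\<lambda>_. 0) + (\<Sum>q\<in>crossings D. rhs D \<tau> p (\<lambda>_. 0) (unit_at q) * u q)"
proof -
  have fin: "finite (crossings D)" by (rule finite_crossings[OF wf_finite[OF assms(1)]])
  have "rhs D \<tau> p (\<lambda>_. 0) (\<lambda>r. \<Sum>q\<in>A. unit_at q r * u q) = (\<Sum>q\<in>A. rhs D \<tau> p (\<lambda>_. 0) (unit_at q) * u q)"
    if "finite A" for A using that
  proof (induction A rule: finite_induct)
    case (insert q A)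
    have "rhs D \<tau> p (\<lambda>_. 0) (\<lambda>r. \<Sum>q\<in>insert q A. unit_at q r * u q)
        = rhs D \<tau> p (\<lambda>x. 0 + u q * 0) (\<lambda>r. (\<Sum>q\<in>A. unit_at q r * u q) + u q * unit_at q r)"
      using insert.hyps by (simp add: add.commute mult.commute)
    thus ?case unfolding rhs_linear using insert by (simp add: mult.commute)
  qed (simp add: rhs_zero)
  note sum = this[OF fin]
  have "rhs D \<tau> p y u = rhs D \<tau> p (\<lambda>x. y x + 1 * 0) (\<lambda>r. 0 + 1 * (\<Sum>q\<in>crossings D. unit_at q r * u q))"
    by (rule rhs_cong[OF assms]) (simp_all add: sum_unit_at fin)
  thus ?thesis unfolding rhs_linear sum by simp
qed

text \<open>\<open>rhs\<close> is affine in \<open>u\<close>; subtracting its value at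
  \<open>u\<close> = 0 leaves the linear part, which is independent of the inputs
  \<open>y\<close>.\<close>

lemma sys_sum:
  assumes "wf_diagram D" "p \<in> crossings D"
  shows "(\<Sum>q\<in>crossings D. sys D \<tau> p q * u q) = u p - (rhs D \<tau> p y u - rhs D \<tau> p y (\<lambda>_. 0))"
proof -
  have fin: "finite (crossings D)" by (rule finite_crossings[OF wf_finite[OF assms(1)]])
  have "(\<Sum>q\<in>crossings D. unit_at q p * u q) = u p"
    using assms(2) fin by (simp add: sum_unit_at)
  thus ?thesis unfolding rhs_expand[OF assms, of \<tau> y u]
    by (simp add: sys_def left_diff_distrib sum_subtractf)
qed

lemma solves_iff:
  assumes "wf_diagram D"
  shows "solves D \<tau> y u \<longleftrightarrow>
    (\<forall>p\<in>crossings D. (\<Sum>q\<in>crossings D. sys D \<tau> p q * u q) = rhs D \<tau> p y (\<lambda>_. 0))"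
  unfolding solves_def using sys_sum[OF assms, of _ \<tau> u y] by auto

lemma solves_exists:
  assumes "wf_diagram D" "omega D \<tau> \<noteq> 0"
  shows "\<exists>u. solves D \<tau> y u"
  unfolding solves_iff[OF assms(1)]
  using det_on_solve[OF finite_crossings[OF wf_finite[OF assms(1)]] assms(2)[unfolded omega_def],
      of "\<lambda>p. rhs D \<tau> p y (\<lambda>_. 0)"] by simp

lemma solves_cramer:
  assumes "wf_diagram D" "omega D \<tau> \<noteq> 0" "solves D \<tau> y u" "q \<in> crossings D"
  shows "u q = det_on (crossings D) (\<lambda>p r. if r = q then rhs D \<tau> p y (\<lambda>_. 0) else sys D \<tau> p r) / omega D \<tau>"
proof -
  have "det_on (crossings D) (\<lambda>p r. if r = q then rhs D \<tau> p y (\<lambda>_. 0) else sys D \<tau> p r)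
      = u q * omega D \<tau>"
    unfolding omega_def using assms(3) solves_iff[OF assms(1)]
    by (intro det_on_cramer finite_crossings wf_finite assms(1,4)) blast
  thus ?thesis using assms(2) by simp
qed

lemma transfer_eq:
  assumes "wf_diagram D" "omega D \<tau> \<noteq> 0" "i \<in> dom D" "j \<in> dom D" "solves D \<tau> (unit_at i) u"
  shows "transfer D \<tau> i j = arc_value (unit_at i) u (out_arc D j)"
proof -
  define u' where "u' = (SOME u. solves D \<tau> (unit_at i) u)"
  have "solves D \<tau> (unit_at i) u'" unfolding u'_def
    by (rule someI[of "solves D \<tau> (unit_at i)", OF assms(5)])
  hence "u' q = u q" if "q \<in> crossings D" for q
    using solves_cramer[OF assms(1,2) \<open>solves D \<tau> (unit_at i) u'\<close> that]
      solves_cramer[OF assms(1,2,5) that] by simp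
  hence "arc_value (unit_at i) u' (out_arc D j) = arc_value (unit_at i) u (out_arc D j)"
    by (intro arc_value_cong[OF out_arc_valid[OF assms(4)]]) simp_all
  thus ?thesis unfolding transfer_def u'_def[symmetric] using assms(3,4) by simp
qed

text \<open>At t = 1 all weights are 1, so a value passes unchanged under every crossing. A solution
  of the homogeneous system therefore keeps along each strand the value 0 of its initial arc, and
  the kernel is trivial.\<close>

lemma omega_nonzero:
  assumes wf: "wf_diagram D"
  shows "omega D (\<lambda>_. 1 :: 'k::field) \<noteq> 0"
proof
  note fin = finite_crossings[OF wf_finite[OF wf]]
  assume "omega D (\<lambda>_. 1 :: 'k) = 0"
  then obtain u :: "nat \<Rightarrow> 'k" and p where p: "p \<in> crossings D" "u p \<noteq> 0"
    and u: "\<And>p. p \<in> crossings D \<Longrightarrow> (\<Sum>q\<in>crossings D. sys D (\<lambda>_. 1) p q * u q) = 0"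
    unfolding omega_def det_on_eq_0_iff[OF fin] by blast
  have sol: "u p = rhs D (\<lambda>_. 1) p (\<lambda>_. 0) u" if "p \<in> crossings D" for p
    using u[OF that] sys_sum[OF wf that, of "\<lambda>_. 1" u "\<lambda>_. 0"] by (simp add: rhs_zero)
  have zero: "arc_value (\<lambda>_. 0) u (follow (Inl x) l) = 0" if "D x = Some (l @ l')" for x l l'
    using that
  proof (induction l arbitrary: l' rule: rev_induct)
    case (snoc v l)
    have IH: "arc_value (\<lambda>_. 0) u (follow (Inl x) l) = 0" using snoc.IH[of "v # l'"] snoc.prems by simp
    show ?case
    proof (cases "is_over v")
      case True
      thus ?thesis using IH by (simp add: follow_append)
    next
      case False
      have occ: "D x = Some (l @ v # l')" using snoc.prems by simp
      define q where "q = crossing v"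
      have q: "q \<in> crossings D" using occurs_crossing[of D x l v l'] occ by (simp add: q_def)
      obtain s z m m' y n n' where *: "D z = Some (m @ over_pass q s # m')" "D y = Some (n @ under_pass q s # n')"
        using crossing_occurs[OF wf q] .
      have "v = under_pass q s"
        using False occurs_sign[OF wf occ *(2)] by (cases v) (simp add: q_def)
      hence "x = y" "l = n" using occurrence_unique[OF wf occ, of y n n'] *(2) by auto
      hence "u q = arc_value (\<lambda>_. 0) u (follow (Inl x) l)"
        using sol[OF q] crossing_dataI[OF wf crossing_atI[OF *]] by (simp add: rhs_def)
      thus ?thesis using IH False by (simp add: follow_append q_def)
    qed
  qed simp
  obtain s z m m' y n n' where *: "D z = Some (m @ over_pass p s # m')" "D y = Some (n @ under_pass p s # n')"
    using crossing_occurs[OF wf p(1)] .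
  have "arc_value (\<lambda>_. 0) u (follow (Inl y) n) = 0" by (rule zero[OF *(2)])
  thus False using p(2) sol[OF p(1)] crossing_dataI[OF wf crossing_atI[OF *]] by (simp add: rhs_def)
qed

section \<open>Specialisation of the variables in the system\<close>

context partial_hom
begin

lemma arc_value_in: "(\<And>x. y x \<in> L) \<Longrightarrow> (\<And>p. u p \<in> L) \<Longrightarrow> arc_value y u s \<in> L"
  "h (arc_value y u s) = arc_value (\<lambda>x. h (y x)) (\<lambda>p. h (u p)) s"
  by (cases s; auto)+

lemma unit_at_in: "unit_at i j \<in> L" "h (unit_at i j) = unit_at i j"
  by (auto simp: unit_at_def zero one)

context
  fixes \<tau> :: "nat \<Rightarrow> 'a"
  assumes \<tau>: "\<And>x. \<tau> x \<in> L" "\<And>x. h (\<tau> x) \<noteq> 0"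
begin

lemma weight_in: "weight \<tau> x s \<in> L" "h (weight \<tau> x s) = weight (\<lambda>x. h (\<tau> x)) x s"
  using \<tau> inverse by (auto simp: weight_def)

lemma rhs_in:
  assumes "\<And>x. y x \<in> L" "\<And>p. u p \<in> L"
  shows "rhs D \<tau> p y u \<in> L" "h (rhs D \<tau> p y u) = rhs D (\<lambda>x. h (\<tau> x)) p (\<lambda>x. h (y x)) (\<lambda>p. h (u p))"
  using assms
  by (cases "crossing_data D p"; simp add: rhs_def weight_in arc_value_in add mult diff one)+

lemma sys_in: "sys D \<tau> p q \<in> L" "h (sys D \<tau> p q) = sys D (\<lambda>x. h (\<tau> x)) p q"
  unfolding sys_def by (simp_all add: rhs_in zero unit_at_in diff)

lemma omega_in: "omega D \<tau> \<in> L" "h (omega D \<tau>) = omega D (\<lambda>x. h (\<tau> x))"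
  unfolding omega_def by (simp_all add: det_on sys_in)

text \<open>By Cramer's rule the only denominator of a solution is \<open>omega\<close>, whose image
  is nonzero. So the solution lies in \<open>L\<close>, and its image solves the specialised
  system.\<close>

lemma transfer_in:
  assumes wf: "wf_diagram D" and nz: "omega D (\<lambda>x. h (\<tau> x)) \<noteq> 0"
  shows "transfer D \<tau> i j \<in> L \<and> h (transfer D \<tau> i j) = transfer D (\<lambda>x. h (\<tau> x)) i j"
proof (cases "i \<in> dom D \<and> j \<in> dom D")
  case True
  have nz': "omega D \<tau> \<noteq> 0" using nz omega_in(2)[of D] zero by auto
  obtain w where w: "solves D \<tau> (unit_at i) w" using solves_exists[OF wf nz'] by blast
  \<comment> \<open>Off the crossings \<open>w\<close> is arbitrary and may leave \<open>L\<close>;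
    the value 0 put there is seen by no equation.\<close>
  define u where "u p = (if p \<in> crossings D then w p else 0)" for p
  have cong: "rhs D \<tau> p (unit_at i) w = rhs D \<tau> p (unit_at i) u" if "p \<in> crossings D" for p
    by (rule rhs_cong[OF wf that]) (simp_all add: u_def)
  have u: "solves D \<tau> (unit_at i) u" using w cong by (simp add: solves_def u_def)
  have in_L: "u p \<in> L" for p
  proof (cases "p \<in> crossings D")
    case True
    show ?thesis unfolding solves_cramer[OF wf nz' u True]
      by (rule divide) (simp_all add: omega_in nz det_on sys_in rhs_in unit_at_in zero)
  qed (simp add: u_def zero)
  have "solves D (\<lambda>x. h (\<tau> x)) (unit_at i) (\<lambda>p. h (u p))"
    unfolding solves_def
  proof
    fix p assume "p \<in> crossings D"
    hence "h (u p) = h (rhs D \<tau> p (unit_at i) u)" using u by (simp add: solves_def)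
    thus "h (u p) = rhs D (\<lambda>x. h (\<tau> x)) p (unit_at i) (\<lambda>p. h (u p))"
      by (simp add: rhs_in in_L unit_at_in)
  qed
  from transfer_eq[OF wf nz _ _ this] transfer_eq[OF wf nz' _ _ u] True
  show ?thesis by (simp add: arc_value_in in_L unit_at_in)
qed (auto simp: transfer_def zero)

end
end

section \<open>Compatibility with the operations\<close>

text \<open>The maps act on strands, on crossing names and on arcs. A separate map \<open>g\<close>
  on arcs is needed because stitching turns the initial arc of the second strand into an arc that
  may leave a crossing. Only the arc on which a passage is reached is compared, not its position,
  which stitching shifts.\<close>

definition transport :: "wdiagram \<Rightarrow> wdiagram \<Rightarrow> (nat \<Rightarrow> nat) \<Rightarrow> (nat \<Rightarrow> nat) \<Rightarrow> (nat + nat \<Rightarrow> nat + nat) \<Rightarrow> bool" where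
  "transport D E f \<pi> g \<longleftrightarrow> (\<forall>q. g (Inr q) = Inr (\<pi> q)) \<and>
     (\<forall>x l v l'. D x = Some (l @ v # l') \<longrightarrow>
        (\<exists>m m'. E (f x) = Some (m @ rename_pass \<pi> v # m') \<and> follow (Inl (f x)) m = g (follow (Inl x) l)))"

lemma rhs_transport:
  assumes wf: "wf_diagram D" "wf_diagram E" and tr: "transport D E f \<pi> g" and p: "p \<in> crossings D"
  shows "rhs E \<tau> (\<pi> p) y u = rhs D (\<tau> \<circ> f) p (\<lambda>x. arc_value y u (g (Inl x))) (u \<circ> \<pi>)"
proof -
  obtain s x l l' z m m' where *: "D x = Some (l @ over_pass p s # l')" "D z = Some (m @ under_pass p s # m')"
    using crossing_occurs[OF wf(1) p] .
  obtain l2 l2' m2 m2' where **: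
    "E (f x) = Some (l2 @ over_pass (\<pi> p) s # l2')" "follow (Inl (f x)) l2 = g (follow (Inl x) l)"
    "E (f z) = Some (m2 @ under_pass (\<pi> p) s # m2')" "follow (Inl (f z)) m2 = g (follow (Inl z) m)"
    using tr * unfolding transport_def by (metis rename_pass_sel(4))
  have g: "arc_value y u (g s) = arc_value (\<lambda>x. arc_value y u (g (Inl x))) (u \<circ> \<pi>) s" for s
    using tr by (cases s) (auto simp: transport_def)
  show ?thesis
    using crossing_dataI[OF wf(1) crossing_atI[OF *]] crossing_dataI[OF wf(2) crossing_atI[of E "f x" l2 "\<pi> p" s l2' "f z" m2 m2', OF **(1,3)]]
    by (simp add: rhs_def **(2,4) weight_def g[symmetric])
qed

lemma rhs_transport_id:
  assumes "wf_diagram D" "wf_diagram E" "transport D E id id id" "p \<in> crossings D"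
  shows "rhs E \<tau> p y u = rhs D \<tau> p y u"
  using rhs_transport[OF assms] by simp

lemma transport_extend:
  assumes "\<And>x l. D x = Some l \<Longrightarrow> E x = Some l"
  shows "transport D E id id id"
  unfolding transport_def using assms by auto

subsection \<open>Adding a strand\<close>

lemma add_strand_props:
  assumes wf: "wf_diagram D" and a: "a \<notin> dom D"
  shows "crossings (add_strand a D) = crossings D"
    and "p \<in> crossings D \<Longrightarrow> rhs (add_strand a D) \<tau> p y u = rhs D \<tau> p y u"
proof -
  show 1: "crossings (add_strand a D) = crossings D"
    using a wf_finite[OF wf]
    by (simp add: crossings_passes wf_add_strand[OF wf a, THEN wf_finite] passes_upd[of D a "[]", folded add_strand_def])
  assume "p \<in> crossings D"
  thus "rhs (add_strand a D) \<tau> p y u = rhs D \<tau> p y u"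
    using a by (intro rhs_transport_id[OF wf wf_add_strand[OF wf a]] transport_extend)
      (auto simp: add_strand_def)
qed

lemma omega_add_strand:
  assumes "wf_diagram D" "a \<notin> dom D"
  shows "omega (add_strand a D) \<tau> = omega D \<tau>"
  unfolding omega_def add_strand_props(1)[OF assms]
  by (rule det_on_cong) (simp add: sys_def add_strand_props(2)[OF assms])

lemma transfer_add_strand:
  assumes wf: "wf_diagram D" and a: "a \<notin> dom D" and nz: "omega D \<tau> \<noteq> 0"
  shows "transfer (add_strand a D) \<tau> i j = (if i = a \<and> j = a then 1 else transfer D \<tau> i j)"
proof (cases "i \<in> dom (add_strand a D) \<and> j \<in> dom (add_strand a D)")
  case True
  let ?E = "add_strand a D"
  note wf' = wf_add_strand[OF wf a]
  have nz': "omega ?E \<tau> \<noteq> 0" using nz omega_add_strand[OF wf a, of \<tau>] by simp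
  obtain u where u: "solves D \<tau> (unit_at i) u" using solves_exists[OF wf nz] by blast
  hence u': "solves ?E \<tau> (unit_at i) u" by (simp add: solves_def add_strand_props[OF wf a])
  have eq: "transfer ?E \<tau> i j = arc_value (unit_at i) u (out_arc ?E j)"
    using True by (intro transfer_eq[OF wf' nz' _ _ u']) blast+
  show ?thesis
  proof (cases "j = a")
    case True
    thus ?thesis using eq a by (auto simp: out_arc_def add_strand_def unit_at_def transfer_def)
  next
    case False
    hence j: "j \<in> dom D" "out_arc ?E j = out_arc D j" using True by (auto simp: add_strand_def out_arc_def)
    show ?thesis
    proof (cases "i = a")
      case True
      have cong: "rhs D \<tau> p (\<lambda>_. 0) (\<lambda>_. 0) = rhs D \<tau> p (unit_at i) (\<lambda>_. 0)" if "p \<in> crossings D" for p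
        using a True by (intro rhs_cong[OF wf that]) (auto simp: unit_at_def)
      \<comment> \<open>The new strand meets no crossing, so its input excites nothing.\<close>
      have "solves ?E \<tau> (unit_at i) (\<lambda>_. 0)"
        using cong by (simp add: solves_def rhs_zero add_strand_props[OF wf a])
      hence "transfer ?E \<tau> i j = arc_value (unit_at i) (\<lambda>_. 0) (out_arc ?E j)"
        using \<open>i \<in> dom ?E \<and> j \<in> dom ?E\<close> by (intro transfer_eq[OF wf' nz']) blast+
      also have "\<dots> = arc_value (\<lambda>_. 0) (\<lambda>_. 0) (out_arc D j)"
        unfolding j(2) using a True by (intro arc_value_cong[OF out_arc_valid[OF j(1)]]) (auto simp: unit_at_def)
      finally show ?thesis using True False a by (simp add: transfer_def)
    next
      case i: False
      hence "i \<in> dom D" using True by (auto simp: add_strand_def)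
      from transfer_eq[OF wf nz this j(1) u] show ?thesis using eq j False by simp
    qed
  qed
next
  case False
  thus ?thesis by (auto simp: transfer_def add_strand_def)
qed

subsection \<open>Disjoint union\<close>

lemma can_unionD:
  assumes "can_union D E"
  shows "dom D \<inter> dom E = {}" "crossings D \<inter> crossings E = {}" "crossings (D ++ E) = crossings D \<union> crossings E"
    "x \<in> dom D \<Longrightarrow> (D ++ E) x = D x" "x \<in> dom E \<Longrightarrow> (D ++ E) x = E x"
proof -
  show 1: "dom D \<inter> dom E = {}" and "crossings D \<inter> crossings E = {}" using assms by (auto simp: can_union_def)
  show 2: "x \<in> dom D \<Longrightarrow> (D ++ E) x = D x" "x \<in> dom E \<Longrightarrow> (D ++ E) x = E x" for x
    using 1 by (auto simp: map_add_def split: option.splits)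
  have "(\<Union>x\<in>dom (D ++ E). set (the ((D ++ E) x))) = (\<Union>x\<in>dom D. set (the (D x))) \<union> (\<Union>x\<in>dom E. set (the (E x)))"
    unfolding dom_map_add UN_Un Un_commute[of "dom E"] using 2 by (intro arg_cong2[where f = "(\<union>)"] SUP_cong) auto
  thus "crossings (D ++ E) = crossings D \<union> crossings E" unfolding crossings_def by (simp only: image_Un)
qed

lemma rhs_union:
  assumes wf: "wf_diagram D" "wf_diagram E" and un: "can_union D E"
  shows "p \<in> crossings D \<Longrightarrow> rhs (D ++ E) \<tau> p y u = rhs D \<tau> p y u"
    "p \<in> crossings E \<Longrightarrow> rhs (D ++ E) \<tau> p y u = rhs E \<tau> p y u"
  by (rule rhs_transport_id[OF _ wf_union[OF wf un]];
      (intro transport_extend wf)?; (metis can_unionD(4,5)[OF un] domI)?; simp)+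

lemma omega_union:
  assumes wf: "wf_diagram D" "wf_diagram E" and un: "can_union D E"
  shows "omega (D ++ E) \<tau> = omega D \<tau> * omega E \<tau>"
proof -
  note fin = wf(1)[THEN wf_finite, THEN finite_crossings] wf(2)[THEN wf_finite, THEN finite_crossings]
  have zero: "sys (D ++ E) \<tau> p q = 0" if "p \<in> crossings E" "q \<in> crossings D" for p q
  proof -
    have "rhs E \<tau> p (\<lambda>_. 0) (unit_at q) = rhs E \<tau> p (\<lambda>_. 0) (\<lambda>_. 0)"
      using that can_unionD(2)[OF un] by (intro rhs_cong[OF wf(2) that(1)]) (auto simp: unit_at_def)
    thus ?thesis using that can_unionD(2)[OF un] by (auto simp: sys_def rhs_union[OF wf un] rhs_zero unit_at_def)
  qed
  have "omega (D ++ E) \<tau> = det_on (crossings D) (sys (D ++ E) \<tau>) * det_on (crossings E) (sys (D ++ E) \<tau>)"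
    unfolding omega_def can_unionD(3)[OF un]
    by (rule det_on_union[OF fin can_unionD(2)[OF un] zero])
  also have "\<dots> = omega D \<tau> * omega E \<tau>"
    unfolding omega_def by (intro arg_cong2[where f = "(*)"] det_on_cong) (simp_all add: sys_def rhs_union[OF wf un])
  finally show ?thesis .
qed

lemma transfer_union:
  assumes wf: "wf_diagram D" "wf_diagram E" and un: "can_union D E"
    and nz: "omega D \<tau> \<noteq> 0" "omega E \<tau> \<noteq> 0"
  shows "transfer (D ++ E) \<tau> i j = (if i \<in> dom D \<and> j \<in> dom D then transfer D \<tau> i j
    else if i \<in> dom E \<and> j \<in> dom E then transfer E \<tau> i j else 0)"
proof (cases "i \<in> dom (D ++ E) \<and> j \<in> dom (D ++ E)")
  case True
  have nz': "omega (D ++ E) \<tau> \<noteq> 0" using nz omega_union[OF wf un, of \<tau>] by simp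
  define piece where "piece F w p = (if p \<in> crossings F then w p else 0)" for F and w :: "nat \<Rightarrow> 'a" and p
  \<comment> \<open>A unit input at strand \<open>i\<close> is felt only in the part containing
    \<open>i\<close>; the other part is solved with zero input.\<close>
  obtain v w where v: "solves D \<tau> (if i \<in> dom D then unit_at i else (\<lambda>_. 0)) v"
    and w: "solves E \<tau> (if i \<in> dom E then unit_at i else (\<lambda>_. 0)) w"
    using solves_exists[OF wf(1) nz(1)] solves_exists[OF wf(2) nz(2)] by blast
  define u where "u p = (if p \<in> crossings D then v p else w p)" for p
  have uD: "u p = v p" if "p \<in> crossings D" for p using that by (simp add: u_def)
  have uE: "u p = w p" if "p \<in> crossings E" for p using that can_unionD(2)[OF un] by (auto simp: u_def)
  have "rhs D \<tau> p (if i \<in> dom D then unit_at i else (\<lambda>_. 0)) v = rhs D \<tau> p (unit_at i) u" if "p \<in> crossings D" for p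
    by (rule rhs_cong[OF wf(1) that]) (auto simp: uD unit_at_def)
  moreover have "rhs E \<tau> p (if i \<in> dom E then unit_at i else (\<lambda>_. 0)) w = rhs E \<tau> p (unit_at i) u" if "p \<in> crossings E" for p
    by (rule rhs_cong[OF wf(2) that]) (auto simp: uE unit_at_def)
  ultimately have u: "solves (D ++ E) \<tau> (unit_at i) u"
    using v w unfolding solves_def can_unionD(3)[OF un] by (auto simp: rhs_union[OF wf un] uD uE)
  have eq: "transfer (D ++ E) \<tau> i j = arc_value (unit_at i) u (out_arc (D ++ E) j)"
    by (rule transfer_eq[OF wf_union[OF wf un] nz' True[THEN conjunct1] True[THEN conjunct2] u])
  have main: "arc_value (unit_at i) u (out_arc (D ++ E) j) = (if i \<in> dom F then transfer F \<tau> i j else 0)"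
    if F: "wf_diagram F" "omega F \<tau> \<noteq> 0" "j \<in> dom F" "(D ++ E) j = F j"
      "solves F \<tau> (if i \<in> dom F then unit_at i else (\<lambda>_. 0)) z" "\<And>p. p \<in> crossings F \<Longrightarrow> u p = z p" for F z
  proof -
    have out: "out_arc (D ++ E) j = out_arc F j" using F(4) by (simp add: out_arc_def)
    show ?thesis
    proof (cases "i \<in> dom F")
      case True
      have "arc_value (unit_at i) u (out_arc F j) = arc_value (unit_at i) z (out_arc F j)"
        by (rule arc_value_cong[OF out_arc_valid[OF F(3)]]) (simp_all add: F(6))
      thus ?thesis using transfer_eq[OF F(1,2) True F(3)] F(5) True out by simp
    next
      case False
      have "z q = 0" if "q \<in> crossings F" for q
      proof -
        \<comment> \<open>Zero input admits the zero solution, and Cramer's rule leaves no other on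
          the crossings.\<close>
        have "solves F \<tau> (\<lambda>_. 0) (\<lambda>_. 0)" by (simp add: solves_def rhs_zero)
        moreover have "solves F \<tau> (\<lambda>_. 0) z" using F(5) False by simp
        ultimately show ?thesis
          using solves_cramer[OF F(1,2) _ that, of "\<lambda>_. 0" "\<lambda>_. 0"]
            solves_cramer[OF F(1,2) _ that, of "\<lambda>_. 0" z] by simp
      qed
      hence "arc_value (unit_at i) u (out_arc F j) = arc_value (\<lambda>_. 0) (\<lambda>_. 0) (out_arc F j)"
        using False by (intro arc_value_cong[OF out_arc_valid[OF F(3)]]) (auto simp: F(6) unit_at_def)
      thus ?thesis using False out by simp
    qed
  qed
  show ?thesis
  proof (cases "j \<in> dom D")
    case jD: True
    hence "j \<notin> dom E" using can_unionD(1)[OF un] by auto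
    thus ?thesis using main[OF wf(1) nz(1) jD can_unionD(4)[OF un jD] v uD] jD eq by auto
  next
    case False
    hence jE: "j \<in> dom E" using True by auto
    show ?thesis using main[OF wf(2) nz(2) jE can_unionD(5)[OF un jE] w uE] jE eq False by auto
  qed
next
  case False
  thus ?thesis by (auto simp: transfer_def)
qed

subsection \<open>Relabelling and renaming\<close>

lemma follow_relabel: "follow (Inl (f x)) l = map_sum f id (follow (Inl x) l)"
  by (induction l rule: rev_induct) (auto simp: follow_append)

lemma relabel_transport:
  assumes "can_relabel a b D"
  shows "transport D (relabel a b D) (\<lambda>x. if x = a then b else x) id (map_sum (\<lambda>x. if x = a then b else x) id)"
proof -
  have eq: "relabel a b D (if x = a then b else x) = D x" if "x \<in> dom D" for x
  proof (cases "x = a")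
    case False
    hence "x \<noteq> b" using that assms by (auto simp: can_relabel_def)
    thus ?thesis using False by (simp add: relabel_def)
  qed (use that in \<open>auto simp: relabel_def\<close>)
  show ?thesis unfolding transport_def
  proof (intro conjI allI impI)
    let ?f = "\<lambda>x. if x = a then b else x"
    fix x l v l' assume D: "D x = Some (l @ v # l')"
    have "relabel a b D (?f x) = Some (l @ rename_pass id v # l')"
      using eq[of x] D unfolding rename_pass_id by (metis domI)
    thus "\<exists>m m'. relabel a b D (?f x) = Some (m @ rename_pass id v # m') \<and>
        follow (Inl (?f x)) m = map_sum ?f id (follow (Inl x) l)"
      using follow_relabel[of ?f x l] by blast
  qed simp
qed

lemma crossings_relabel:
  "wf_diagram D \<Longrightarrow> can_relabel a b D \<Longrightarrow> crossings (relabel a b D) = crossings D"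
  by (simp add: crossings_passes wf_finite dom_relabel passes_relabel)

lemma rhs_relabel:
  assumes "wf_diagram D" "can_relabel a b D" "p \<in> crossings D"
  shows "rhs (relabel a b D) \<tau> p y u
    = rhs D (\<lambda>x. \<tau> (if x = a then b else x)) p (\<lambda>x. y (if x = a then b else x)) u"
  using rhs_transport[OF assms(1) wf_relabel[OF assms(1,2)] relabel_transport[OF assms(2)] assms(3), of \<tau> y u]
  by (simp add: comp_def)

lemma omega_relabel:
  assumes "wf_diagram D" "can_relabel a b D"
  shows "omega (relabel a b D) \<tau> = omega D (\<lambda>x. \<tau> (if x = a then b else x))"
  unfolding omega_def crossings_relabel[OF assms]
  by (rule det_on_cong) (simp add: sys_def rhs_relabel[OF assms])

lemma transfer_relabel:
  assumes wf: "wf_diagram D" and re: "can_relabel a b D"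
    and nz: "omega D (\<lambda>x. \<tau> (if x = a then b else x)) \<noteq> 0"
    and ij: "i \<in> insert b (dom D - {a})" "j \<in> insert b (dom D - {a})"
  shows "transfer (relabel a b D) \<tau> i j = transfer D (\<lambda>x. \<tau> (if x = a then b else x))
    (if i = b then a else i) (if j = b then a else j)"
proof -
  let ?E = "relabel a b D" and ?\<tau> = "\<lambda>x. \<tau> (if x = a then b else x)"
  let ?o = "\<lambda>i. if i = b then a else i" and ?f = "\<lambda>x. if x = a then b else x"
  have dom: "i \<in> dom ?E" "j \<in> dom ?E" "?o i \<in> dom D" "?o j \<in> dom D"
    using ij re by (auto simp: dom_relabel can_relabel_def)
  obtain u where u: "solves D ?\<tau> (unit_at (?o i)) u" using solves_exists[OF wf nz] by blast
  have inv: "?f x = i \<longleftrightarrow> x = ?o i" if "x \<in> dom D" for x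
    using that ij re by (auto simp: can_relabel_def)
  have "rhs D ?\<tau> p (\<lambda>x. unit_at i (?f x)) u = rhs D ?\<tau> p (unit_at (?o i)) u" if "p \<in> crossings D" for p
    using inv by (intro rhs_cong[OF wf that]) (auto simp: unit_at_def)
  hence u': "solves ?E \<tau> (unit_at i) u" using u unfolding solves_def
    by (simp add: crossings_relabel[OF wf re] rhs_relabel[OF wf re])
  have nz': "omega ?E \<tau> \<noteq> 0" using nz omega_relabel[OF wf re, of \<tau>] by simp
  have out: "out_arc ?E j = map_sum ?f id (out_arc D (?o j))"
  proof -
    have "?f (?o j) = j" "?E j = D (?o j)" using ij re by (auto simp: relabel_def can_relabel_def)
    thus ?thesis using follow_relabel[of ?f "?o j"] unfolding out_arc_def by simp
  qed
  have "arc_value (unit_at i) u (map_sum ?f id s) = arc_value (unit_at (?o i)) u s"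
    if "s \<in> Inl ` dom D \<union> Inr ` crossings D" for s
    using that by (elim UnE imageE) (simp_all add: unit_at_def inv del: if_split)
  note arc_val = this
  show ?thesis
    unfolding transfer_eq[OF wf_relabel[OF wf re] nz' dom(1,2) u'] transfer_eq[OF wf nz dom(3,4) u] out
    by (rule arc_val[OF out_arc_valid[OF dom(4)]])
qed

lemma rename_follow: "follow (Inl x) (map (rename_pass f) l) = map_sum id f (follow (Inl x) l)"
  by (induction l rule: rev_induct) (auto simp: follow_append)

lemma rename_transport: "transport D (rename_crossings f D) id f (map_sum id f)"
  unfolding transport_def
proof (intro conjI allI impI)
  fix x l v l' assume "D x = Some (l @ v # l')"
  thus "\<exists>m m'. rename_crossings f D (id x) = Some (m @ rename_pass f v # m') \<and>
      follow (Inl (id x)) m = map_sum id f (follow (Inl x) l)"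
    by (intro exI[of _ "map (rename_pass f) l"] exI[of _ "map (rename_pass f) l'"])
       (simp add: rename_crossings_eq rename_follow)
qed simp

lemma rhs_rename:
  assumes "wf_diagram D" "inj_on f (crossings D)" "p \<in> crossings D"
  shows "rhs (rename_crossings f D) \<tau> (f p) y u = rhs D \<tau> p y (u \<circ> f)"
  using rhs_transport[OF assms(1) wf_rename[OF assms(1,2)] rename_transport assms(3), of \<tau> y u] by simp

lemma omega_rename:
  assumes wf: "wf_diagram D" and inj: "inj_on f (crossings D)"
  shows "omega (rename_crossings f D) \<tau> = omega D \<tau>"
  unfolding omega_def crossings_rename[OF wf_finite[OF wf]]
proof (rule det_on_bij[of f])
  show "finite (crossings D)" by (rule finite_crossings[OF wf_finite[OF wf]])
  fix p q assume pq: "p \<in> crossings D" "q \<in> crossings D"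
  have "rhs D \<tau> p (\<lambda>_. 0) (unit_at (f q) \<circ> f) = rhs D \<tau> p (\<lambda>_. 0) (unit_at q)"
    using inj pq by (intro rhs_cong[OF wf pq(1)]) (auto simp: unit_at_def inj_on_def)
  moreover have "(f p = f q) = (p = q)" using inj pq by (auto simp: inj_on_def)
  ultimately show "sys (rename_crossings f D) \<tau> (f p) (f q) = sys D \<tau> p q"
    unfolding sys_def rhs_rename[OF wf inj pq(1)] by (simp add: unit_at_def)
qed (simp add: inj inj_on_imp_bij_betw)

lemma transfer_rename:
  assumes wf: "wf_diagram D" and inj: "inj_on f (crossings D)" and nz: "omega D \<tau> \<noteq> 0"
  shows "transfer (rename_crossings f D) \<tau> = transfer D \<tau>"
proof (intro ext)
  fix i j
  show "transfer (rename_crossings f D) \<tau> i j = transfer D \<tau> i j"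
  proof (cases "i \<in> dom D \<and> j \<in> dom D")
    case True
    let ?E = "rename_crossings f D"
    note wf' = wf_rename[OF wf inj]
    have nz': "omega ?E \<tau> \<noteq> 0" using nz omega_rename[OF wf inj, of \<tau>] by simp
    obtain u where u: "solves ?E \<tau> (unit_at i) u" using solves_exists[OF wf' nz'] by blast
    hence u': "solves D \<tau> (unit_at i) (u \<circ> f)" unfolding solves_def
      by (simp add: crossings_rename[OF wf_finite[OF wf]] rhs_rename[OF wf inj])
    have "out_arc ?E j = map_sum id f (out_arc D j)"
      using True by (auto simp: out_arc_def rename_crossings_eq rename_follow)
    moreover have "arc_value y u (map_sum id f s) = arc_value y (u \<circ> f) s" for y s by (cases s) auto
    ultimately show ?thesis
      using transfer_eq[OF wf' nz' _ _ u] transfer_eq[OF wf nz _ _ u'] True by (simp add: dom_rename)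
  next
    case False
    thus ?thesis by (auto simp: transfer_def dom_rename)
  qed
qed

subsection \<open>Stitching\<close>

lemma follow_commute:
  assumes "\<And>q. g (Inr q) = Inr q"
  shows "follow (g s) l = g (follow s l)"
  by (induction l rule: rev_induct) (auto simp: follow_append assms)

lemma unit_at_sym: "unit_at i j = unit_at j i"
  by (auto simp: unit_at_def)

locale stitching =
  fixes D :: wdiagram and a b c :: nat
  assumes wf: "wf_diagram D" and can: "can_stitch a b c D"
begin

abbreviation "E \<equiv> stitch a b c D"

definition lab :: "nat \<Rightarrow> nat" where
  "lab x = (if x = a \<or> x = b then c else x)"

definition joint :: "nat + nat" where
  "joint = follow (Inl c) (the (D a))"

text \<open>The initial arc of \<open>b\<close> becomes the arc on which \<open>a\<close> ends. If
  \<open>a\<close> has no underpass, that is the initial arc of \<open>c\<close>; otherwise an input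
  of the old system has turned into one of its unknowns.\<close>

definition g :: "nat + nat \<Rightarrow> nat + nat" where
  "g = case_sum (\<lambda>x. if x = b then joint else Inl (lab x)) Inr"

lemma g_simps [simp]: "g (Inr q) = Inr q" "g (Inl b) = joint" "x \<noteq> b \<Longrightarrow> g (Inl x) = Inl (lab x)"
  by (simp_all add: g_def)

lemma ab: "a \<in> dom D" "b \<in> dom D" "a \<noteq> b" "b \<noteq> a" "x \<in> dom D \<Longrightarrow> x \<noteq> a \<Longrightarrow> x \<noteq> b \<Longrightarrow> x \<noteq> c"
  using can by (auto simp: can_stitch_def)

lemma E_apply: "E c = Some (the (D a) @ the (D b))" "x \<in> dom D \<Longrightarrow> x \<noteq> a \<Longrightarrow> x \<noteq> b \<Longrightarrow> E x = D x"
  using ab(5)[of x] by (auto simp: stitch_def)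

lemma joint_eq: "joint = g (out_arc D a)"
  using follow_commute[of g "Inl a" "the (D a)"] ab by (simp add: joint_def out_arc_def lab_def)

lemma out_arc_cases:
  obtains "out_arc D a = Inl a" "joint = Inl c"
    | r where "out_arc D a = Inr r" "joint = Inr r" "r \<in> crossings D"
  using follow_cases[of "Inl a" "the (D a)"] out_arc_valid[OF ab(1)] ab joint_eq
  by (auto simp: out_arc_def lab_def)

lemma transport_E: "transport D E lab id g"
  unfolding transport_def
proof (intro conjI allI impI)
  fix x l v l' assume D: "D x = Some (l @ v # l')"
  have fol: "follow (g s) l = g (follow s l)" for s by (rule follow_commute) simp
  consider "x = a" | "x = b" | "x \<noteq> a" "x \<noteq> b" by blast
  thus "\<exists>m m'. E (lab x) = Some (m @ rename_pass id v # m') \<and> follow (Inl (lab x)) m = g (follow (Inl x) l)"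
  proof cases
    case 1
    have "follow (Inl c) l = g (follow (Inl a) l)" using fol[of "Inl a"] ab by (simp add: lab_def)
    thus ?thesis using D 1 E_apply(1)
      by (intro exI[of _ l] exI[of _ "l' @ the (D b)"]) (simp add: lab_def)
  next
    case 2
    have "follow (Inl c) (the (D a) @ l) = g (follow (Inl b) l)"
      using fol[of "Inl b"] by (simp add: follow_append joint_def)
    thus ?thesis using D 2 E_apply(1)
      by (intro exI[of _ "the (D a) @ l"] exI[of _ l']) (simp add: lab_def)
  next
    case 3
    have "follow (Inl x) l = g (follow (Inl x) l)" using fol[of "Inl x"] 3 by (simp add: lab_def)
    thus ?thesis using D 3 E_apply(2)[of x]
      by (intro exI[of _ l] exI[of _ l']) (simp add: lab_def domI)
  qed
qed simp

lemma out_arc_E: "out_arc E c = g (out_arc D b)"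
  "x \<in> dom D \<Longrightarrow> x \<noteq> a \<Longrightarrow> x \<noteq> b \<Longrightarrow> out_arc E x = g (out_arc D x)"
proof -
  have fol: "follow (g s) l = g (follow s l)" for s l by (rule follow_commute) simp
  show "out_arc E c = g (out_arc D b)"
    using fol[of "Inl b" "the (D b)"] by (simp add: out_arc_def E_apply(1) follow_append joint_def)
  show "x \<in> dom D \<Longrightarrow> x \<noteq> a \<Longrightarrow> x \<noteq> b \<Longrightarrow> out_arc E x = g (out_arc D x)"
    using fol[of "Inl x" "the (D x)"] by (simp add: out_arc_def E_apply(2) lab_def)
qed

lemma crossings_E: "crossings E = crossings D"
  using wf can by (simp add: crossings_passes wf_finite dom_stitch passes_stitch)

lemma rhs_E:
  assumes "p \<in> crossings D"
  shows "rhs E \<tau> p y u = rhs D (\<lambda>x. \<tau> (lab x)) p (\<lambda>x. arc_value y u (g (Inl x))) u"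
  using rhs_transport[OF wf wf_stitch[OF wf can] transport_E assms, of \<tau> y u] by (simp add: comp_def)

context
  fixes \<tau> :: "nat \<Rightarrow> 'k::field"
  assumes nz: "omega D (\<lambda>x. \<tau> (lab x)) \<noteq> 0"
begin

abbreviation "\<sigma> \<equiv> (\<lambda>x. \<tau> (lab x))"

text \<open>Let \<open>u\<close> be the response to a unit input at \<open>b\<close>. If
  \<open>a\<close> ends on the arc \<open>r\<close> leaving a crossing, only column \<open>r\<close>
  changes: it becomes the old matrix applied to the \<open>r\<close>-th unit vector minus
  \<open>u\<close>. Cramer's rule yields the factor 1 - \<open>u r\<close>, and \<open>u r\<close>
  is the entry \<gamma>. If \<open>a\<close> has no underpass, no unknown is affected and \<gamma> =
  0.\<close>

lemma omega_E: "omega E \<tau> = (1 - transfer D \<sigma> b a) * omega D \<sigma>"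
proof (cases rule: out_arc_cases)
  case 1
  obtain u where u: "solves D \<sigma> (unit_at b) u" using solves_exists[OF wf nz] by blast
  have "transfer D \<sigma> b a = 0"
    using transfer_eq[OF wf nz ab(2,1) u] 1 ab by (simp add: unit_at_def)
  moreover have "omega E \<tau> = omega D \<sigma>"
    unfolding omega_def crossings_E
  proof (rule det_on_cong)
    fix p q assume p: "p \<in> crossings D"
    have "arc_value (\<lambda>_. 0) (unit_at q) (g (Inl x)) = (0 :: 'k)" for x
      using 1 by (cases "x = b") simp_all
    thus "sys E \<tau> p q = sys D \<sigma> p q" by (simp add: sys_def rhs_E[OF p])
  qed
  ultimately show ?thesis by simp
next
  case (2 r)
  obtain u where u: "solves D \<sigma> (unit_at b) u" using solves_exists[OF wf nz] by blast
  have \<gamma>: "transfer D \<sigma> b a = u r"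
    using transfer_eq[OF wf nz ab(2,1) u] 2 by simp
  note fin = finite_crossings[OF wf_finite[OF wf]]
  let ?b = "\<lambda>p. sys D \<sigma> p r - rhs D \<sigma> p (unit_at b) (\<lambda>_. 0)"
  have sum: "(\<Sum>q\<in>crossings D. sys D \<sigma> p q * (unit_at r q - u q)) = ?b p" if "p \<in> crossings D" for p
  proof -
    have "(\<Sum>q\<in>crossings D. sys D \<sigma> p q * u q) = rhs D \<sigma> p (unit_at b) (\<lambda>_. 0)"
      using u that unfolding solves_iff[OF wf] by blast
    moreover have "(\<Sum>q\<in>crossings D. sys D \<sigma> p q * unit_at r q) = sys D \<sigma> p r"
      using sum_unit_at[OF fin, of r "sys D \<sigma> p"] 2(3) by (simp add: mult.commute unit_at_sym[of r])
    ultimately show ?thesis by (simp add: right_diff_distrib sum_subtractf)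
  qed
  have "omega E \<tau> = det_on (crossings D) (\<lambda>p q. if q = r then ?b p else sys D \<sigma> p q)"
    unfolding omega_def crossings_E
  proof (rule det_on_cong)
    fix p q assume p: "p \<in> crossings D"
    \<comment> \<open>In \<open>E\<close> the input of \<open>b\<close> is the value on arc
      \<open>r\<close>, so the unknown \<open>r\<close>, and no other, also acts as an input at
      \<open>b\<close>.\<close>
    have "arc_value (\<lambda>_. 0) (unit_at q) (g (Inl x)) = (0 + unit_at q r * unit_at b x :: 'k)" for x
      using 2 by (cases "x = b") (simp_all add: unit_at_def)
    hence "rhs E \<tau> p (\<lambda>_. 0) (unit_at q)
        = rhs D \<sigma> p (\<lambda>x. 0 + unit_at q r * unit_at b x) (\<lambda>x. unit_at q x + unit_at q r * 0)"
      by (simp add: rhs_E[OF p])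
    also have "\<dots> = rhs D \<sigma> p (\<lambda>_. 0) (unit_at q) + unit_at q r * rhs D \<sigma> p (unit_at b) (\<lambda>_. 0)"
      unfolding rhs_linear by simp
    finally show "sys E \<tau> p q = (if q = r then ?b p else sys D \<sigma> p q)"
      by (simp add: sys_def) (simp add: unit_at_def)
  qed
  also have "\<dots> = (unit_at r r - u r) * omega D \<sigma>"
    unfolding omega_def by (rule det_on_cramer[OF fin 2(3) sum])
  finally show ?thesis by (simp add: \<gamma> unit_at_def)
qed

text \<open>Superposition: the glued system is solved by a solution of the old one with input 1 at
  \<open>i'\<close> and a suitable input at \<open>b\<close>. The feedback from the end of
  \<open>a\<close> into \<open>b\<close> produces the denominator.\<close>

lemma transfer_E:
  assumes nz': "1 - transfer D \<sigma> b a \<noteq> 0"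
    and i: "i \<in> insert c (dom D - {a, b})" and j: "j \<in> insert c (dom D - {a, b})"
  defines "i' \<equiv> if i = c then a else i" and "j' \<equiv> if j = c then b else j"
  shows "transfer E \<tau> i j = transfer D \<sigma> i' j' + transfer D \<sigma> i' a * transfer D \<sigma> b j' / (1 - transfer D \<sigma> b a)"
proof -
  \<comment> \<open>The value carried through the joint: what \<open>i'\<close> sends directly to
    the end of \<open>a\<close>, plus what \<open>\<kappa>\<close> itself returns there after being
    fed into \<open>b\<close>.\<close>
  define \<kappa> where "\<kappa> = transfer D \<sigma> i' a / (1 - transfer D \<sigma> b a)"
  have \<kappa>: "\<kappa> = transfer D \<sigma> i' a + \<kappa> * transfer D \<sigma> b a"
    using nz' by (simp add: \<kappa>_def field_simps)
  have dom: "i' \<in> dom D" "j' \<in> dom D" "i' \<noteq> b" using i j ab by (auto simp: i'_def j'_def)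
  obtain v where v: "solves D \<sigma> (unit_at i') v" using solves_exists[OF wf nz] by blast
  obtain w where w: "solves D \<sigma> (unit_at b) w" using solves_exists[OF wf nz] by blast
  define u where "u = (\<lambda>p. v p + \<kappa> * w p)"
  define y where "y = (\<lambda>x. unit_at i' x + \<kappa> * unit_at b x)"
  have val: "arc_value y u s = arc_value (unit_at i') v s + \<kappa> * arc_value (unit_at b) w s" for s
    unfolding y_def u_def by (rule arc_value_linear)
  have out: "arc_value y u (out_arc D x) = transfer D \<sigma> i' x + \<kappa> * transfer D \<sigma> b x" if "x \<in> dom D" for x
    unfolding val using transfer_eq[OF wf nz dom(1) that v] transfer_eq[OF wf nz ab(2) that w] by simp
  have glue: "arc_value (unit_at i) u (g (Inl x)) = y x" if "x \<in> dom D" for x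
  proof (cases "x = b")
    case True
    have "arc_value (unit_at i) u joint = \<kappa>"
    proof (cases rule: out_arc_cases)
      case 1
      have "\<kappa> = arc_value y u (Inl a)" using out[OF ab(1)] \<kappa> 1 by simp
      thus ?thesis using 1 ab i by (auto simp: y_def unit_at_def i'_def)
    next
      case (2 r)
      thus ?thesis using out[OF ab(1)] \<kappa> by simp
    qed
    thus ?thesis using True dom by (simp add: y_def unit_at_def)
  next
    case False
    have "(lab x = i) = (x = i')" using that False i ab by (auto simp: lab_def i'_def)
    thus ?thesis using False by (simp add: y_def unit_at_def)
  qed
  have "solves E \<tau> (unit_at i) u"
    unfolding solves_def crossings_E
  proof
    fix p assume p: "p \<in> crossings D"
    have "rhs E \<tau> p (unit_at i) u = rhs D \<sigma> p y u"
      unfolding rhs_E[OF p] by (rule rhs_cong[OF wf p]) (simp_all add: glue)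
    also have "\<dots> = u p" using v w p unfolding y_def u_def rhs_linear by (simp add: solves_def)
    finally show "u p = rhs E \<tau> p (unit_at i) u" by simp
  qed
  hence "transfer E \<tau> i j = arc_value (unit_at i) u (out_arc E j)"
    using i j nz nz' by (intro transfer_eq wf_stitch wf can) (simp_all add: dom_stitch[OF can] omega_E)
  also have "out_arc E j = g (out_arc D j')"
    using out_arc_E j by (auto simp: j'_def)
  also have "arc_value (unit_at i) u (g (out_arc D j')) = arc_value y u (out_arc D j')"
    using out_arc_valid[OF dom(2)] by (elim UnE imageE) (simp_all add: glue)
  also have "\<dots> = transfer D \<sigma> i' j' + \<kappa> * transfer D \<sigma> b j'" by (rule out[OF dom(2)])
  finally show ?thesis by (simp add: \<kappa>_def)
qed

end
end

subsection \<open>The invariant\<close>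

definition invariant :: "wdiagram \<Rightarrow> gamma" where
  "invariant D = Gelem (dom D) (omega D tvar) (transfer D tvar)"

text \<open>Evaluation at t = 1 sends this determinant to the one in \<open>omega_nonzero\<close>.
  The map \<open>f\<close> need not be injective, because stitching identifies variables.\<close>

lemma omega_tvar_nonzero:
  assumes "wf_diagram D"
  shows "omega D (\<lambda>x. tvar (f x)) \<noteq> 0"
proof
  interpret partial_hom "fract_regular at_one" "fract_ext at_one" by (rule partial_hom_at_one)
  assume "omega D (\<lambda>x. tvar (f x)) = 0"
  hence "omega D (\<lambda>_. 1 :: rat) = 0"
    using omega_in(2)[of "\<lambda>x. tvar (f x)" D] by (simp add: at_one_tvar tvar_regular[OF at_one_hom] zero)
  thus False using omega_nonzero[OF assms] by blast
qed

lemma subst_omega: "omega D tvar \<in> fract_regular (subst_fract f)"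
  "subst f (omega D tvar) = omega D (\<lambda>x. tvar (f x))"
proof -
  interpret partial_hom "fract_regular (subst_fract f)" "subst f" by (rule partial_hom_subst)
  show "omega D tvar \<in> fract_regular (subst_fract f)" "subst f (omega D tvar) = omega D (\<lambda>x. tvar (f x))"
    using omega_in[of tvar D] by (simp_all add: subst_tvar tvar_regular[OF subst_fract_hom] tvar_nonzero)
qed

lemma subst_transfer:
  assumes "wf_diagram D"
  shows "transfer D tvar i j \<in> fract_regular (subst_fract f)"
    "subst f (transfer D tvar i j) = transfer D (\<lambda>x. tvar (f x)) i j"
proof -
  interpret partial_hom "fract_regular (subst_fract f)" "subst f" by (rule partial_hom_subst)
  show "transfer D tvar i j \<in> fract_regular (subst_fract f)"
    "subst f (transfer D tvar i j) = transfer D (\<lambda>x. tvar (f x)) i j"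
    using transfer_in[of tvar D i j] assms
    by (simp_all add: subst_tvar tvar_regular[OF subst_fract_hom] tvar_nonzero omega_tvar_nonzero)
qed

lemma invariant_add_strand:
  assumes "wf_diagram D" "a \<notin> dom D"
  shows "invariant (add_strand a D) = gamma_e a (invariant D)"
proof -
  have "dom (add_strand a D) = insert a (dom D)" by (simp add: add_strand_def)
  thus ?thesis
    using transfer_add_strand[OF assms omega_tvar_nonzero[OF assms(1), of "\<lambda>x. x"]]
    by (simp add: invariant_def omega_add_strand[OF assms] fun_eq_iff)
qed

lemma invariant_union:
  "wf_diagram D \<Longrightarrow> wf_diagram E \<Longrightarrow> can_union D E \<Longrightarrow>
    invariant (D ++ E) = gamma_union (invariant D) (invariant E)"
  using omega_tvar_nonzero[of D "\<lambda>x. x"] omega_tvar_nonzero[of E "\<lambda>x. x"]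
  by (simp add: invariant_def omega_union transfer_union fun_eq_iff Un_commute)

lemma transfer_outside: "i \<notin> dom D \<or> j \<notin> dom D \<Longrightarrow> transfer D \<tau> i j = 0"
  by (auto simp: transfer_def)

lemma invariant_relabel:
  assumes wf: "wf_diagram D" and re: "can_relabel a b D"
  shows "invariant (relabel a b D) = gamma_relabel a b (invariant D)"
proof -
  have "transfer (relabel a b D) tvar i j = (if i \<in> insert b (dom D - {a}) \<and> j \<in> insert b (dom D - {a})
      then subst (\<lambda>i. if i = a then b else i) (transfer D tvar (if i = b then a else i) (if j = b then a else j))
      else 0)" for i j
  proof (cases "i \<in> insert b (dom D - {a}) \<and> j \<in> insert b (dom D - {a})")
    case True
    have "omega D (\<lambda>x. tvar (if x = a then b else x)) \<noteq> 0" by (rule omega_tvar_nonzero[OF wf])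
    from transfer_relabel[OF wf re this, of i j] True show ?thesis
      unfolding subst_transfer[OF wf] by presburger
  next
    case False
    hence "transfer (relabel a b D) tvar i j = 0"
      by (intro transfer_outside) (simp only: dom_relabel[OF re] de_Morgan_conj)
    thus ?thesis using False by presburger
  qed
  thus ?thesis
    by (simp add: invariant_def Let_def dom_relabel[OF re] omega_relabel[OF wf re] subst_omega fun_eq_iff del: insert_iff)
qed

lemma invariant_stitch:
  assumes wf: "wf_diagram D" and can: "can_stitch a b c D"
  shows "invariant (stitch a b c D) = gamma_stitch a b c (invariant D)"
proof -
  interpret stitching D a b c by unfold_locales fact+
  have lab: "(\<lambda>i. if i = a \<or> i = b then c else i) = lab" by (simp add: fun_eq_iff lab_def)
  interpret h: partial_hom "fract_regular (subst_fract lab)" "subst lab" by (rule partial_hom_subst)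
  note reg = subst_omega(1)[of D lab] subst_transfer(1)[OF wf, of _ _ lab]
  have nz: "omega D (\<lambda>x. tvar (lab x)) \<noteq> 0" by (rule omega_tvar_nonzero[OF wf])
  note omega_E = omega_E[OF nz]
  let ?M = "transfer D tvar" and ?M' = "transfer D (\<lambda>x. tvar (lab x))"
  \<comment> \<open>This denominator is a factor of the determinant of the stitched diagram, which
    is itself nonzero.\<close>
  have nz': "1 - ?M' b a \<noteq> 0"
    using omega_tvar_nonzero[OF wf_stitch[OF wf can], of "\<lambda>x. x"] omega_E by simp
  have sub: "subst lab (?M i j + ?M k l * ?M m n / (1 - ?M b a)) = ?M' i j + ?M' k l * ?M' m n / (1 - ?M' b a)"
    for i j k l m n
  proof -
    have "1 - ?M b a \<in> fract_regular (subst_fract lab)" "subst lab (1 - ?M b a) = 1 - ?M' b a"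
      using reg by (simp_all add: h.diff h.one subst_transfer(2)[OF wf])
    thus ?thesis using reg nz' by (simp add: h.add h.mult h.divide subst_transfer(2)[OF wf])
  qed
  have "subst lab ((1 - ?M b a) * omega D tvar) = omega E tvar"
    using reg by (simp add: h.diff h.one h.mult subst_transfer(2)[OF wf] subst_omega(2) omega_E)
  moreover have entry: "transfer E tvar i j = (if i = c \<and> j = c then subst lab (?M a b + ?M a a * ?M b b / (1 - ?M b a))
           else if i = c \<and> j \<in> dom D - {a, b} then subst lab (?M a j + ?M a a * ?M b j / (1 - ?M b a))
           else if i \<in> dom D - {a, b} \<and> j = c then subst lab (?M i b + ?M b b * ?M i a / (1 - ?M b a))
           else if i \<in> dom D - {a, b} \<and> j \<in> dom D - {a, b} then subst lab (?M i j + ?M i a * ?M b j / (1 - ?M b a))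
           else 0)" (is "_ = ?rhs i j") for i j
  proof (cases "i \<in> insert c (dom D - {a, b}) \<and> j \<in> insert c (dom D - {a, b})")
    case True
    from transfer_E[OF nz nz' True[THEN conjunct1] True[THEN conjunct2]] show ?thesis
      unfolding sub using True ab(5) by (auto simp: mult.commute)
  next
    case False
    hence "transfer E tvar i j = 0"
      by (intro transfer_outside) (simp only: dom_stitch[OF can] de_Morgan_conj)
    moreover have "?rhs i j = 0" using False by auto
    ultimately show ?thesis by (simp only:)
  qed
  ultimately show ?thesis
    by (simp only: invariant_def gamma_stitch.simps Let_def lab dom_stitch[OF can] gamma.inject fun_eq_iff simp_thms)
qed

lemma invariant_rename:
  "wf_diagram D \<Longrightarrow> inj_on f (crossings D) \<Longrightarrow> invariant (rename_crossings f D) = invariant D"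
  using omega_tvar_nonzero[of D "\<lambda>x. x"]
  by (simp add: invariant_def dom_rename omega_rename transfer_rename)

subsection \<open>Invariance under the moves\<close>

definition passage :: "wdiagram \<Rightarrow> nat \<Rightarrow> pass \<Rightarrow> nat + nat \<Rightarrow> bool" where
  "passage D x v a \<longleftrightarrow> (\<exists>l l'. D x = Some (l @ v # l') \<and> a = follow (Inl x) l)"

lemma passage_single: "D x = Some [v] \<Longrightarrow> passage D x v (Inl x)"
  unfolding passage_def by (intro exI[of _ "[]"] exI[of _ "[]"]) simp

lemma passage_first: "D x = Some [v, w] \<Longrightarrow> passage D x v (Inl x)"
  unfolding passage_def by (intro exI[of _ "[]"] exI[of _ "[w]"]) simp

lemma passage_second: "D x = Some [v, w] \<Longrightarrow> passage D x w (if is_over v then Inl x else Inr (crossing v))"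
  unfolding passage_def by (intro exI[of _ "[v]"] exI[of _ "[]"]) simp

lemma crossing_data_passage:
  "wf_diagram D \<Longrightarrow> passage D x (over_pass p s) oa \<Longrightarrow> passage D y (under_pass p s) ua \<Longrightarrow>
    crossing_data D p = (x, s, oa, ua)"
  unfolding passage_def by (metis crossing_atI crossing_dataI)

text \<open>Solutions are unique where it matters, so one explicit solution on each side for every
  unit input decides equality of the matrices.\<close>

lemma invariant_eqI:
  assumes wf: "wf_diagram D" "wf_diagram E" and dom: "dom D = dom E"
    and om: "omega D tvar = omega E tvar"
    and sol: "\<And>i. i \<in> dom D \<Longrightarrow> \<exists>u v. solves D tvar (unit_at i) u \<and> solves E tvar (unit_at i) v \<and>
      (\<forall>j\<in>dom D. arc_value (unit_at i) u (out_arc D j) = arc_value (unit_at i) v (out_arc E j))"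
  shows "invariant D = invariant E"
proof -
  have nz: "omega D tvar \<noteq> 0" "omega E tvar \<noteq> 0"
    using omega_tvar_nonzero[OF wf(1), of "\<lambda>x. x"] omega_tvar_nonzero[OF wf(2), of "\<lambda>x. x"] by auto
  have "transfer D tvar i j = transfer E tvar i j" for i j
  proof (cases "i \<in> dom D \<and> j \<in> dom D")
    case True
    hence T: "i \<in> dom D" "j \<in> dom D" "i \<in> dom E" "j \<in> dom E" unfolding dom[symmetric] by blast+
    obtain u v where "solves D tvar (unit_at i) u" "solves E tvar (unit_at i) v"
      "arc_value (unit_at i) u (out_arc D j) = arc_value (unit_at i) v (out_arc E j)"
      using sol[OF T(1)] T(2) by blast
    thus ?thesis using transfer_eq[OF wf(1) nz(1) T(1,2)] transfer_eq[OF wf(2) nz(2) T(3,4)] by simp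
  next
    case False
    hence "i \<notin> dom E \<or> j \<notin> dom E" "i \<notin> dom D \<or> j \<notin> dom D" using dom by simp_all
    thus ?thesis by (simp only: transfer_outside)
  qed
  thus ?thesis using dom om by (simp add: invariant_def fun_eq_iff)
qed

lemma wf_two_strands:
  assumes "a \<noteq> b" "paired (mset l + mset m)"
  shows "wf_diagram [a \<mapsto> l, b \<mapsto> m]"
proof -
  have "passes [a \<mapsto> l, b \<mapsto> m] = mset l + mset m"
    using passes_upd[of "[a \<mapsto> l]" b m] passes_upd[of Map.empty a l] assms(1)
    by (simp add: passes_def[of Map.empty])
  thus ?thesis using assms(2) by (simp add: wf_diagram_iff)
qed

lemma wf_three_strands:
  assumes "distinct [a, b, c]" "paired (mset l + mset m + mset n)"
  shows "wf_diagram [a \<mapsto> l, b \<mapsto> m, c \<mapsto> n]"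
proof -
  have "passes [a \<mapsto> l, b \<mapsto> m, c \<mapsto> n] = mset l + mset m + mset n"
    using passes_upd[of "[a \<mapsto> l, b \<mapsto> m]" c n] passes_upd[of "[a \<mapsto> l]" b m] passes_upd[of Map.empty a l] assms(1)
    by (simp add: passes_def[of Map.empty])
  thus ?thesis using assms(2) by (simp add: wf_diagram_iff)
qed

lemma paired_empty: "paired {#}"
  by (simp add: paired_def)

lemma paired_one: "paired {#over_pass p s, under_pass p s#}"
  by (auto simp: paired_def)

lemma paired_two: "p \<noteq> q \<Longrightarrow> paired {#over_pass p s, under_pass p s, over_pass q s', under_pass q s'#}"
  using paired_union[OF paired_one paired_one, of p s q s'] by (simp add: add_mset_commute)

lemma paired_three:
  "distinct [p, q, r] \<Longrightarrow> paired {#over_pass p s, under_pass p s, over_pass q s', under_pass q s',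
     over_pass r s'', under_pass r s''#}"
  using paired_union[OF paired_two[of p q s s'] paired_one[of r s'']] by (simp add: add_mset_commute)

lemma invariant_crossing:
  assumes "a \<noteq> b"
  shows "wf_diagram (crossing_diagram a b p s)" "invariant (crossing_diagram a b p s) = gamma_crossing a b s"
proof -
  let ?D = "crossing_diagram a b p s"
  show wf: "wf_diagram ?D"
    unfolding crossing_diagram_def using assms paired_one[of p s]
    by (intro wf_two_strands) (simp_all add: add_mset_commute)
  have dom: "dom ?D = {a, b}" by (auto simp: crossing_diagram_def)
  have cr: "crossings ?D = {p}" using assms by (simp add: crossings_def crossing_diagram_def insert_commute)
  have data: "crossing_data ?D p = (a, s, Inl a, Inl b)"
    by (rule crossing_data_passage[OF wf passage_single passage_single])
       (use assms in \<open>simp_all add: crossing_diagram_def\<close>)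
  have out: "out_arc ?D a = Inl a" "out_arc ?D b = Inr p"
    using assms by (simp_all add: out_arc_def crossing_diagram_def)
  have om: "omega ?D tvar = 1"
    by (simp add: omega_def cr det_on_singleton sys_def rhs_def data) (simp add: unit_at_def)
  have "solves ?D tvar (unit_at i) (\<lambda>_. weight tvar a s * unit_at i b + (1 - weight tvar a s) * unit_at i a)" for i
    by (simp add: solves_def cr rhs_def data)
  from transfer_eq[OF wf _ _ _ this] om dom
  have "transfer ?D tvar i j = arc_value (unit_at i)
      (\<lambda>_. weight tvar a s * unit_at i b + (1 - weight tvar a s) * unit_at i a) (out_arc ?D j)"
    if "i \<in> {a, b}" "j \<in> {a, b}" for i j using that by simp
  note entry = this
  have "transfer ?D tvar = (\<lambda>i j. if i = a \<and> j = a then 1 else if i = a \<and> j = b then 1 - weight tvar a s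
      else if i = b \<and> j = b then weight tvar a s else 0)"
    (is "_ = ?M")
  proof (intro ext)
    fix i j
    show "transfer ?D tvar i j = ?M i j"
    proof (cases "i \<in> {a, b} \<and> j \<in> {a, b}")
      case True
      thus ?thesis using entry[of i j] assms by (auto simp: out unit_at_def)
    next
      case False
      hence "transfer ?D tvar i j = 0" by (intro transfer_outside) (simp add: dom)
      thus ?thesis using False by auto
    qed
  qed
  thus "invariant ?D = gamma_crossing a b s"
    unfolding weight_def by (simp add: invariant_def gamma_crossing_def Let_def om dom)
qed

lemma omega_empty_diagram: "crossings D = {} \<Longrightarrow> omega D \<tau> = 1"
  by (simp add: omega_def det_on_empty)

text \<open>Both passages of the lower strand lie under the same arc with mutually inverse weights,
  so the second undoes the first, in either order.\<close>

lemma invariant_R2: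
  assumes ab: "a \<noteq> b" and pq: "p \<noteq> q"
    and m: "m = [under_pass p s, under_pass q (\<not> s)] \<or> m = [under_pass q (\<not> s), under_pass p s]"
  defines "D \<equiv> [a \<mapsto> [over_pass p s, over_pass q (\<not> s)], b \<mapsto> m]" and "E \<equiv> [a \<mapsto> [], b \<mapsto> []]"
  shows "wf_diagram D" "wf_diagram E" "invariant D = invariant E"
proof -
  show wfE: "wf_diagram E"
    unfolding E_def using ab paired_empty by (intro wf_two_strands) simp_all
  show wf: "wf_diagram D"
    unfolding D_def using ab m paired_two[OF pq, of s "\<not> s"]
    by (intro wf_two_strands) (auto simp: add_mset_commute)
  have dom: "dom D = {a, b}" "dom E = {a, b}" by (auto simp: D_def E_def)
  have crE: "crossings E = {}" by (auto simp: crossings_def E_def)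
  have cr: "crossings D = {p, q}" using ab m by (auto simp: crossings_def D_def)
  have Da: "D a = Some [over_pass p s, over_pass q (\<not> s)]" "D b = Some m" using ab by (simp_all add: D_def)
  have over: "passage D a (over_pass p s) (Inl a)" "passage D a (over_pass q (\<not> s)) (Inl a)"
    using passage_first[of D a, OF Da(1)] passage_second[of D a, OF Da(1)] by simp_all
  have under: "passage D b (under_pass p s) (if hd m = under_pass p s then Inl b else Inr q) \<and>
    passage D b (under_pass q (\<not> s)) (if hd m = under_pass p s then Inr p else Inl b)"
    using m
  proof (elim disjE)
    assume m: "m = [under_pass p s, under_pass q (\<not> s)]"
    from passage_first[of D b, OF Da(2)[unfolded m]] passage_second[of D b, OF Da(2)[unfolded m]] m
    show ?thesis by simp
  next
    assume m: "m = [under_pass q (\<not> s), under_pass p s]"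
    from passage_first[of D b, OF Da(2)[unfolded m]] passage_second[of D b, OF Da(2)[unfolded m]] m pq
    show ?thesis by simp
  qed
  note data = crossing_data_passage[OF wf over(1) under[THEN conjunct1]]
    crossing_data_passage[OF wf over(2) under[THEN conjunct2]]
  have out: "out_arc D a = Inl a" "out_arc D b = (if hd m = under_pass p s then Inr q else Inr p)"
    "out_arc E a = Inl a" "out_arc E b = Inl b"
    using m pq ab Da by (auto simp: out_arc_def E_def)
  have om: "omega D tvar = 1"
    unfolding omega_def cr
    by (cases "hd m = under_pass p s",
        subst det_on_insert, simp_all add: pq det_on_singleton sys_def rhs_def data unit_at_def,
        subst insert_commute, subst det_on_insert)
       (use pq in \<open>simp_all add: det_on_singleton sys_def rhs_def data unit_at_def\<close>)
  have inv: "weight tvar a s * weight tvar a (\<not> s) = 1"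
    using tvar_nonzero[of a] by (simp add: weight_def)
  show "invariant D = invariant E"
  proof (rule invariant_eqI[OF wf wfE])
    fix i assume "i \<in> dom D"
    let ?T = "weight tvar a s" and ?T' = "weight tvar a (\<not> s)"
    let ?y = "unit_at i :: nat \<Rightarrow> ratfun"
    \<comment> \<open>The crossing met first receives the Burau combination; at the second the
      inverse weight restores the input \<open>?y b\<close>.\<close>
    define u where "u = (\<lambda>c. if hd m = under_pass p s
       then if c = p then ?T * ?y b + (1 - ?T) * ?y a else ?y b
       else if c = q then ?T' * ?y b + (1 - ?T') * ?y a else ?y b)"
    have "solves D tvar ?y u"
      using pq by (auto simp: solves_def cr rhs_def data u_def algebra_simps inv)
    moreover have "solves E tvar ?y u" by (simp add: solves_def crE)
    moreover have "\<forall>j\<in>dom D. arc_value ?y u (out_arc D j) = arc_value ?y u (out_arc E j)"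
      using pq by (auto simp: dom out u_def)
    ultimately show "\<exists>u v. solves D tvar ?y u \<and> solves E tvar ?y v \<and>
      (\<forall>j\<in>dom D. arc_value ?y u (out_arc D j) = arc_value ?y v (out_arc E j))" by blast
  qed (simp_all add: dom om omega_empty_diagram[OF crE])
qed

text \<open>An overpass does not end an arc, so exchanging two of them alters no crossing data and
  the two systems coincide.\<close>

lemma invariant_OC:
  fixes s s' :: bool
  assumes abc: "distinct [a, b, c]" and pq: "p \<noteq> q"
  defines "D \<equiv> [a \<mapsto> [over_pass p s, over_pass q s'], b \<mapsto> [under_pass p s], c \<mapsto> [under_pass q s']]"
    and "E \<equiv> [a \<mapsto> [over_pass q s', over_pass p s], b \<mapsto> [under_pass p s], c \<mapsto> [under_pass q s']]"
  shows "wf_diagram D" "wf_diagram E" "invariant D = invariant E"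
proof -
  show wf: "wf_diagram D" and wfE: "wf_diagram E"
    unfolding D_def E_def using abc paired_two[OF pq, of s s']
    by (intro wf_three_strands; simp add: add_mset_commute)+
  have dom: "dom D = {a, b, c}" "dom E = {a, b, c}" by (auto simp: D_def E_def)
  have cr: "crossings D = {p, q}" "crossings E = {p, q}" using abc by (auto simp: crossings_def D_def E_def)
  have D: "D a = Some [over_pass p s, over_pass q s']" "D b = Some [under_pass p s]" "D c = Some [under_pass q s']"
    and E: "E a = Some [over_pass q s', over_pass p s]" "E b = Some [under_pass p s]" "E c = Some [under_pass q s']"
    using abc by (simp_all add: D_def E_def)
  have "crossing_data D p = (a, s, Inl a, Inl b)" "crossing_data D q = (a, s', Inl a, Inl c)"
    "crossing_data E p = (a, s, Inl a, Inl b)" "crossing_data E q = (a, s', Inl a, Inl c)"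
    using passage_first[of D a, OF D(1)] passage_second[of D a, OF D(1)] passage_first[of E a, OF E(1)] passage_second[of E a, OF E(1)]
      passage_single[of D b, OF D(2)] passage_single[of D c, OF D(3)] passage_single[of E b, OF E(2)] passage_single[of E c, OF E(3)]
    by (auto intro!: crossing_data_passage[OF wf] crossing_data_passage[OF wfE])
  hence rhs: "rhs D tvar x y u = rhs E tvar x y u" if "x \<in> {p, q}" for x y u
    using that by (auto simp: rhs_def)
  have out: "out_arc D x = out_arc E x" if "x \<in> {a, b, c}" for x
    using that D E by (auto simp: out_arc_def)
  have "omega D tvar = omega E tvar"
    unfolding omega_def cr by (rule det_on_cong) (simp add: sys_def rhs)
  moreover have "solves D tvar = solves E tvar"
    unfolding solves_def cr by (intro ext) (simp add: rhs)
  moreover have "\<exists>u v. solves D tvar (unit_at i) u \<and> solves E tvar (unit_at i) v \<and>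
      (\<forall>j\<in>dom D. arc_value (unit_at i) u (out_arc D j) = arc_value (unit_at i) v (out_arc E j))" for i
  proof -
    obtain u where "solves D tvar (unit_at i) u"
      using solves_exists[OF wf omega_tvar_nonzero[OF wf, of "\<lambda>x. x"]] by blast
    thus ?thesis using calculation(2) out dom by (intro exI[of _ u]) simp
  qed
  ultimately show "invariant D = invariant E"
    by (intro invariant_eqI[OF wf wfE]) (simp_all add: dom)
qed

text \<open>A strand has its passages in the listed order exactly when its orientation flag equals
  \<open>left\<close>; this is the origin of the case distinctions. The top strand consists of one
  arc, so its flag affects the signs only.\<close>

lemma r3_facts:
  fixes left m u v w :: bool
  assumes ijk: "distinct [i, j, k]" and pqr: "distinct [p, q, r]"
  defines "D \<equiv> r3_side left m u v w (i, j, k) (p, q, r)"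
  shows "wf_diagram D" "dom D = {i, j, k}" "crossings D = {p, q, r}"
    "crossing_data D p = (i, m = (u = v), Inl i, Inl j)"
    "crossing_data D q = (i, m = (u = w), Inl i, if w = left then Inl k else Inr r)"
    "crossing_data D r = (j, m = (v = w), if v = left then Inr p else Inl j, if w = left then Inr q else Inl k)"
    "out_arc D i = Inl i" "out_arc D j = Inr p" "out_arc D k = (if w = left then Inr r else Inr q)"
proof -
  let ?sp = "m = (u = v)" and ?sq = "m = (u = w)" and ?sr = "m = (v = w)"
  let ?o = "\<lambda>e l. if e = left then l else rev l"
  let ?li = "?o u [over_pass p ?sp, over_pass q ?sq]"
    and ?lj = "?o v [under_pass p ?sp, over_pass r ?sr]"
    and ?lk = "?o w [under_pass q ?sq, under_pass r ?sr]"
  have D: "D = [i \<mapsto> ?li, j \<mapsto> ?lj, k \<mapsto> ?lk]" by (simp add: D_def r3_side_def Let_def)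
  have mset_o: "mset (?o e l) = mset l" for e and l :: "pass list" by simp
  show wf: "wf_diagram D"
    unfolding D
  proof (rule wf_three_strands[OF ijk])
    show "paired (mset ?li + mset ?lj + mset ?lk)"
      unfolding mset_o using paired_three[OF pqr, of ?sp ?sq ?sr] by (simp add: add_mset_commute)
  qed
  show "dom D = {i, j, k}" by (auto simp: D)
  show "crossings D = {p, q, r}" using ijk by (auto simp: crossings_def D)
  have Di: "D i = Some ?li" "D j = Some ?lj" "D k = Some ?lk" using ijk by (simp_all add: D)
  show "out_arc D i = Inl i" "out_arc D j = Inr p" "out_arc D k = (if w = left then Inr r else Inr q)"
    unfolding out_arc_def Di by simp_all
  have i: "passage D i (over_pass p ?sp) (Inl i) \<and> passage D i (over_pass q ?sq) (Inl i)"
  proof (cases "u = left")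
    case True
    hence "D i = Some [over_pass p ?sp, over_pass q ?sq]" by (simp add: Di)
    from passage_first[of D i, OF this] passage_second[of D i, OF this] True show ?thesis by simp
  next
    case False
    hence "D i = Some [over_pass q ?sq, over_pass p ?sp]" by (simp add: Di)
    from passage_first[of D i, OF this] passage_second[of D i, OF this] False show ?thesis by simp
  qed
  have j: "passage D j (under_pass p ?sp) (Inl j) \<and> passage D j (over_pass r ?sr) (if v = left then Inr p else Inl j)"
  proof (cases "v = left")
    case True
    hence "D j = Some [under_pass p ?sp, over_pass r ?sr]" by (simp add: Di)
    from passage_first[of D j, OF this] passage_second[of D j, OF this] True show ?thesis by simp
  next
    case False
    hence "D j = Some [over_pass r ?sr, under_pass p ?sp]" by (simp add: Di)
    from passage_first[of D j, OF this] passage_second[of D j, OF this] False show ?thesis by simp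
  qed
  have k: "passage D k (under_pass q ?sq) (if w = left then Inl k else Inr r) \<and> passage D k (under_pass r ?sr) (if w = left then Inr q else Inl k)"
  proof (cases "w = left")
    case True
    hence "D k = Some [under_pass q ?sq, under_pass r ?sr]" by (simp add: Di)
    from passage_first[of D k, OF this] passage_second[of D k, OF this] True show ?thesis by simp
  next
    case False
    hence "D k = Some [under_pass r ?sr, under_pass q ?sq]" by (simp add: Di)
    from passage_first[of D k, OF this] passage_second[of D k, OF this] False show ?thesis by simp
  qed
  note i = i[THEN conjunct1] i[THEN conjunct2]
  note j = j[THEN conjunct1] j[THEN conjunct2]
  note k = k[THEN conjunct1] k[THEN conjunct2]
  show "crossing_data D p = (i, m = (u = v), Inl i, Inl j)"
    "crossing_data D q = (i, m = (u = w), Inl i, if w = left then Inl k else Inr r)"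
    "crossing_data D r = (j, m = (v = w), if v = left then Inr p else Inl j, if w = left then Inr q else Inl k)"
    by (rule crossing_data_passage[OF wf i(1) j(1)] crossing_data_passage[OF wf i(2) k(1)]
          crossing_data_passage[OF wf j(2) k(2)])+
qed

text \<open>The system is unitriangular: \<open>p\<close> depends on no other crossing, and
  \<open>q\<close> and \<open>r\<close> depend on each other in one direction only, decided by the
  order on the bottom strand.\<close>

lemma omega_r3:
  assumes ijk: "distinct [i, j, k]" and pqr: "distinct [p, q, r]"
  shows "omega (r3_side left m u v w (i, j, k) (p, q, r)) (\<tau> :: nat \<Rightarrow> 'k::field) = 1"
proof -
  define D where "D = r3_side left m u v w (i, j, k) (p, q, r)"
  note facts = r3_facts[OF assms, of left m u v w, folded D_def]
  let ?A = "sys D \<tau>"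
  have A: "?A p p = 1" "?A q q = 1" "?A r r = 1" "?A p q = 0" "?A p r = 0"
    "w = left \<Longrightarrow> ?A q r = 0" "w \<noteq> left \<Longrightarrow> ?A r q = 0"
    using pqr by (simp_all add: sys_def rhs_def facts unit_at_def)
  have "omega D \<tau> = det_on {q, r} ?A"
    unfolding omega_def facts using A pqr by (subst det_on_insert) auto
  also have "\<dots> = 1"
  proof (cases "w = left")
    case True
    thus ?thesis using A pqr by (subst det_on_insert) (auto simp: det_on_singleton)
  next
    case False
    thus ?thesis unfolding insert_commute[of q r] using A pqr
      by (subst det_on_insert) (auto simp: det_on_singleton)
  qed
  finally show ?thesis by (simp add: D_def)
qed

text \<open>The result lists the values leaving \<open>p\<close>, \<open>q\<close>,
  \<open>r\<close>. \<open>V\<close> is the value of the middle strand where it passes over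
  \<open>r\<close>; the pair \<open>Q1\<close>, \<open>R1\<close> belongs to a bottom strand meeting
  \<open>q\<close> first, the pair \<open>Q2\<close>, \<open>R2\<close> to one meeting
  \<open>r\<close> first.\<close>

definition r3_value :: "(nat \<Rightarrow> 'k::field) \<Rightarrow> bool \<Rightarrow> bool \<Rightarrow> bool \<Rightarrow> bool \<Rightarrow> bool \<Rightarrow> nat \<times> nat \<times> nat \<Rightarrow> (nat \<Rightarrow> 'k) \<Rightarrow> 'k \<times> 'k \<times> 'k" where
  "r3_value \<tau> left m u v w = (\<lambda>(i, j, k) y.
     let Tp = weight \<tau> i (m = (u = v)); Tq = weight \<tau> i (m = (u = w)); Tr = weight \<tau> j (m = (v = w));
         P = Tp * y j + (1 - Tp) * y i; V = (if v = left then P else y j);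
         Q1 = Tq * y k + (1 - Tq) * y i; R1 = Tr * Q1 + (1 - Tr) * V;
         R2 = Tr * y k + (1 - Tr) * V; Q2 = Tq * R2 + (1 - Tq) * y i
     in (P, if w = left then (Q1, R1) else (Q2, R2)))"

lemma invariant_R3:
  assumes ijk: "distinct [i, j, k]" and pqr: "distinct [p, q, r]"
  shows "invariant (r3_side True m u v w (i, j, k) (p, q, r)) = invariant (r3_side False m u v w (i, j, k) (p, q, r))"
proof -
  define D where "D left = r3_side left m u v w (i, j, k) (p, q, r)" for left
  note facts = r3_facts[OF assms, of _ m u v w, folded D_def]
  define sol where "sol left y = (case r3_value tvar left m u v w (i, j, k) y of (P, Q, R) \<Rightarrow>
    (\<lambda>c. if c = p then P else if c = q then Q else R))" for left and y :: "nat \<Rightarrow> ratfun"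
  have solves: "solves (D left) tvar y (sol left y)" for left y
    unfolding solves_def facts using pqr
    by (cases "v = left"; cases "w = left"; simp add: rhs_def facts sol_def r3_value_def Let_def)
  \<comment> \<open>The only output with a real computation, the self-distributivity of the Burau
    operation. It relies on \<open>p\<close> and \<open>q\<close> carrying the same variable, that
    of the top strand; the cases run through orientations and reflection.\<close>
  have "arc_value y (sol True y) (out_arc (D True) k) = arc_value y (sol False y) (out_arc (D False) k)" for y
    unfolding facts using pqr tvar_nonzero[of i] tvar_nonzero[of j]
    by (cases m; cases u; cases v; cases w; simp add: sol_def r3_value_def Let_def weight_def field_simps)
  moreover have "arc_value y (sol True y) (out_arc (D True) j) = arc_value y (sol False y) (out_arc (D False) j)" for y
    unfolding facts by (simp add: sol_def r3_value_def Let_def)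
  ultimately have "\<forall>x\<in>dom (D True). arc_value y (sol True y) (out_arc (D True) x) = arc_value y (sol False y) (out_arc (D False) x)" for y
    unfolding facts(2) by (simp add: facts(7))
  note outs = this
  have "invariant (D True) = invariant (D False)"
  proof (rule invariant_eqI[OF facts(1) facts(1)])
    show "omega (D True) tvar = omega (D False) tvar"
      unfolding omega_r3[OF assms, of _ m u v w, folded D_def] ..
    show "\<exists>u v. solves (D True) tvar (unit_at x) u \<and> solves (D False) tvar (unit_at x) v \<and>
      (\<forall>y\<in>dom (D True). arc_value (unit_at x) u (out_arc (D True) y) = arc_value (unit_at x) v (out_arc (D False) y))" for x
      by (intro exI[of _ "sol True (unit_at x)"] exI[of _ "sol False (unit_at x)"] conjI solves outs)
  qed (simp only: facts(2))
  thus ?thesis by (simp only: D_def)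
qed

text \<open>Well-formedness and equality of labels are part of the induction, since the congruence
  clauses need their side conditions on both diagrams.\<close>

lemma wequiv_invariant:
  "wequiv D E \<Longrightarrow> wf_diagram D \<and> wf_diagram E \<and> dom D = dom E \<and> invariant D = invariant E"
proof (induction rule: wequiv.induct)
  case (rename D f)
  thus ?case using wf_rename invariant_rename dom_rename by simp
next
  case (R2_parallel a b p q s)
  have "dom [a \<mapsto> [over_pass p s, over_pass q (\<not> s)], b \<mapsto> [under_pass p s, under_pass q (\<not> s)]] = dom [a \<mapsto> [], b \<mapsto> []]"
    by auto
  thus ?case using invariant_R2[OF R2_parallel, of "[under_pass p s, under_pass q (\<not> s)]" s] by blast
next
  case (R2_antiparallel a b p q s)
  have "dom [a \<mapsto> [over_pass p s, over_pass q (\<not> s)], b \<mapsto> [under_pass q (\<not> s), under_pass p s]] = dom [a \<mapsto> [], b \<mapsto> []]"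
    by auto
  thus ?case using invariant_R2[OF R2_antiparallel, of "[under_pass q (\<not> s), under_pass p s]" s] by blast
next
  case (R3 i j k p q r m u v w)
  thus ?case using r3_facts(1,2)[OF R3] invariant_R3[OF R3] by simp
next
  case (OC a b c p q s s')
  have "dom [a \<mapsto> [over_pass p s, over_pass q s'], b \<mapsto> [under_pass p s], c \<mapsto> [under_pass q s']]
      = dom [a \<mapsto> [over_pass q s', over_pass p s], b \<mapsto> [under_pass p s], c \<mapsto> [under_pass q s']]" by auto
  thus ?case using invariant_OC[OF OC, where s = s and s' = s'] by blast
next
  case (union D D' E E')
  thus ?case by (simp add: wf_union invariant_union)
next
  case (stitch D D' a b c)
  hence "can_stitch a b c D'" by (simp add: can_stitch_def)
  thus ?case using stitch by (simp add: wf_stitch invariant_stitch dom_stitch)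
next
  case (relabel D D' a b)
  hence "can_relabel a b D'" by (simp add: can_relabel_def)
  thus ?case using relabel by (simp add: wf_relabel invariant_relabel dom_relabel)
qed simp_all

lemma invariant_empty: "wf_diagram Map.empty" "invariant Map.empty = gamma_empty"
proof -
  show "wf_diagram Map.empty" by (simp add: wf_diagram_def crossings_def)
  have "crossings Map.empty = {}" by (simp add: crossings_def)
  thus "invariant Map.empty = gamma_empty"
    by (simp add: invariant_def gamma_empty_def omega_empty_diagram transfer_def fun_eq_iff)
qed

text \<open>This is single-valuedness of \<open>phi_graph\<close>: whichever way a diagram was
  assembled, the value depends on the diagram alone.\<close>

lemma phi_graph_invariant: "phi_graph D \<zeta> \<Longrightarrow> wf_diagram D \<and> \<zeta> = invariant D"
proof (induction rule: phi_graph.induct)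
  case (strand D \<zeta> a)
  thus ?case by (simp add: wf_add_strand invariant_add_strand)
next
  case (equiv D \<zeta> E)
  thus ?case using wequiv_invariant by metis
qed (simp_all add: invariant_empty invariant_crossing wf_union invariant_union wf_stitch invariant_stitch
      wf_relabel invariant_relabel)

subsection \<open>Every diagram is composed of crossings and trivial strands\<close>

text \<open>Cutting a strand of length at least 2 after its first passage adds a strand, yet lowers
  this sum by one. Empty strands count 1 so that their removal is progress as well.\<close>

definition complexity :: "wdiagram \<Rightarrow> nat" where
  "complexity D = (\<Sum>x\<in>dom D. if the (D x) = [] then 1 else 2 * length (the (D x)) - 1)"

lemma complexity_upd:
  assumes "finite (dom D)" "a \<notin> dom D"
  shows "complexity (D(a \<mapsto> l)) = (if l = [] then 1 else 2 * length l - 1) + complexity D"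
  using assms unfolding complexity_def by (auto intro!: sum.cong)

lemma upd_remove: "D a = Some l \<Longrightarrow> D = (D(a := None))(a \<mapsto> l)"
  by (auto simp: fun_eq_iff)

lemma complexity_remove:
  assumes "finite (dom D)" "D a = Some l"
  shows "complexity D = (if l = [] then 1 else 2 * length l - 1) + complexity (D(a := None))"
  using complexity_upd[of "D(a := None)" a l] upd_remove[of D a l] assms by simp

lemma phi_graph_exists: "wf_diagram D \<Longrightarrow> \<exists>\<zeta>. phi_graph D \<zeta>"
proof (induction "complexity D" arbitrary: D rule: less_induct)
  case less
  note wf = less.prems
  note fin = wf_finite[OF wf]
  consider (empty) x where "D x = Some []" | (long) x v w l where "D x = Some (v # w # l)"
    | (short) "\<And>x l. D x = Some l \<Longrightarrow> \<exists>v. l = [v]"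
    by (metis list.exhaust)
  thus ?case
  proof cases
    case (empty x)
    let ?D = "D(x := None)"
    have "wf_diagram ?D" using wf passes_remove[OF fin empty] by (simp add: wf_diagram_iff)
    moreover have "complexity ?D < complexity D" using complexity_remove[OF fin empty] by simp
    ultimately obtain \<zeta> where "phi_graph ?D \<zeta>" using less.hyps by blast
    from phi_graph.strand[OF this, of x] show ?thesis
      using upd_remove[of D x "[]"] empty unfolding add_strand_def by auto
  next
    case (long x v w l)
    obtain y where y: "y \<notin> dom D" using ex_new_if_finite[OF infinite_UNIV_nat fin] by blast
    let ?B = "D(x := None)" let ?D = "?B(x \<mapsto> [v], y \<mapsto> w # l)"
    have xy: "x \<noteq> y" using y long by (metis domI)
    have y0: "x \<notin> dom ?B" "y \<notin> dom (?B(x \<mapsto> [v]))" using y xy by simp_all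
    have fin': "finite (dom ?B)" "finite (dom (?B(x \<mapsto> [v])))" using fin by simp_all
    have "passes ?D = passes D" "complexity ?D < complexity D"
      using passes_remove[OF fin long] complexity_remove[OF fin long] xy y
        passes_upd[OF fin'(1) y0(1), of "[v]"] passes_upd[OF fin'(2) y0(2), of "w # l"]
        complexity_upd[OF fin'(1) y0(1), of "[v]"] complexity_upd[OF fin'(2) y0(2), of "w # l"]
      by simp_all
    hence "wf_diagram ?D" using wf by (simp add: wf_diagram_iff)
    then obtain \<zeta> where \<zeta>: "phi_graph ?D \<zeta>" using less.hyps[OF \<open>complexity ?D < complexity D\<close>] by blast
    have "can_stitch x y x ?D" using xy long by (simp add: can_stitch_def)
    from phi_graph.stitch[OF \<zeta> this] have "phi_graph (stitch x y x ?D) (gamma_stitch x y x \<zeta>)" .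
    also have "stitch x y x ?D = D" using xy long y by (auto simp: stitch_def fun_eq_iff domIff)
    finally show ?thesis by blast
  next
    \<comment> \<open>Every strand now carries a single passage, so the two strands of any crossing
      split off as a disjoint union.\<close>
    case short
    show ?thesis
    proof (cases "dom D = {}")
      case True
      thus ?thesis using phi_graph.empty by auto
    next
      case False
      then obtain x v where "D x = Some [v]" using short by blast
      hence "crossing v \<in> crossings D" using occurs_crossing[of D x "[]" v "[]"] by simp
      then obtain p where p: "p \<in> crossings D" by blast
      obtain s a m m' b n n' where "D a = Some (m @ over_pass p s # m')" "D b = Some (n @ under_pass p s # n')"
        using crossing_occurs[OF wf p] .
      hence ab: "D a = Some [over_pass p s]" "D b = Some [under_pass p s]"
        using short[of a] short[of b] by (auto simp: append_eq_Cons_conv)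
      hence ne: "a \<noteq> b" by auto
      let ?D = "D(a := None, b := None)"
      have fin': "finite (dom (D(a := None)))" using fin by simp
      have b': "(D(a := None)) b = Some [under_pass p s]" using ab ne by simp
      have passes: "passes D = {#over_pass p s, under_pass p s#} + passes ?D"
        using passes_remove[OF fin ab(1)] passes_remove[of "D(a := None)" b, OF fin' b'] by simp
      have p_notin: "p \<notin> crossings ?D"
      proof
        assume "p \<in> crossings ?D"
        then obtain v where "v \<in># passes ?D" "crossing v = p"
          using fin by (auto simp: crossings_passes)
        moreover obtain t where t: "filter_mset (\<lambda>v. crossing v = p) (passes D) = {#over_pass p t, under_pass p t#}"
          using wf p by (auto simp: wf_diagram_def)
        ultimately have "v \<in># filter_mset (\<lambda>v. crossing v = p) (passes ?D)" by simp
        moreover have "filter_mset (\<lambda>v. crossing v = p) (passes ?D) = {#}"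
          using arg_cong[OF t, of size] by (simp add: passes)
        ultimately show False by simp
      qed
      have "wf_diagram ?D"
        unfolding wf_diagram_def
      proof (intro conjI ballI)
        fix q assume q: "q \<in> crossings ?D"
        hence qp: "q \<noteq> p" using p_notin by blast
        have "q \<in> crossings D" using q fin by (auto simp: crossings_passes passes)
        then obtain t where "filter_mset (\<lambda>v. crossing v = q) (passes D) = {#over_pass q t, under_pass q t#}"
          using wf by (auto simp: wf_diagram_def)
        thus "\<exists>s. filter_mset (\<lambda>v. crossing v = q) (passes ?D) = {#over_pass q s, under_pass q s#}"
          using qp by (auto simp: passes)
      qed (use fin in simp)
      moreover have "complexity ?D < complexity D"
        using complexity_remove[OF fin ab(1)] complexity_remove[of "D(a := None)" b, OF fin' b'] by simp
      ultimately obtain \<zeta> where \<zeta>: "phi_graph ?D \<zeta>" using less.hyps by blast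
      have "crossings (crossing_diagram a b p s) = {p}"
        using ne by (simp add: crossings_def crossing_diagram_def insert_commute)
      hence "can_union ?D (crossing_diagram a b p s)"
        using p_notin by (auto simp: can_union_def crossing_diagram_def)
      from phi_graph.union[OF \<zeta> phi_graph.crossing[OF ne] this]
      have "phi_graph (?D ++ crossing_diagram a b p s) (gamma_union \<zeta> (gamma_crossing a b s))" .
      also have "?D ++ crossing_diagram a b p s = D"
        using ab ne by (auto simp: fun_eq_iff map_add_def crossing_diagram_def)
      finally show ?thesis by blast
    qed
  qed
qed

lemma phi_eq_invariant: "wf_diagram D \<Longrightarrow> phi D = invariant D"
  unfolding phi_def using phi_graph_exists phi_graph_invariant by (intro the_equality) blast+

text \<open>The two Burau coefficients at a crossing add up to 1, so the constant 1 solves the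
  system with input 1 and also appears at the output.\<close>

lemma phi_long_knot:
  assumes wf: "wf_diagram K" and dom: "dom K = {x}"
  shows "phi K = Gelem {x} (omega K tvar) (\<lambda>i j. if i = x \<and> j = x then 1 else 0)"
proof -
  have one: "arc_value (unit_at x) (\<lambda>_. 1) s = (1 :: ratfun)" if "s \<in> Inl ` dom K \<union> Inr ` crossings K" for s
    using that dom by (auto simp: unit_at_def)
  have "solves K tvar (unit_at x) (\<lambda>_. 1)"
    unfolding solves_def
  proof
    fix p assume p: "p \<in> crossings K"
    obtain o' s oa ua where "crossing_data K p = (o', s, oa, ua)" "o' \<in> dom K"
      "oa \<in> Inl ` dom K \<union> Inr ` crossings K" "ua \<in> Inl ` dom K \<union> Inr ` crossings K"
      using crossing_data_valid[OF wf p] .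
    thus "1 = rhs K tvar p (unit_at x) (\<lambda>_. 1)" by (simp add: rhs_def one)
  qed
  hence "transfer K tvar x x = 1"
    using transfer_eq[OF wf omega_tvar_nonzero[OF wf, of "\<lambda>x. x"]] one[OF out_arc_valid] dom by simp
  hence "transfer K tvar = (\<lambda>i j. if i = x \<and> j = x then 1 else 0)"
    using dom by (auto simp: fun_eq_iff transfer_outside)
  thus ?thesis by (simp add: phi_eq_invariant[OF wf] invariant_def dom)
qed

section \<open>Planar Gauss codes\<close>

locale gauss_code =
  fixes w :: "pass list"
  assumes distinct: "distinct w"
    and partner: "v \<in> set w \<Longrightarrow> Pass (crossing v) (\<not> is_over v) (is_pos v) \<in> set w"
    and sign: "v \<in> set w \<Longrightarrow> v' \<in> set w \<Longrightarrow> crossing v = crossing v' \<Longrightarrow> is_pos v = is_pos v'"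

lemma wf_gauss_code:
  assumes wf: "wf_diagram K" and K: "K x = Some w"
    and dom: "dom K = {x}"
  shows "gauss_code w"
proof
  note fin = wf_finite[OF wf]
  have pw: "passes K = mset w" using dom K by (simp add: passes_def)
  have "count (mset w) v \<le> 1" for v using wf_count[OF wf, of v] pw by simp
  thus "distinct w"
    by (simp add: distinct_count_atmost_1 le_Suc_eq count_mset_0_iff)
  show "is_pos v = is_pos v'" if "v \<in> set w" "v' \<in> set w" "crossing v = crossing v'" for v v'
    using that K split_list[OF that(1)] split_list[OF that(2)] occurs_sign[OF wf, of x _ v _ x _ v'] by metis
  show "Pass (crossing v) (\<not> is_over v) (is_pos v) \<in> set w" if v: "v \<in> set w" for v
  proof -
    obtain s where s: "filter_mset (\<lambda>u. crossing u = crossing v) (mset w)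
        = {#over_pass (crossing v) s, under_pass (crossing v) s#}"
      using wf v pw by (auto simp: wf_diagram_iff paired_def)
    have "over_pass (crossing v) s \<in> set w" "under_pass (crossing v) s \<in> set w"
      "v \<in> {over_pass (crossing v) s, under_pass (crossing v) s}"
      using arg_cong[OF s, of set_mset] v by auto
    thus ?thesis by (cases v) auto
  qed
qed

context gauss_code
begin

abbreviation "N \<equiv> length w"

lemma mate:
  assumes "k < N"
  shows "mate w k < N" "mate w k \<noteq> k" "crossing (w ! mate w k) = crossing (w ! k)"
    "is_over (w ! mate w k) \<longleftrightarrow> \<not> is_over (w ! k)" "is_pos (w ! mate w k) = is_pos (w ! k)"
    "w ! mate w k = Pass (crossing (w ! k)) (\<not> is_over (w ! k)) (is_pos (w ! k))"
proof -
  let ?v = "Pass (crossing (w ! k)) (\<not> is_over (w ! k)) (is_pos (w ! k))"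
  have "?v \<in> set w" using partner assms by simp
  then obtain l where l: "l < N" "w ! l = ?v" by (auto simp: in_set_conv_nth)
  have "mate w k = l"
    unfolding mate_def
  proof (rule the_equality)
    show "l < N \<and> l \<noteq> k \<and> crossing (w ! l) = crossing (w ! k)"
      using l by (metis pass.sel(1,2))
    fix l' assume l': "l' < N \<and> l' \<noteq> k \<and> crossing (w ! l') = crossing (w ! k)"
    hence "is_pos (w ! l') = is_pos (w ! k)" using sign assms by simp
    moreover have "w ! l' \<noteq> w ! k" using l' assms distinct by (simp add: nth_eq_iff_index_eq)
    ultimately have "w ! l' = ?v" using l' by (metis pass.expand pass.sel)
    thus "l' = l" using l l' distinct by (metis nth_eq_iff_index_eq)
  qed
  thus "mate w k < N" "mate w k \<noteq> k" "crossing (w ! mate w k) = crossing (w ! k)"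
    "is_over (w ! mate w k) \<longleftrightarrow> \<not> is_over (w ! k)" "is_pos (w ! mate w k) = is_pos (w ! k)"
    "w ! mate w k = ?v"
    using l by (simp_all, metis pass.sel(2))
qed

lemma mate_mate:
  assumes k: "k < N"
  shows "mate w (mate w k) = k"
proof -
  note l = mate(1)[OF k]
  have "w ! mate w (mate w k) = w ! k"
    unfolding mate(6)[OF l] mate(6)[OF k] by simp
  thus ?thesis using distinct mate(1)[OF l] k by (simp add: nth_eq_iff_index_eq)
qed

abbreviation "rtl \<equiv> right_to_left w"

lemma rtl_mate: "k < N \<Longrightarrow> rtl (mate w k) \<longleftrightarrow> \<not> rtl k"
  using mate[of k] by (auto simp: right_to_left_def)

definition unders :: "nat set" where
  "unders = {k. k < N \<and> \<not> is_over (w ! k)}"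

definition overs :: "nat set" where
  "overs = {k. k < N \<and> is_over (w ! k)}"

lemma finite_unders: "finite unders" "finite overs"
  by (simp_all add: unders_def overs_def)

lemma mate_bij: "bij_betw (mate w) unders overs"
  by (rule bij_betw_byWitness[where f' = "mate w"])
     (use mate mate_mate in \<open>auto simp: unders_def overs_def\<close>)

lemma crossing_bij: "bij_betw (\<lambda>k. crossing (w ! k)) unders (crossing ` set w)"
  unfolding bij_betw_def
proof
  show "inj_on (\<lambda>k. crossing (w ! k)) unders"
  proof (rule inj_onI)
    fix k l assume kl: "k \<in> unders" "l \<in> unders" "crossing (w ! k) = crossing (w ! l)"
    hence "w ! k = w ! l" using sign[of "w ! k" "w ! l"] by (auto simp: unders_def intro: pass.expand)
    thus "k = l" using kl distinct by (simp add: unders_def nth_eq_iff_index_eq)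
  qed
  show "(\<lambda>k. crossing (w ! k)) ` unders = crossing ` set w"
  proof (intro equalityI subsetI)
    fix p assume "p \<in> crossing ` set w"
    then obtain k where k: "k < N" "p = crossing (w ! k)" by (auto simp: in_set_conv_nth)
    thus "p \<in> (\<lambda>k. crossing (w ! k)) ` unders"
      using mate[OF k(1)] by (cases "is_over (w ! k)") (auto simp: unders_def image_iff)
  qed (auto simp: unders_def)
qed

lemma length_eq: "N = 2 * card unders"
proof -
  have "{..<N} = unders \<union> overs" "unders \<inter> overs = {}" by (auto simp: unders_def overs_def)
  hence "N = card unders + card overs" using finite_unders by (metis card_Un_disjoint card_lessThan)
  thus ?thesis using bij_betw_same_card[OF mate_bij] by simp
qed

subsection \<open>Faces\<close>

definition darts :: "(nat \<times> bool) set" where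
  "darts = {0..N} \<times> UNIV"

text \<open>The inverse of \<open>next_dart\<close> on darts, obtained by undoing each turn. It
  makes \<open>next_dart\<close> a permutation of a finite set, so that its orbits partition the
  darts.\<close>

fun previous_dart :: "nat \<times> bool \<Rightarrow> nat \<times> bool" where
  "previous_dart (e, True) = (if e = 0 then (N, True)
     else if rtl (e - 1) then (Suc (mate w (e - 1)), False) else (mate w (e - 1), True))"
| "previous_dart (e, False) = (if e = N then (0, False)
     else if rtl e then (mate w e, True) else (Suc (mate w e), False))"

lemma next_dart_darts:
  assumes d: "d \<in> darts"
  shows "next_dart w d \<in> darts"
proof -
  obtain e b where e: "d = (e, b)" "e \<le> N" using d by (auto simp: darts_def)
  show ?thesis
  proof (cases b)
    case True
    show ?thesis
    proof (cases "e = N")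
      case False
      hence "e < N" using e(2) by simp
      thus ?thesis using True e(1) mate(1)[of e] by (auto simp: darts_def)
    qed (simp add: e(1) True darts_def)
  next
    case False
    show ?thesis
    proof (cases e)
      case (Suc k)
      hence "k < N" using e(2) by simp
      thus ?thesis using Suc False e(1) mate(1)[of k] by (auto simp: darts_def)
    qed (simp add: e(1) False darts_def)
  qed
qed

lemma previous_next:
  assumes d: "d \<in> darts"
  shows "previous_dart (next_dart w d) = d"
proof -
  obtain e b where e: "d = (e, b)" "e \<le> N" using d by (auto simp: darts_def)
  show ?thesis
  proof (cases b)
    case True
    show ?thesis
    proof (cases "e = N")
      case False
      hence "e < N" using e(2) by simp
      thus ?thesis using True e(1) mate(1)[of e] mate_mate[of e] rtl_mate[of e] by (auto simp: darts_def)
    qed (simp add: e(1) True darts_def)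
  next
    case False
    show ?thesis
    proof (cases e)
      case (Suc k)
      hence "k < N" using e(2) by simp
      thus ?thesis using Suc False e(1) mate(1)[of k] mate_mate[of k] rtl_mate[of k] by (auto simp: darts_def)
    qed (simp add: e(1) False darts_def)
  qed
qed

definition face :: "nat \<times> bool \<Rightarrow> (nat \<times> bool) set" where
  "face d = orbit (next_dart w) d"

lemma faces_eq: "faces w = face ` darts"
  by (simp add: faces_def face_def darts_def)

lemma face_next: "d \<in> darts \<Longrightarrow> face (next_dart w d) = face d"
proof -
  assume d: "d \<in> darts"
  \<comment> \<open>\<open>orbit\<close> starts with the first iterate, so \<open>d\<close> lies in
    its own orbit only by periodicity. To use permutations, the map is extended by the identity
    outside the darts.\<close>
  define g where "g x = (if x \<in> darts then next_dart w x else x)" for x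
  have fin: "finite darts" by (simp add: darts_def)
  have "inj_on (next_dart w) darts" using previous_next by (rule inj_on_inverseI)
  moreover have "next_dart w ` darts \<subseteq> darts" using next_dart_darts by blast
  ultimately have "bij_betw (next_dart w) darts darts"
    using endo_inj_surj[OF fin, of "next_dart w"] by (simp add: bij_betw_def)
  hence "bij_betw g darts darts" by (subst bij_betw_cong[of _ _ "next_dart w"]) (simp_all add: g_def)
  hence "g permutes darts" by (rule bij_imp_permutes) (simp add: g_def)
  hence "d \<in> orbit g d" using fin by (intro permutation_self_in_orbit) (auto simp: permutation_permutes)
  also have "orbit g d = orbit (next_dart w) d"
    using d next_dart_darts by (intro orbit_cong0[of _ darts]) (auto simp: g_def)
  finally show ?thesis unfolding face_def by (rule self_in_orbit_step)
qed

text \<open>One equation for each of the four sectors at the crossing: a left turn stays on the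
  boundary of the same face.\<close>

lemma corners:
  assumes k: "k < N" "rtl k"
  defines "m \<equiv> mate w k"
  shows "face (k, True) = face (Suc m, True)" "face (Suc k, False) = face (m, False)"
    "face (m, True) = face (k, False)" "face (Suc m, False) = face (Suc k, True)"
proof -
  note m = mate(1)[OF k(1)] mate_mate[OF k(1)] rtl_mate[OF k(1)]
  have D: "(e, b) \<in> darts \<longleftrightarrow> e \<le> N" for e b by (simp add: darts_def)
  show "face (k, True) = face (Suc m, True)" "face (Suc k, False) = face (m, False)"
    "face (m, True) = face (k, False)" "face (Suc m, False) = face (Suc k, True)"
    using face_next[of "(k, True)"] face_next[of "(Suc k, False)"] face_next[of "(m, True)"]
      face_next[of "(Suc m, False)"] k m by (simp_all add: D m_def)
qed

text \<open>The forward dart has its face on the left of the edge, the backward dart on the right.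
  Thus this is the coboundary of \<open>G\<close> across edge \<open>e\<close>.\<close>

definition jump :: "((nat \<times> bool) set \<Rightarrow> int) \<Rightarrow> nat \<Rightarrow> int" where
  "jump G e = G (face (e, True)) - G (face (e, False))"

text \<open>Going once around a crossing returns to the starting face, so the four jumps cancel:
  what one strand gains the other loses.\<close>

lemma jump_balance:
  assumes "k < N"
  shows "jump G (Suc (mate w k)) - jump G (mate w k) = - (jump G (Suc k) - jump G k)"
proof (cases "rtl k")
  case True
  from corners[OF assms True] show ?thesis by (simp add: jump_def)
next
  case False
  hence "rtl (mate w k)" using rtl_mate[OF assms] by simp
  from corners[OF mate(1)[OF assms] this] show ?thesis by (simp add: jump_def mate_mate[OF assms])
qed

text \<open>By \<open>jump_balance\<close> the increment at an underpass is the negative of that at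
  its overpass. Hence the overpasses alone control all jumps, and boundary data need one entry per
  crossing.\<close>

lemma jump_constant:
  assumes "\<And>k. k \<in> overs \<Longrightarrow> M dvd jump G (Suc k) - jump G k" and "e \<le> N"
  shows "M dvd jump G e - jump G 0"
  using \<open>e \<le> N\<close>
proof (induction e)
  case (Suc k)
  hence k: "k < N" by simp
  have "M dvd jump G (Suc k) - jump G k"
  proof (cases "is_over (w ! k)")
    case True
    thus ?thesis using assms(1)[of k] k by (simp add: overs_def)
  next
    case False
    hence "mate w k \<in> overs" using mate[OF k] by (simp add: overs_def)
    from assms(1)[OF this] show ?thesis unfolding jump_balance[OF k] by (simp only: dvd_minus_iff)
  qed
  from dvd_add[OF this Suc.IH] k show ?case by simp
qed simp

text \<open>The left faces of consecutive edges are separated by a single edge of the other strand,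
  and every face borders some edge of the knot.\<close>

lemma face_constant:
  assumes jump: "\<And>e. e \<le> N \<Longrightarrow> M dvd jump G e" and e: "e \<le> N"
  shows "M dvd G (face (e, b)) - G (face (0, True))"
proof -
  have step: "M dvd G (face (Suc k, True)) - G (face (k, True))" if k: "k < N" for k
  proof (cases "rtl k")
    case True
    have "M dvd jump G (Suc (mate w k))" using mate(1)[OF k] by (intro jump) simp
    thus ?thesis using corners[OF k True] dvd_minus_iff[of M "jump G (Suc (mate w k))"] by (simp add: jump_def)
  next
    case False
    hence "rtl (mate w k)" using rtl_mate[OF k] by simp
    from corners[OF mate(1)[OF k] this] have "face (Suc k, True) = face (mate w k, True)" "face (mate w k, False) = face (k, True)"
      by (simp_all add: mate_mate[OF k])
    moreover have "M dvd jump G (mate w k)" using mate(1)[OF k] by (intro jump) simp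
    ultimately show ?thesis by (simp add: jump_def)
  qed
  have T: "M dvd G (face (e, True)) - G (face (0, True))" using e
  proof (induction e)
    case (Suc k)
    thus ?case using dvd_add[OF step[of k] Suc.IH] by simp
  qed simp
  show ?thesis
  proof (cases b)
    case False
    have "G (face (e, False)) - G (face (0, True)) = (G (face (e, True)) - G (face (0, True))) - jump G e"
      by (simp add: jump_def)
    thus ?thesis using dvd_diff[OF T jump[OF e]] False by (simp only:)
  qed (simp add: T)
qed

end

subsection \<open>Alexander numberings\<close>

locale planar_gauss_code = gauss_code +
  assumes planar: "planar_code w"
begin

text \<open>With infinity as an extra vertex, n crossings give n + 1 vertices and 2n + 1 edges;
  Euler characteristic 2 leaves n + 2 faces.\<close>

lemma card_faces: "card (faces w) = card unders + 2"
  using planar bij_betw_same_card[OF crossing_bij] length_eq by (simp add: planar_code_def Let_def)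

text \<open>
  Functions on the faces modulo \<open>M\<close> are as many as their possible boundary data, and are determined by
  them; hence every boundary datum occurs.  This replaces \<open>H\<^sub>1(S\<^sup>2) = 0\<close>.
\<close>

lemma unit_jump_exists:
  assumes M: "M > (1::int)"
  obtains G where "\<And>e. e \<le> N \<Longrightarrow> M dvd jump G e - 1"
proof -
  let ?Z = "{0..<M}"
  let ?F = "faces w \<rightarrow>\<^sub>E ?Z" and ?B = "overs \<rightarrow>\<^sub>E ?Z"
  \<comment> \<open>One value, one jump and n increments: \<open>M\<close> to the power n + 2
    possibilities, exactly as many as functions on n + 2 faces.\<close>
  define data where "data G = (G (face (0, True)), jump G 0 mod M,
    restrict (\<lambda>k. (jump G (Suc k) - jump G k) mod M) overs)" for G
  have finF: "finite (faces w)" by (simp add: faces_eq darts_def)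
  have inj: "inj_on data ?F"
  proof (rule inj_onI)
    fix G G' assume G: "G \<in> ?F" "G' \<in> ?F" and eq: "data G = data G'"
    define H where "H f = G f - G' f" for f
    have jH: "jump H e = jump G e - jump G' e" for e by (simp add: jump_def H_def)
    have "M dvd jump H (Suc k) - jump H k" if "k \<in> overs" for k
    proof -
      have "(jump G (Suc k) - jump G k) mod M = (jump G' (Suc k) - jump G' k) mod M"
        using eq that unfolding data_def by (auto dest: fun_cong[of _ _ k])
      hence "M dvd (jump G (Suc k) - jump G k) - (jump G' (Suc k) - jump G' k)" by (simp add: mod_eq_dvd_iff)
      thus ?thesis by (simp add: jH algebra_simps)
    qed
    note jump_constant[OF this]
    moreover have "M dvd jump H 0" using eq by (simp add: data_def jH mod_eq_dvd_iff)
    ultimately have "M dvd jump H e" if "e \<le> N" for e using that by (metis diff_add_cancel dvd_add)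
    note const = face_constant[OF this]
    have div: "M dvd G f - G' f" if "f \<in> faces w" for f
    proof -
      obtain e b where "f = face (e, b)" "e \<le> N" using \<open>f \<in> faces w\<close> by (auto simp: faces_eq darts_def)
      moreover have "H (face (0, True)) = 0" using eq by (simp add: data_def H_def)
      ultimately show ?thesis using const[of e b] by (simp add: H_def)
    qed
    show "G = G'"
    proof (rule PiE_ext[OF G])
      fix f assume f: "f \<in> faces w"
      hence "G f \<in> ?Z" "G' f \<in> ?Z" using G by auto
      moreover have "G f mod M = G' f mod M" using div[OF f] by (simp only: mod_eq_dvd_iff)
      ultimately show "G f = G' f" by simp
    qed
  qed
  have sub: "data ` ?F \<subseteq> ?Z \<times> ?Z \<times> ?B"
  proof
    fix z assume "z \<in> data ` ?F"
    then obtain G where G: "G \<in> ?F" "z = data G" by blast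
    have "face (0, True) \<in> faces w" by (auto simp: faces_eq darts_def)
    hence "G (face (0, True)) \<in> ?Z" using G by auto
    thus "z \<in> ?Z \<times> ?Z \<times> ?B" using M by (auto simp: G data_def)
  qed
  have "card ?F = nat M ^ (card unders + 2)" using finF by (simp add: card_PiE card_faces)
  moreover have "card ?B = nat M ^ card unders"
    using finite_unders bij_betw_same_card[OF mate_bij] by (simp add: card_PiE)
  ultimately have "card ?F = card (?Z \<times> ?Z \<times> ?B)"
    by (simp add: card_cartesian_product power_add power2_eq_square)
  hence card: "card (data ` ?F) = card (?Z \<times> ?Z \<times> ?B)" using card_image[OF inj] by (simp only:)
  have "finite (?Z \<times> ?Z \<times> ?B)" using finite_unders by (intro finite_cartesian_product finite_PiE) auto
  \<comment> \<open>The datum to be realised: jump 1 at the initial edge and no change at any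
    crossing.\<close>
  from card_subset_eq[OF this sub card] have "(0, 1, restrict (\<lambda>_. 0) overs) \<in> data ` ?F" using M by auto
  then obtain G where G: "(0, 1, restrict (\<lambda>_. 0) overs) = data G" by (rule imageE)
  have "M dvd jump G (Suc k) - jump G k" if "k \<in> overs" for k
  proof -
    have "(jump G (Suc k) - jump G k) mod M = 0"
      using G that unfolding data_def by (auto dest: fun_cong[of _ _ k])
    thus ?thesis by (simp add: dvd_eq_mod_eq_0)
  qed
  note jump_constant[OF this]
  moreover have "M dvd jump G 0 - 1" using G M by (simp add: data_def mod_eq_dvd_iff[symmetric])
  ultimately have "M dvd jump G e - 1" if "e \<le> N" for e
    using that by (metis (no_types, lifting) add_diff_eq diff_add_cancel dvd_add)
  thus thesis by (rule that)
qed

text \<open>The integral candidate for the number of the region to the right of edge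
  \<open>e\<close>, relative to the right of edge 0: each strand crossed shifts it by one, with sign
  given by its direction.\<close>

definition winding :: "nat \<Rightarrow> int" where
  "winding e = (\<Sum>i<e. if rtl i then - 1 else 1)"

lemma winding_Suc: "winding (Suc k) = winding k + (if rtl k then - 1 else 1)"
  by (simp add: winding_def)

lemma winding_bound: "\<bar>winding e\<bar> \<le> int e"
  by (induction e) (auto simp: winding_Suc winding_def[of 0])

text \<open>By \<open>corners\<close> the two edges have the same face on their left. Where all
  jumps are 1 modulo \<open>M\<close>, their right faces also agree modulo \<open>M\<close>, and
  \<open>winding\<close> computes these values up to a common constant.\<close>

lemma winding_rtl:
  assumes k: "k < N" "rtl k"
  shows "winding k = winding (Suc (mate w k))"
proof -
  \<comment> \<open>Both windings are at most \<open>N\<close> in absolute value, so their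
    difference is smaller than this modulus and a congruence is an equality.\<close>
  define M where "M = 2 * int N + 2"
  obtain G where G: "\<And>e. e \<le> N \<Longrightarrow> M dvd jump G e - 1"
    using unit_jump_exists[of M] by (auto simp: M_def)
  define r where "r e = G (face (e, False))" for e
  have dvd: "M dvd G (face (e, True)) - r e - 1" if "e \<le> N" for e
    using G[OF that] by (simp add: jump_def r_def)
  have local: "M dvd r k - r (Suc (mate w k))" "M dvd r (Suc k) - r k + 1" "M dvd r (Suc (mate w k)) - r (mate w k) - 1"
    if k: "k < N" "rtl k" for k
  proof -
    note c = corners[OF k, folded r_def]
    have m: "mate w k < N" using mate(1)[OF k(1)] .
    have 1: "M dvd G (face (Suc (mate w k), True)) - r k - 1" using dvd[of k] k c(1) by simp
    have 2: "M dvd G (face (Suc (mate w k), True)) - r (Suc (mate w k)) - 1" using dvd[of "Suc (mate w k)"] m by simp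
    have 3: "M dvd r k - r (mate w k) - 1" using dvd[of "mate w k"] m c(3) by (simp add: r_def)
    have 4: "r (Suc k) = r (mate w k)" using c(2) by (simp add: r_def)
    show A: "M dvd r k - r (Suc (mate w k))" using dvd_diff[OF 2 1] by (simp add: algebra_simps)
    show "M dvd r (Suc k) - r k + 1" using 3 4 by (metis (no_types, lifting) dvd_minus_iff minus_diff_eq diff_diff_eq2 add.commute diff_add_eq)
    show "M dvd r (Suc (mate w k)) - r (mate w k) - 1" using dvd_diff[OF 3 A] by (simp add: algebra_simps)
  qed
  have wind: "M dvd r e - r 0 - winding e" if "e \<le> N" for e using that
  proof (induction e)
    case (Suc e)
    hence e: "e < N" by simp
    have "M dvd r (Suc e) - r e - (if rtl e then - 1 else 1)"
    proof (cases "rtl e")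
      case True
      thus ?thesis using local(2)[OF e] by simp
    next
      case False
      hence "rtl (mate w e)" using rtl_mate[OF e] by simp
      thus ?thesis using local(3)[OF mate(1)[OF e]] False by (simp add: mate_mate[OF e])
    qed
    from dvd_add[OF this Suc.IH] show ?case using e by (simp add: winding_Suc algebra_simps)
  qed (simp add: winding_def)
  have m: "mate w k < N" using mate(1)[OF k(1)] .
  have "M dvd (r (Suc (mate w k)) - r 0 - winding (Suc (mate w k))) - (r k - r 0 - winding k) + (r k - r (Suc (mate w k)))"
    by (rule dvd_add[OF dvd_diff[OF wind wind] local(1)[OF k]]) (use k m in simp_all)
  hence "M dvd winding k - winding (Suc (mate w k))" by (simp add: algebra_simps)
  moreover have "\<bar>winding k - winding (Suc (mate w k))\<bar> < M"
    using winding_bound[of k] winding_bound[of "Suc (mate w k)"] k m by (simp add: M_def)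
  ultimately show ?thesis using dvd_imp_le_int[of "winding k - winding (Suc (mate w k))" M]
    by (cases "winding k = winding (Suc (mate w k))") (auto simp: M_def)
qed

text \<open>The upper passage of a positive crossing sees the other strand from right to left, the
  lower passage of a negative one does; \<open>winding_rtl\<close> at that passage leads to the same
  equations for both signs. They let one power of t serve as weight of the whole crossing.\<close>

lemma winding_under:
  assumes l: "l \<in> unders"
  shows "winding (mate w l) = winding (Suc l)"
    "winding (Suc l) = winding l + (if is_pos (w ! l) then 1 else - 1)"
    "winding (Suc (mate w l)) = winding l"
proof -
  have l': "l < N" "\<not> is_over (w ! l)" using l by (simp_all add: unders_def)
  note m = mate[OF l'(1)] mate_mate[OF l'(1)] rtl_mate[OF l'(1)]
  have r: "rtl l \<longleftrightarrow> \<not> is_pos (w ! l)" using l' by (simp add: right_to_left_def)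
  show 1: "winding (Suc l) = winding l + (if is_pos (w ! l) then 1 else - 1)"
    by (simp add: winding_Suc r)
  have "winding (mate w l) = winding (Suc l) \<and> winding (Suc (mate w l)) = winding l"
  proof (cases "rtl l")
    case True
    thus ?thesis using winding_rtl[OF l'(1) True] m by (simp add: winding_Suc)
  next
    case False
    hence "rtl (mate w l)" using m by simp
    from winding_rtl[OF m(1) this] show ?thesis using m False by (simp add: winding_Suc)
  qed
  thus "winding (mate w l) = winding (Suc l)" "winding (Suc (mate w l)) = winding l" by simp_all
qed

end

section \<open>Laurent polynomials\<close>

lemma tpow_0: "tpow 0 = 1"
  by (simp add: tpow_def)

lemma tpow_add: "tpow (a + b) = tpow a * tpow b"
  by (simp add: tpow_def mult_single)

lemma tpow_neg: "tpow (- a) * tpow a = 1" "tpow a * tpow (- a) = 1"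
  by (simp_all add: tpow_0 flip: tpow_add)

text \<open>If an exponent of the product arises in one way only, its coefficient is a single
  product and cannot cancel.\<close>

lemma lookup_mult_unique:
  fixes u v :: "'a::comm_monoid_add \<Rightarrow>\<^sub>0 'b::comm_semiring_1"
  assumes "\<And>a b. a \<in> Poly_Mapping.keys u \<Longrightarrow> b \<in> Poly_Mapping.keys v \<Longrightarrow> a + b = M + M' \<Longrightarrow> a = M \<and> b = M'"
  shows "Poly_Mapping.lookup (u * v) (M + M') = Poly_Mapping.lookup u M * Poly_Mapping.lookup v M'"
proof -
  have "u * v = (\<Sum>a\<in>Poly_Mapping.keys u. \<Sum>b\<in>Poly_Mapping.keys v.
      Poly_Mapping.single (a + b) (Poly_Mapping.lookup u a * Poly_Mapping.lookup v b))"
    by (subst (1) sum_monomials[of u], subst (1) sum_monomials[of v]) (simp add: sum_product mult_single)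
  hence "Poly_Mapping.lookup (u * v) (M + M') = (\<Sum>a\<in>Poly_Mapping.keys u. \<Sum>b\<in>Poly_Mapping.keys v.
      if a + b = M + M' then Poly_Mapping.lookup u a * Poly_Mapping.lookup v b else 0)"
    by (simp add: lookup_sum lookup_single when_def)
  also have "\<dots> = (\<Sum>a\<in>Poly_Mapping.keys u. \<Sum>b\<in>Poly_Mapping.keys v.
      if b = M' then (if a = M then Poly_Mapping.lookup u a * Poly_Mapping.lookup v b else 0) else 0)"
    using assms by (intro sum.cong) auto
  also have "\<dots> = (\<Sum>a\<in>Poly_Mapping.keys u. if a = M then Poly_Mapping.lookup u a * Poly_Mapping.lookup v M' else 0)"
    by (intro sum.cong) (auto simp: in_keys_iff)
  also have "\<dots> = Poly_Mapping.lookup u M * Poly_Mapping.lookup v M'"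
    by (auto simp: in_keys_iff)
  finally show ?thesis .
qed

text \<open>The sums of the two largest and of the two smallest exponents arise in one way only, so
  their coefficients in the product 1 are nonzero and both sums are 0. This forces a single exponent
  in each factor, and the coefficients are units of the integers.\<close>

lemma laurent_unit:
  fixes u v :: laurent
  assumes uv: "u * v = 1"
  obtains z where "u = tpow z \<or> u = - tpow z"
proof -
  have "u \<noteq> 0" "v \<noteq> 0" using uv by auto
  hence ne: "Poly_Mapping.keys u \<noteq> {}" "Poly_Mapping.keys v \<noteq> {}" by auto
  let ?U = "Poly_Mapping.keys u" and ?V = "Poly_Mapping.keys v"
  have key: "a + b = 0" if "a \<in> ?U" "b \<in> ?V"
    "\<And>a' b'. a' \<in> ?U \<Longrightarrow> b' \<in> ?V \<Longrightarrow> a' + b' = a + b \<Longrightarrow> a' = a \<and> b' = b" for a b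
  proof (rule ccontr)
    assume "a + b \<noteq> 0"
    hence "Poly_Mapping.lookup (u * v) (a + b) = 0" by (simp add: uv lookup_one)
    moreover have "Poly_Mapping.lookup (u * v) (a + b) = Poly_Mapping.lookup u a * Poly_Mapping.lookup v b"
      by (rule lookup_mult_unique) (rule that(3))
    ultimately show False using that(1,2) by (simp add: in_keys_iff)
  qed
  have "Max ?U + Max ?V = 0"
  proof (rule key)
    fix a' b' assume "a' \<in> ?U" "b' \<in> ?V" "a' + b' = Max ?U + Max ?V"
    moreover from this have "a' \<le> Max ?U" "b' \<le> Max ?V" by simp_all
    ultimately show "a' = Max ?U \<and> b' = Max ?V" by linarith
  qed (use ne in \<open>auto intro: Max_in Min_in\<close>)
  moreover have "Min ?U + Min ?V = 0"
  proof (rule key)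
    fix a' b' assume "a' \<in> ?U" "b' \<in> ?V" "a' + b' = Min ?U + Min ?V"
    moreover from this have "Min ?U \<le> a'" "Min ?V \<le> b'" by simp_all
    ultimately show "a' = Min ?U \<and> b' = Min ?V" by linarith
  qed (use ne in \<open>auto intro: Max_in Min_in\<close>)
  moreover have "Min ?U \<le> Max ?U" "Min ?V \<le> Max ?V" using ne by simp_all
  ultimately have eq: "Min ?U = Max ?U" "Min ?V = Max ?V" "Max ?V = - Max ?U" by linarith+
  define z where "z = Max ?U"
  have single: "Poly_Mapping.keys p = {Max (Poly_Mapping.keys p)}"
    if "Min (Poly_Mapping.keys p) = Max (Poly_Mapping.keys p)" "Poly_Mapping.keys p \<noteq> {}" for p :: laurent
  proof
    show "Poly_Mapping.keys p \<subseteq> {Max (Poly_Mapping.keys p)}"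
    proof
      fix a assume "a \<in> Poly_Mapping.keys p"
      hence "Min (Poly_Mapping.keys p) \<le> a" "a \<le> Max (Poly_Mapping.keys p)" by simp_all
      thus "a \<in> {Max (Poly_Mapping.keys p)}" using that(1) by simp
    qed
  qed (use that in simp)
  let ?c = "Poly_Mapping.lookup u z" and ?d = "Poly_Mapping.lookup v (- z)"
  have U: "?U = {z}" and V: "?V = {- z}"
    using single[OF eq(1) ne(1)] single[OF eq(2) ne(2)] unfolding eq(3) z_def by (simp_all only:)
  have "Poly_Mapping.lookup (u * v) (z + - z) = ?c * ?d"
    by (rule lookup_mult_unique) (simp add: U V)
  hence "?c * ?d = 1" by (simp add: uv lookup_one)
  hence c: "?c = 1 \<or> ?c = - 1" by (auto simp: zmult_eq_1_iff)
  have "u = Poly_Mapping.single z ?c"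
    using U by (intro poly_mapping_eqI) (auto simp: lookup_single when_def in_keys_iff)
  thus thesis using c that[of z] by (metis tpow_def single_uminus)
qed

lemma laurent_at_hom:
  assumes "t \<noteq> 0"
  shows "comm_ring_hom (laurent_at t)"
proof -
  interpret poly_lift_hom "of_int :: int \<Rightarrow> ratfun" "\<lambda>k. t powi k"
    by unfold_locales (use assms in \<open>simp_all add: power_int_add\<close>)
  have "laurent_at t = poly_lift of_int (\<lambda>k. t powi k)"
    by (simp add: fun_eq_iff laurent_at_def poly_lift_def)
  thus ?thesis using comm_ring_hom_lift by simp
qed

lemma laurent_at_tpow: "laurent_at t (tpow k) = t powi k"
  by (simp add: laurent_at_def tpow_def)

section \<open>Minors\<close>

text \<open>Replace row \<open>k\<close> by the difference of the unit rows \<open>j\<close> and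
  \<open>j'\<close>. All row sums still vanish, so the determinant is 0; expansion along row
  \<open>k\<close> gives the difference of the two cofactors.\<close>

lemma cofactor_row_const:
  fixes B :: "'a::idom mat"
  assumes B: "B \<in> carrier_mat n n" and sum: "\<And>i. i < n \<Longrightarrow> (\<Sum>j<n. B $$ (i, j)) = 0"
    and k: "k < n" "j < n" "j' < n"
  shows "cofactor B k j = cofactor B k j'"
proof (cases "j = j'")
  case False
  define B' where "B' = mat n n (\<lambda>(i, l). if i = k then (if l = j then 1 else if l = j' then - 1 else 0) else B $$ (i, l))"
  have B': "B' \<in> carrier_mat n n" by (simp add: B'_def)
  have del: "mat_delete B' k l = mat_delete B k l" for l
    using B by (intro eq_matI) (auto simp: mat_delete_def B'_def)
  have "B' *\<^sub>v vec n (\<lambda>_. 1) = 0\<^sub>v n"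
  proof (rule eq_vecI)
    fix i assume i: "i < dim_vec (0\<^sub>v n)"
    have "(\<Sum>l<n. if l = j then 1 else if l = j' then - 1 else 0) = (\<Sum>l<n. (if l = j then 1 else 0) + (if l = j' then - 1 else (0::'a)))"
      using False by (intro sum.cong) auto
    also have "\<dots> = 0" using k by (simp add: sum.distrib)
    finally show "(B' *\<^sub>v vec n (\<lambda>_. 1)) $ i = 0\<^sub>v n $ i"
      using i sum[of i] by (cases "i = k") (simp_all add: B'_def scalar_prod_def atLeast0LessThan)
  qed (simp add: B'_def)
  moreover have "vec n (\<lambda>_. 1) \<noteq> (0\<^sub>v n :: 'a vec)" using k by (metis index_vec index_zero_vec(1) zero_neq_one)
  ultimately have "det B' = 0"
    unfolding det_0_iff_vec_prod_zero[OF B'] by (intro exI[of _ "vec n (\<lambda>_. 1)"]) simp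
  moreover have "det B' = (\<Sum>l<n. B' $$ (k, l) * cofactor B' k l)"
    using laplace_expansion_row[OF B' k(1)] .
  moreover have "\<dots> = (\<Sum>l<n. (if l = j then cofactor B k l else 0) - (if l = j' then cofactor B k l else 0))"
    using False k by (intro sum.cong) (auto simp: B'_def cofactor_def del[unfolded B'_def])
  moreover have "\<dots> = cofactor B k j - cofactor B k j'"
    using k by (simp add: sum_subtractf)
  ultimately show ?thesis by simp
qed simp

lemma pick_delete:
  assumes k: "k < n" and i: "i < n - 1"
  shows "pick ({..<n} - {k}) i = insert_index k i"
proof -
  let ?I = "{..<n} - {k}" and ?j = "insert_index k i"
  have j: "?j \<in> ?I" using k i by (auto simp: insert_index_def)
  have "{a \<in> ?I. a < ?j} = (if i < k then {..<i} else {..<Suc i} - {k})"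
    using k i by (auto simp: insert_index_def)
  hence "card {a \<in> ?I. a < ?j} = i" by simp
  thus ?thesis using pick_card_in_set[OF j] by simp
qed

text \<open>Links minors given by index sets with Laplace expansion: \<open>insert_index\<close>
  enumerates the complement of one index in increasing order.\<close>

lemma submatrix_delete:
  assumes A: "A \<in> carrier_mat n n" and k: "k < n" "l < n"
  shows "submatrix A ({..<n} - {k}) ({..<n} - {l}) = mat_delete A k l"
proof -
  have card: "card {i. i < n \<and> i \<in> {..<n} - {m}} = n - 1" if "m < n" for m
  proof -
    have "{i. i < n \<and> i \<in> {..<n} - {m}} = {..<n} - {m}" by auto
    thus ?thesis using that by simp
  qed
  show ?thesis
  proof (rule eq_matI)
    show "dim_row (submatrix A ({..<n} - {k}) ({..<n} - {l})) = dim_row (mat_delete A k l)"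
      "dim_col (submatrix A ({..<n} - {k}) ({..<n} - {l})) = dim_col (mat_delete A k l)"
      using A k card by (simp_all add: dim_submatrix del: Diff_iff)
    fix i j assume ij: "i < dim_row (mat_delete A k l)" "j < dim_col (mat_delete A k l)"
    hence ij': "i < n - 1" "j < n - 1" using A by simp_all
    have "submatrix A ({..<n} - {k}) ({..<n} - {l}) $$ (i, j) = A $$ (insert_index k i, insert_index l j)"
      using ij' A k card by (subst submatrix_index) (simp_all add: pick_delete del: Diff_iff)
    also have "\<dots> = mat_delete A k l $$ (i, j)"
      using ij ij' A by (simp add: mat_delete_def insert_index_def)
    finally show "submatrix A ({..<n} - {k}) ({..<n} - {l}) $$ (i, j) = mat_delete A k l $$ (i, j)" .
  qed
qed

lemma subset_card_pred:
  assumes "I \<subseteq> {..<n}" "card I = n - 1" "n > 0"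
  obtains k where "k < n" "I = {..<n} - {k}"
proof -
  have "card ({..<n} - I) = 1" using assms by (simp add: card_Diff_subset finite_subset)
  then obtain k where "{..<n} - I = {k}" by (auto simp: card_1_singleton_iff)
  hence "k < n" "I = {..<n} - {k}" using assms(1) by auto
  thus thesis by (rule that)
qed

text \<open>Multiply the row relation on the right by the adjugate and read off entry
  \<open>k\<close>; no division by the determinant is involved.\<close>

lemma left_eigen_cofactor:
  fixes W :: "'a::comm_ring_1 mat"
  assumes W: "W \<in> carrier_mat n n" and k: "k < n" and c: "c < n"
    and rel: "\<And>j. j < n \<Longrightarrow> (\<Sum>i<n. \<phi> i * W $$ (i, j)) = (if j = c then z else 0)"
  shows "\<phi> k * det W = z * cofactor W k c"
proof -
  have adj: "(\<Sum>j<n. W $$ (i, j) * cofactor W k j) = (if i = k then det W else 0)" if "i < n" for i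
  proof -
    have "(W * adj_mat W) $$ (i, k) = (\<Sum>j<n. W $$ (i, j) * cofactor W k j)"
      using W that k by (simp add: scalar_prod_def adj_mat_def atLeast0LessThan)
    thus ?thesis unfolding adj_mat(2)[OF W] using that k by (cases "i = k") simp_all
  qed
  have "\<phi> k * det W = (\<Sum>i<n. \<phi> i * (\<Sum>j<n. W $$ (i, j) * cofactor W k j))"
    using k by (simp add: adj if_distrib[of "\<lambda>x. _ * x"] cong: if_cong)
  also have "\<dots> = (\<Sum>i<n. \<Sum>j<n. \<phi> i * W $$ (i, j) * cofactor W k j)"
    by (simp add: sum_distrib_left mult.assoc)
  also have "\<dots> = (\<Sum>j<n. (\<Sum>i<n. \<phi> i * W $$ (i, j)) * cofactor W k j)"
    by (subst sum.swap) (simp add: sum_distrib_right)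
  also have "\<dots> = z * cofactor W k c"
    using c by (simp add: rel if_distrib[of "\<lambda>x. x * _"] cong: if_cong)
  finally show ?thesis .
qed

section \<open>The Alexander polynomial of the closure\<close>

context gauss_code
begin

text \<open>Not reduced modulo the number of arcs, in contrast to \<open>wirtinger_arc\<close>: the
  long knot has one arc more than underpasses, and closing it identifies the last with the
  first.\<close>

definition arc :: "nat \<Rightarrow> nat" where
  "arc k = length (filter (\<lambda>v. \<not> is_over v) (take k w))"

definition under_pos :: "nat \<Rightarrow> nat" where
  "under_pos i = filter (\<lambda>k. \<not> is_over (w ! k)) [0..<N] ! i"

abbreviation "n \<equiv> card unders"

lemma arc_Suc: "k < N \<Longrightarrow> arc (Suc k) = arc k + (if is_over (w ! k) then 0 else 1)"
  by (simp add: arc_def take_Suc_conv_app_nth)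

lemma arc_0: "arc 0 = 0"
  by (simp add: arc_def)

lemma arc_card: "k \<le> N \<Longrightarrow> arc k = card {l \<in> unders. l < k}"
proof (induction k)
  case (Suc k)
  hence k: "k < N" by simp
  show ?case
  proof (cases "is_over (w ! k)")
    case True
    hence "{l \<in> unders. l < Suc k} = {l \<in> unders. l < k}" by (auto simp: unders_def less_Suc_eq)
    thus ?thesis using Suc True by (simp add: arc_Suc[OF k])
  next
    case False
    hence "{l \<in> unders. l < Suc k} = insert k {l \<in> unders. l < k}" using k by (auto simp: unders_def less_Suc_eq)
    thus ?thesis using Suc False finite_unders by (simp add: arc_Suc[OF k])
  qed
qed (simp add: arc_0)

lemma arc_le: "k \<le> N \<Longrightarrow> arc k \<le> n"
  unfolding arc_card using finite_unders by (intro card_mono) auto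

lemma arc_length: "arc N = n"
proof -
  have "{l \<in> unders. l < N} = unders" by (auto simp: unders_def)
  thus ?thesis by (simp add: arc_card)
qed

lemma unders_list: "set (filter (\<lambda>k. \<not> is_over (w ! k)) [0..<N]) = unders"
  "length (filter (\<lambda>k. \<not> is_over (w ! k)) [0..<N]) = n"
proof -
  show 1: "set (filter (\<lambda>k. \<not> is_over (w ! k)) [0..<N]) = unders" by (auto simp: unders_def)
  show "length (filter (\<lambda>k. \<not> is_over (w ! k)) [0..<N]) = n"
    using distinct_card[of "filter (\<lambda>k. \<not> is_over (w ! k)) [0..<N]"] unfolding 1 by simp
qed

lemma under_bij: "bij_betw under_pos {..<n} unders"
proof -
  have "under_pos = (!) (filter (\<lambda>k. \<not> is_over (w ! k)) [0..<N])"
    by (simp add: fun_eq_iff under_pos_def)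
  thus ?thesis using unders_list by (simp only:) (intro bij_betw_nth; simp)
qed

lemma under_in: "i < n \<Longrightarrow> under_pos i \<in> unders"
  using under_bij by (auto simp: bij_betw_def)

lemma under_less: "i < n \<Longrightarrow> under_pos i < N" "i < n \<Longrightarrow> \<not> is_over (w ! under_pos i)"
  using under_in by (auto simp: unders_def)

lemma arc_under: "i < n \<Longrightarrow> arc (under_pos i) = i"
proof -
  assume i: "i < n"
  let ?us = "filter (\<lambda>k. \<not> is_over (w ! k)) [0..<N]"
  have sorted: "sorted_wrt (<) ?us" by (intro sorted_wrt_filter) simp
  have mono: "under_pos a < under_pos b" if "a < b" "b < n" for a b
    unfolding under_pos_def using that sorted by (intro sorted_wrt_nth_less[of "(<)"]) (simp_all add: unders_list)
  have "{l \<in> unders. l < under_pos i} = under_pos ` {..<i}"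
  proof (intro equalityI subsetI)
    fix l assume "l \<in> {l \<in> unders. l < under_pos i}"
    then obtain a where a: "a < n" "l = under_pos a" "under_pos a < under_pos i"
      using under_bij by (auto simp: bij_betw_def)
    hence "a < i" using mono[of i a] i by (metis linorder_neqE_nat order_less_asym)
    thus "l \<in> under_pos ` {..<i}" using a by blast
  qed (use mono under_in i in auto)
  moreover have "card (under_pos ` {..<i}) = i"
    using under_bij i by (subst card_image) (auto simp: bij_betw_def intro: inj_on_subset)
  ultimately show ?thesis using under_less[OF i] by (simp add: arc_card)
qed

lemma under_arc: "k \<in> unders \<Longrightarrow> under_pos (arc k) = k"
  using under_bij arc_under by (metis bij_betw_imp_surj_on imageE lessThan_iff)

lemma arc_less: "k \<in> unders \<Longrightarrow> arc k < n"
  using under_bij arc_under by (metis bij_betw_imp_surj_on imageE lessThan_iff)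

definition label :: "nat \<Rightarrow> nat" where
  "label i = crossing (w ! under_pos i)"

lemma label_bij: "bij_betw label {..<n} (crossing ` set w)"
  unfolding label_def using bij_betw_trans[OF under_bij crossing_bij] by (simp add: comp_def)

text \<open>Arc 0 is the initial arc of the strand; a later arc starts at the underpass numbered one
  less, hence the shift.\<close>

lemma follow_take: "k \<le> N \<Longrightarrow> follow (Inl x) (take k w) = (if arc k = 0 then Inl x else Inr (label (arc k - 1)))"
proof (induction k)
  case (Suc k)
  hence k: "k < N" by simp
  show ?case
  proof (cases "is_over (w ! k)")
    case True
    thus ?thesis using Suc by (simp add: take_Suc_conv_app_nth[OF k] follow_append arc_Suc[OF k])
  next
    case False
    hence "under_pos (arc k) = k" using k by (intro under_arc) (simp add: unders_def)
    thus ?thesis using False by (simp add: take_Suc_conv_app_nth[OF k] follow_append arc_Suc[OF k] label_def)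
  qed
qed (simp add: arc_0)

section \<open>The system of a long knot in Wirtinger numbering\<close>

definition tweight :: "nat \<Rightarrow> laurent" where
  "tweight i = tpow (if is_pos (w ! under_pos i) then 1 else - 1)"

definition over_arc :: "nat \<Rightarrow> nat" where
  "over_arc i = arc (mate w (under_pos i))"

lemma over_arc_le: "i < n \<Longrightarrow> over_arc i \<le> n"
  unfolding over_arc_def using mate(1)[OF under_less(1)] by (intro arc_le less_imp_le)

text \<open>
  The Wirtinger relations of the long knot on its \<open>n + 1\<close> arcs, with the column of the arc \<open>0\<close>
  deleted.
\<close>

definition wirtinger :: "nat \<Rightarrow> nat \<Rightarrow> laurent" where
  "wirtinger i j = of_bool (j = i) - tweight i * of_bool (Suc j = i) - (1 - tweight i) * of_bool (Suc j = over_arc i)"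

definition wirtinger_mat :: "laurent mat" where
  "wirtinger_mat = mat n n (\<lambda>(i, j). wirtinger i j)"

text \<open>Column \<open>j\<close> stands for arc \<open>j\<close> + 1, which leaves underpass
  \<open>j\<close> and so is the unknown of the crossing \<open>label j\<close>. Arc 0 is the input,
  which \<open>sys\<close> sets to zero.\<close>

lemma omega_wirtinger:
  assumes wf: "wf_diagram K" and K: "K x = Some w" "dom K = {x}"
  shows "omega K tvar = laurent_at (tvar x) (det wirtinger_mat)"
proof -
  interpret h: comm_ring_hom "laurent_at (tvar x)" by (rule laurent_at_hom[OF tvar_nonzero])
  have cr: "crossings K = crossing ` set w" using K by (simp add: crossings_def)
  have inj: "label i = label j \<longleftrightarrow> i = j" if "i < n" "j < n" for i j
    using label_bij that by (auto simp: bij_betw_def inj_on_def)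
  have data: "crossing_data K (label i) = (x, is_pos (w ! under_pos i),
      follow (Inl x) (take (mate w (under_pos i)) w), follow (Inl x) (take (under_pos i) w))" if i: "i < n" for i
  proof -
    let ?k = "under_pos i" and ?m = "mate w (under_pos i)"
    note k = under_less[OF i]
    have "w ! ?k = under_pass (label i) (is_pos (w ! ?k))" using k by (cases "w ! ?k") (simp add: label_def)
    moreover have "w ! ?m = over_pass (label i) (is_pos (w ! ?k))" using mate(6)[OF k(1)] k(2) by (simp add: label_def)
    ultimately have "K x = Some (take ?m w @ over_pass (label i) (is_pos (w ! ?k)) # drop (Suc ?m) w)"
      "K x = Some (take ?k w @ under_pass (label i) (is_pos (w ! ?k)) # drop (Suc ?k) w)"
      using K id_take_nth_drop[OF k(1)] id_take_nth_drop[OF mate(1)[OF k(1)]] by simp_all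
    thus ?thesis by (intro crossing_dataI[OF wf] crossing_atI)
  qed
  have weight: "weight tvar x (is_pos (w ! under_pos i)) = laurent_at (tvar x) (tweight i)" for i
    by (simp add: weight_def tweight_def laurent_at_tpow)
  have val: "arc_value (\<lambda>_. 0) (unit_at (label j)) (follow (Inl x) (take k w)) = of_bool (Suc j = arc k)"
    if "k \<le> N" "j < n" for k j
    using that arc_le[OF that(1)] inj[of "arc k - 1" j] by (auto simp: follow_take unit_at_def)
  have "sys K tvar (label i) (label j) = laurent_at (tvar x) (wirtinger i j)" if ij: "i < n" "j < n" for i j
  proof -
    have "under_pos i \<le> N" "mate w (under_pos i) \<le> N" using under_less[OF ij(1)] mate(1) by (simp_all add: less_imp_le)
    thus ?thesis
      using ij inj[of i j] unfolding sys_def rhs_def data[OF ij(1)]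
      by (simp add: weight val arc_under wirtinger_def over_arc_def h.hom_minus h.hom_mult unit_at_def of_bool_def)
  qed
  hence "omega K tvar = det (mat n n (\<lambda>(i, j). laurent_at (tvar x) (wirtinger i j)))"
    unfolding omega_def cr
    by (subst det_on_bij[OF label_bij[unfolded lessThan_atLeast0], of _ "\<lambda>i j. laurent_at (tvar x) (wirtinger i j)"])
       (simp_all add: det_on_mat)
  also have "mat n n (\<lambda>(i, j). laurent_at (tvar x) (wirtinger i j)) = map_mat (laurent_at (tvar x)) wirtinger_mat"
    by (intro eq_matI) (simp_all add: wirtinger_mat_def)
  finally show ?thesis by simp
qed

section \<open>The Alexander matrix of the closure\<close>

lemma num_arcs_eq: "num_arcs w = max 1 n"
  using arc_length by (simp add: num_arcs_def arc_def)

lemma wirtinger_arc_eq: "wirtinger_arc w k = arc k mod max 1 n"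
  by (simp add: wirtinger_arc_def arc_def num_arcs_eq)

lemma relators: "length (wirtinger_relators w) = n"
  "i < n \<Longrightarrow> wirtinger_relators w ! i = wirtinger_relator w (under_pos i)"
  by (simp_all add: wirtinger_relators_def under_pos_def unders_list)

lemma alexander_entry:
  assumes i: "i < n" and j: "j < n"
  shows "alexander_matrix w $$ (i, j) = (1 - tweight i) * of_bool (over_arc i mod n = j)
    + tweight i * of_bool (i = j) - of_bool (Suc i mod n = j)"
proof -
  have n: "max 1 n = n" using i by simp
  have arcs: "wirtinger_arc w (under_pos i) = i" "wirtinger_arc w (Suc (under_pos i)) = Suc i mod n"
    "wirtinger_arc w (mate w (under_pos i)) = over_arc i mod n"
    using i arc_Suc[OF under_less(1)[OF i]] under_less(2)[OF i]
    by (simp_all add: wirtinger_arc_eq n arc_under over_arc_def)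
  have fox: "fox j [(a, s), (b, True), (a, \<not> s), (c, False)]
      = (1 - tpow (if s then 1 else - 1)) * of_bool (a = j) + tpow (if s then 1 else - 1) * of_bool (b = j) - of_bool (c = j)"
    for a b c s
  proof -
    have t: "tpow 1 * (tpow (- 1) * x) = x" "tpow (- 1) * (tpow 1 * x) = x" for x
      by (simp_all add: tpow_neg flip: mult.assoc)
    show ?thesis by (cases s) (simp_all add: algebra_simps t of_bool_def)
  qed
  show ?thesis
    using i j relators unfolding alexander_matrix_def
    by (simp add: num_arcs_eq n wirtinger_relator_def Let_def arcs fox tweight_def)
qed

lemma alexander_carrier: "n > 0 \<Longrightarrow> alexander_matrix w \<in> carrier_mat n n"
  by (simp add: alexander_matrix_def relators num_arcs_eq)

text \<open>The coefficients are 1 - T, T and -1. This is the fundamental formula of Fox calculus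
  for a relator of exponent sum zero.\<close>

lemma alexander_row_sum:
  assumes i: "i < n"
  shows "(\<Sum>j<n. alexander_matrix w $$ (i, j)) = 0"
proof -
  have "(\<Sum>j<n. alexander_matrix w $$ (i, j)) = (\<Sum>j<n. (1 - tweight i) * of_bool (over_arc i mod n = j)
      + tweight i * of_bool (i = j) - of_bool (Suc i mod n = j))"
    by (rule sum.cong) (simp_all only: alexander_entry[OF i] lessThan_iff)
  hence "(\<Sum>j<n. alexander_matrix w $$ (i, j)) = (1 - tweight i) * (\<Sum>j<n. of_bool (over_arc i mod n = j))
      + tweight i * (\<Sum>j<n. of_bool (i = j)) - (\<Sum>j<n. of_bool (Suc i mod n = j))"
    unfolding sum.distrib sum_subtractf sum_distrib_left[symmetric] .
  moreover have "(\<Sum>j<n. of_bool (a = j)) = (1 :: laurent)" if "a < n" for a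
    using that by (simp add: of_bool_def)
  ultimately show ?thesis using i by simp
qed

text \<open>Closing the knot merges arcs 0 and \<open>n\<close>, which concerns column 0 here and
  the last column of \<open>wirtinger\<close>; the remaining columns correspond with a shift by one.
  The sign is due to the outgoing arc, inverted in the relator.\<close>

lemma alexander_wirtinger:
  assumes i: "i < n" and j: "Suc j < n"
  shows "alexander_matrix w $$ (i, Suc j) = - wirtinger i j"
proof -
  have "Suc i mod n = Suc j \<longleftrightarrow> i = j" using i j by (cases "Suc i = n") auto
  moreover have "over_arc i mod n = Suc j \<longleftrightarrow> Suc j = over_arc i"
    using over_arc_le[OF i] j by (cases "over_arc i = n") auto
  ultimately show ?thesis using i j
    by (simp add: alexander_entry wirtinger_def eq_commute[of i] algebra_simps)
qed

lemma det_delete_alexander: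
  assumes k: "k < n"
  shows "det (mat_delete (alexander_matrix w) k 0) = (- 1) ^ (n - 1) * det (mat_delete wirtinger_mat k (n - 1))"
proof -
  have n: "n > 0" using k by simp
  have "mat_delete (alexander_matrix w) k 0 = (- 1) \<cdot>\<^sub>m mat_delete wirtinger_mat k (n - 1)"
  proof (rule eq_matI)
    fix i j assume ij: "i < dim_row ((- 1) \<cdot>\<^sub>m mat_delete wirtinger_mat k (n - 1))"
      "j < dim_col ((- 1) \<cdot>\<^sub>m mat_delete wirtinger_mat k (n - 1))"
    hence ij': "i < n - 1" "j < n - 1" by (simp_all add: wirtinger_mat_def)
    have "insert_index k i < n" using ij'(1) unfolding insert_index_def by auto
    thus "mat_delete (alexander_matrix w) k 0 $$ (i, j) = ((- 1) \<cdot>\<^sub>m mat_delete wirtinger_mat k (n - 1)) $$ (i, j)"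
      using ij' alexander_carrier[OF n] alexander_wirtinger[of "insert_index k i" j]
      by (simp add: mat_delete_def wirtinger_mat_def insert_index_def split: if_splits)
  qed (use alexander_carrier[OF n] in \<open>simp_all add: wirtinger_mat_def\<close>)
  thus ?thesis by (simp add: wirtinger_mat_def)
qed

end

section \<open>Comparison of the first minors with the determinant\<close>

context planar_gauss_code
begin

text \<open>
  The rows of the Wirtinger matrix, weighted by powers of \<open>t\<close> given by the Alexander numbering, add up
  to a multiple of the relation that would identify the first and the last arc.
\<close>

lemma wirtinger_relation:
  assumes j: "j < n"
  shows "(\<Sum>i<n. tpow (- winding (Suc (under_pos i))) * wirtinger_mat $$ (i, j))
    = (if j = n - 1 then tpow (- winding N) else 0)"
proof -
  define F where "F e = tpow (- winding e)" for e
  define g :: "nat \<Rightarrow> laurent" where "g a = of_bool (a = Suc j)" for a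
  \<comment> \<open>A function on edges whose increments at the two passages of a crossing add up to
    the weighted matrix entry; summed over all passages these increments telescope along the
    knot.\<close>
  define h where "h e = F e * g (arc e)" for e
  have pair: "(h (Suc l) - h l) + (h (Suc (mate w l)) - h (mate w l))
      = F (Suc l) * wirtinger_mat $$ (arc l, j)" if l: "l \<in> unders" for l
  proof -
    have l': "l < N" "\<not> is_over (w ! l)" using l by (simp_all add: unders_def)
    let ?m = "mate w l" and ?T = "tweight (arc l)"
    have T: "?T = tpow (if is_pos (w ! l) then 1 else - 1)" by (simp add: tweight_def under_arc[OF l])
    have Fl: "F l = ?T * F (Suc l)"
      using winding_under(2)[OF l] by (simp add: F_def T flip: tpow_add)
    have Fm: "F ?m = F (Suc l)" "F (Suc ?m) = ?T * F (Suc l)"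
      using winding_under(1,3)[OF l] Fl by (simp_all add: F_def)
    have arcs: "arc (Suc l) = Suc (arc l)" "arc (Suc ?m) = arc ?m"
      using l' mate[OF l'(1)] by (simp_all add: arc_Suc)
    have W: "wirtinger_mat $$ (arc l, j) = g (Suc (arc l)) - ?T * g (arc l) - (1 - ?T) * g (arc ?m)"
      using arc_less[OF l] j
      by (simp add: wirtinger_mat_def wirtinger_def g_def over_arc_def under_arc[OF l]
          eq_commute[of j] eq_commute[of "Suc j"])
    show ?thesis unfolding W h_def Fl Fm arcs by (simp only: algebra_simps) simp
  qed
  have split: "{..<N} = unders \<union> overs" "unders \<inter> overs = {}" by (auto simp: unders_def overs_def)
  have "(\<Sum>i<n. F (Suc (under_pos i)) * wirtinger_mat $$ (i, j)) = (\<Sum>i<n. F (Suc (under_pos i)) * wirtinger_mat $$ (arc (under_pos i), j))"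
    by (simp add: arc_under)
  also have "\<dots> = (\<Sum>l\<in>unders. F (Suc l) * wirtinger_mat $$ (arc l, j))"
    by (rule sum.reindex_bij_betw[OF under_bij])
  also have "\<dots> = (\<Sum>l\<in>unders. h (Suc l) - h l) + (\<Sum>l\<in>unders. h (Suc (mate w l)) - h (mate w l))"
    by (simp add: pair flip: sum.distrib)
  also have "(\<Sum>l\<in>unders. h (Suc (mate w l)) - h (mate w l)) = (\<Sum>l\<in>overs. h (Suc l) - h l)"
    by (rule sum.reindex_bij_betw[OF mate_bij])
  also have "(\<Sum>l\<in>unders. h (Suc l) - h l) + (\<Sum>l\<in>overs. h (Suc l) - h l) = (\<Sum>l<N. h (Suc l) - h l)"
    unfolding split(1) using finite_unders split(2) by (intro sum.union_disjoint[symmetric])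
  also have "\<dots> = h N - h 0" by (rule sum_lessThan_telescope)
  finally have "(\<Sum>i<n. F (Suc (under_pos i)) * wirtinger_mat $$ (i, j)) = h N - h 0" .
  \<comment> \<open>Edge \<open>N\<close> lies on arc \<open>n\<close>, the arc of the last column,
    and edge 0 on arc 0, which has no column.\<close>
  moreover have "h N = (if j = n - 1 then F N else 0)" "h 0 = 0"
    using j by (auto simp: h_def g_def arc_length arc_0)
  ultimately show ?thesis unfolding F_def by simp
qed

lemma first_minors_associated:
  assumes d: "d \<in> first_minors w"
  shows "\<exists>z. d = tpow z * det wirtinger_mat \<or> d = - (tpow z * det wirtinger_mat)"
proof (cases "n = 0")
  \<comment> \<open>Without crossings there is still one arc, and the only minor is the empty
    determinant 1.\<close>
  case True
  obtain I J where IJ: "I \<subseteq> {..<n}" "J \<subseteq> {..<max 1 n}" "card J = max 1 n - 1"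
    "d = det (submatrix (alexander_matrix w) I J)"
    using d unfolding first_minors_def relators num_arcs_eq by blast
  have "card J = 0" "finite J" using IJ(3) finite_subset[OF IJ(2)] unfolding True by simp_all
  hence J: "J = {}" by simp
  have I: "I = {}" using IJ(1) unfolding True by simp
  have "submatrix (alexander_matrix w) {} {} \<in> carrier_mat 0 0"
    by (rule carrier_matI) (simp_all add: dim_submatrix)
  hence "d = 1" unfolding IJ(4) I J by (rule det_dim_zero)
  moreover have "det wirtinger_mat = 1" by (rule det_dim_zero) (simp add: wirtinger_mat_def True)
  ultimately show ?thesis by (intro exI[of _ 0]) (simp add: tpow_0)
next
  case False
  hence n: "n > 0" "max 1 n = n" by simp_all
  note A = alexander_carrier[OF n(1)]
  obtain I J where IJ: "I \<subseteq> {..<n}" "J \<subseteq> {..<n}" "card I = n - 1" "card J = n - 1"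
    "d = det (submatrix (alexander_matrix w) I J)"
    using d unfolding first_minors_def relators num_arcs_eq n(2) by blast
  obtain k where k: "k < n" "I = {..<n} - {k}" using subset_card_pred[OF IJ(1,3) n(1)] .
  obtain l where l: "l < n" "J = {..<n} - {l}" using subset_card_pred[OF IJ(2,4) n(1)] .
  let ?D = "det wirtinger_mat" and ?W = "det (mat_delete wirtinger_mat k (n - 1))"
  have sq: "(- 1) ^ a * ((- 1) ^ a * x) = (x :: laurent)" for a x
    by (simp flip: mult.assoc power_mult_distrib)
  have d: "d = (- 1) ^ (k + l) * cofactor (alexander_matrix w) k l"
    unfolding IJ(5) k(2) l(2) submatrix_delete[OF A k(1) l(1)] by (simp add: cofactor_def sq)
  \<comment> \<open>Vanishing row sums allow the deleted column to be moved to column 0, the one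
    affected by the closure.\<close>
  also have "cofactor (alexander_matrix w) k l = cofactor (alexander_matrix w) k 0"
    by (rule cofactor_row_const[OF A alexander_row_sum k(1) l(1) n(1)])
  also have "\<dots> = (- 1) ^ k * (- 1) ^ (n - 1) * ?W"
    by (simp add: cofactor_def det_delete_alexander[OF k(1)])
  finally have d: "d = (- 1) ^ (k + l) * ((- 1) ^ k * (- 1) ^ (n - 1) * ?W)" .
  have carrier: "wirtinger_mat \<in> carrier_mat n n" and last: "n - 1 < n"
    using n(1) by (simp_all add: wirtinger_mat_def)
  have "tpow (- winding (Suc (under_pos k))) * ?D = tpow (- winding N) * cofactor wirtinger_mat k (n - 1)"
    by (rule left_eigen_cofactor[OF carrier k(1) last wirtinger_relation])
  hence "tpow (winding N) * (tpow (- winding (Suc (under_pos k))) * ?D) = cofactor wirtinger_mat k (n - 1)"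
    by (simp add: tpow_neg flip: mult.assoc)
  hence "tpow (winding N - winding (Suc (under_pos k))) * ?D = (- 1) ^ (k + (n - 1)) * ?W"
    by (simp add: cofactor_def flip: mult.assoc tpow_add)
  hence "?W = (- 1) ^ (k + (n - 1)) * (tpow (winding N - winding (Suc (under_pos k))) * ?D)"
    by (simp add: sq)
  hence "d = (- 1) ^ (k + l + k + (n - 1) + (k + (n - 1))) * (tpow (winding N - winding (Suc (under_pos k))) * ?D)"
    unfolding d by (simp add: power_add mult_ac)
  thus ?thesis by (cases "even (k + l + k + (n - 1) + (k + (n - 1)))") auto
qed

lemma first_minors_nonempty: "first_minors w \<noteq> {}"
proof -
  have "{..<n} - {0} \<subseteq> {..<length (wirtinger_relators w)}" "{..<n} - {0} \<subseteq> {..<num_arcs w}"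
    "card ({..<n} - {0}) = num_arcs w - 1"
    by (auto simp: relators num_arcs_eq card_Diff_singleton_if max_def)
  thus ?thesis unfolding first_minors_def by blast
qed

text \<open>All minors are unit multiples of the determinant, so it is itself a greatest common
  divisor of them. The chosen polynomial is another, and two that divide each other differ by a
  unit.\<close>

lemma alexander_polynomial_associated:
  obtains z where "det wirtinger_mat = tpow z * alexander_polynomial w \<or>
    det wirtinger_mat = - (tpow z * alexander_polynomial w)"
proof -
  let ?D = "det wirtinger_mat" and ?A = "alexander_polynomial w"
  have dvd1: "?D dvd d" if "d \<in> first_minors w" for d
    using first_minors_associated[OF that] by auto
  obtain d0 where d0: "d0 \<in> first_minors w" using first_minors_nonempty by blast
  have dvd2: "d0 dvd ?D"
  proof -
    obtain z where "d0 = tpow z * ?D \<or> d0 = - (tpow z * ?D)" using first_minors_associated[OF d0] by blast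
    hence "?D = tpow (- z) * d0 \<or> ?D = - (tpow (- z) * d0)"
      by (auto simp: tpow_neg simp flip: mult.assoc)
    thus ?thesis by auto
  qed
  have "is_alexander_polynomial w ?D"
    unfolding is_alexander_polynomial_def using dvd1 d0 dvd_trans[OF _ dvd2] by simp
  hence A: "is_alexander_polynomial w ?A"
    unfolding alexander_polynomial_def by (rule someI[of "is_alexander_polynomial w"])
  hence "?A dvd d0" using d0 by (simp add: is_alexander_polynomial_def)
  hence "?A dvd ?D" using dvd2 by (rule dvd_trans)
  then obtain u where u: "?D = ?A * u" by (rule dvdE)
  have "?D dvd ?A" using A dvd1 by (simp add: is_alexander_polynomial_def)
  then obtain v where v: "?A = ?D * v" by (rule dvdE)
  \<comment> \<open>The unit comes from cancelling the chosen polynomial, so the case where it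
    vanishes is separate; then both sides are 0.\<close>
  show thesis
  proof (cases "?A = 0")
    case True
    thus ?thesis using u that[of 0] by simp
  next
    case False
    have "?A * (u * v) = ?A * 1" using u v by (metis mult.assoc mult.right_neutral)
    hence "u * v = 1" unfolding mult_cancel_left using False by blast
    then obtain z where "u = tpow z \<or> u = - tpow z" by (rule laurent_unit)
    thus ?thesis using that[of z] u by (auto simp: mult.commute)
  qed
qed

end

theorem proposition10:
  fixes K :: wdiagram
  assumes "long_knot K"
  shows "\<exists>\<omega>. phi K = Gelem {1} \<omega> (\<lambda>i j. if i = 1 \<and> j = 1 then 1 else 0) \<and>
             eq_up_to_units (tvar 1) \<omega> (laurent_at (tvar 1) (alexander_polynomial (trivial_closure K)))"
proof -
  have wf: "wf_diagram K" and dom: "dom K = {1}" and planar: "planar_code (the (K 1))"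
    using assms by (simp_all add: long_knot_def)
  obtain w where K: "K 1 = Some w" using dom by auto
  interpret gauss_code w by (rule wf_gauss_code[OF wf K dom])
  interpret planar_gauss_code w by unfold_locales (use planar K in simp)
  interpret h: comm_ring_hom "laurent_at (tvar 1)" by (rule laurent_at_hom[OF tvar_nonzero])
  obtain z where "det wirtinger_mat = tpow z * alexander_polynomial w \<or>
    det wirtinger_mat = - (tpow z * alexander_polynomial w)"
    by (rule alexander_polynomial_associated)
  hence "eq_up_to_units (tvar 1) (omega K tvar) (laurent_at (tvar 1) (alexander_polynomial w))"
    unfolding eq_up_to_units_def omega_wirtinger[OF wf K dom]
    by (intro exI[of _ z]) (auto simp: h.hom_mult h.hom_uminus laurent_at_tpow simp del: One_nat_def)
  moreover have "trivial_closure K = w" using K by (simp add: trivial_closure_def)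
  ultimately show ?thesis using phi_long_knot[OF wf dom] by blast
qed

end
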